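(* Let $\varrho$, $\varrho^{(n)}$, $f_1,\dots,f_{k+1}$, $\bar f_j$, $\mu_j$, $I_j$, $\mathcal H$ and $\xi_j(\cdot)$ be as defined in the context. Suppose the following conditions are satisfied: (i) $\int \|f_j(\eta_j,x)\|^2\,P(dx)<\infty$ for all $\eta_j\in I_j$, $j=1,\dots,k$, and $\int \|f_{k+1}(x)\|^2\,P(dx)<\infty$; (ii) for all $x\in\mathcal X$, the functions $f_j(\cdot,x)$, $j=1,\dots,k$, are Lipschitz continuous on $I_j$: $$\|f_j(\eta_j',x)-f_j(\eta_j'',x)\|\le \gamma_j(x)\,\|\eta_j'-\eta_j''\|\quad\text{for all }\eta_j',\eta_j''\in I_j,$$ and $\int\gamma_j^2(x)\,P(dx)<\infty$; (iii) for all $x\in\mathcal X$, the functions $f_j(\cdot,x)$, $j=1,\dots,k$, are Hadamard directionally differentiable. Then $$\sqrt n\,\big[\varrho^{(n)}-\varrho\big]\xrightarrow{\ \mathcal D\ }\xi_1(W)\qquad (n\to\infty),$$ where $W(\cdot)=(W_1(\cdot),\dots,W_k(\cdot),W_{k+1})$ is a zero-mean Brownian process on $I=I_1\times\cdots\times I_k$; here $W_j(\cdot)$ is a Brownian process of dimension $m_{j-1}$ on $I_j$, $j=1,\dots,k$, and $W_{k+1}$ is an $m_k$-dimensional normal vector. The covariance function of $W$ is $$\mathrm{cov}[W_i(\eta_i),W_j(\eta_j)]=\int_{\mathcal X}[f_i(\eta_i,x)-\bar f_i(\eta_i)][f_j(\eta_j,x)-\bar f_j(\eta_j)]^\top P(dx),\quad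 \eta_i\in I_i,\ \eta_j\in I_j,\ i,j=1,\dots,k,$$ $$\mathrm{cov}[W_i(\eta_i),W_{k+1}]=\int_{\mathcal X}[f_i(\eta_i,x)-\bar f_i(\eta_i)][f_{k+1}(x)-\mu_{k+1}]^\top P(dx),\quad \eta_i\in I_i,\ i=1,\dots,k,$$ $$\mathrm{cov}[W_{k+1},W_{k+1}]=\int_{\mathcal X}[f_{k+1}(x)-\mu_{k+1}][f_{k+1}(x)-\mu_{k+1}]^\top P(dx).$$
   Context: $X$ is an $m$-dimensional random vector with probability distribution $P$ and domain (set of values) $\mathcal X\subset\mathbb R^m$. Let $k\ge 1$, $m_0=1$, $m_1,\dots,m_k\ge1$ be integers, $f_j:\mathbb R^{m_j}\times\mathbb R^m\to\mathbb R^{m_{j-1}}$ for $j=1,\dots,k$, and $f_{k+1}:\mathbb R^m\to\mathbb R^{m_k}$. The composite functional is $$\varrho=\mathbb E\Big[f_1\Big(\mathbb E\big[f_2\big(\mathbb E[\cdots f_k(\mathbb E[f_{k+1}(X)],X)]\cdots,X\big)\big],X\Big)\Big].$$ Given independent identically distributed observations $X_1,\dots,X_n$ of $X$, the plug-in empirical estimator is $$\varrho^{(n)}=\sum_{i_0=1}^n\frac1n\Big[f_1\Big(\sum_{i_1=1}^n\frac1n\big[f_2\big(\sum_{i_2=1}^n\frac1n[\cdots f_k(\sum_{i_k=1}^n\frac1n f_{k+1}(X_{i_k}),X_{i_{k-1}})]\cdots,X_{i_1}\big)\big],X_{i_0}\Big)\Big].$$ Define $\bar f_j(\eta_j)=\int_{\mathcal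 X}f_j(\eta_j,x)\,P(dx)$ for $j=1,\dots,k$, $\mu_{k+1}=\int_{\mathcal X}f_{k+1}(x)\,P(dx)$, and $\mu_j=\bar f_j(\mu_{j+1})$ for $j=k,k-1,\dots,1$ (so $\mu_1=\varrho$). The sets $I_j\subset\mathbb R^{m_j}$ are compact with $\mu_{j+1}\in\mathrm{int}(I_j)$, $j=1,\dots,k$. $\mathcal H=\mathcal C_1(I_1)\times\mathcal C_{m_1}(I_2)\times\cdots\times\mathcal C_{m_{k-1}}(I_k)\times\mathbb R^{m_k}$, where $\mathcal C_{m_{j-1}}(I_j)$ is the space of continuous functions $I_j\to\mathbb R^{m_{j-1}}$ with the supremum norm; $\mathcal H$ carries the product norm. The Hadamard directional derivative of $f_j(\cdot,x)$ at $\mu$ in direction $\zeta$ is $$f_j'(\mu,x;\zeta)=\lim_{t\downarrow0,\ s\to\zeta}\frac1t\big[f_j(\mu+ts,x)-f_j(\mu,x)\big];$$ $f_j(\cdot,x)$ is Hadamard directionally differentiable if this limit exists in every direction. For $d=(d_1,\dots,d_k,d_{k+1})\in\mathcal H$ define recursively $$\xi_{k+1}(d)=d_{k+1},\qquad \xi_j(d)=\int_{\mathcal X}f_j'\big(\mu_{j+1},x;\xi_{j+1}(d)\big)\,P(dx)+d_j(\mu_{j+1}),\quad j=k,k-1,\dots,1.$$ A "zero-mean Brownian process" means a zero-mean (jointly) Gaussian process with continuous sample paths and the stated covariance function; thus $W$ is a random element of $\mathcal H$. $\xrightarrow{\mathcal D}$ denotes convergence in distribution. *)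

theory Defs
  imports "HOL-Probability.Probability"
begin

text \<open>
  The dimensions \<open>m 0, \<dots>, m k\<close> vary with the level, so a vector of dimension \<open>d\<close> is a sequence
  vanishing from index \<open>d\<close> on, i.e. a point of the library topology \<^const>\<open>Euclidean_space\<close> \<open>d\<close>.
\<close>

type_synonym rvec = "nat \<Rightarrow> real"

abbreviation Rvec :: "nat \<Rightarrow> rvec set" where
  "Rvec d \<equiv> topspace (Euclidean_space d)"

definition vnorm :: "nat \<Rightarrow> rvec \<Rightarrow> real" where
  "vnorm d v = L2_set v {..<d}"

definition vdiff :: "rvec \<Rightarrow> rvec \<Rightarrow> rvec" where
  "vdiff u v = (\<lambda>i. u i - v i)"

definition vint :: "'x measure \<Rightarrow> ('x \<Rightarrow> rvec) \<Rightarrow> rvec" where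
  "vint P h = (\<lambda>i. \<integral>x. h x i \<partial>P)"

definition sample_mean :: "(nat \<Rightarrow> 'x) \<Rightarrow> nat \<Rightarrow> ('x \<Rightarrow> rvec) \<Rightarrow> rvec" where
  "sample_mean x n h = (\<lambda>i. \<Sum>l=1..n. (1 / real n) * h (x l) i)"


section \<open>Composite functionals\<close>

text \<open>
  The nested expression built from an averaging operator \<open>A\<close> (expectation or sample mean):
  the value at level \<open>k + 1\<close> is \<open>A g\<close>, and the value at level \<open>j \<le> k\<close> is
  \<open>A (\<lambda>x. f j v x)\<close>, where \<open>v\<close> is the value at level \<open>j + 1\<close>.  Here \<open>g\<close> plays the role of
  \<open>f\<^bsub>k+1\<^esub>\<close>, which has no vector argument.
\<close>

function nested ::
  "(('x \<Rightarrow> rvec) \<Rightarrow> rvec) \<Rightarrow> nat \<Rightarrow> (nat \<Rightarrow> rvec \<Rightarrow> 'x \<Rightarrow> rvec) \<Rightarrow> ('x \<Rightarrow> rvec) \<Rightarrow> nat \<Rightarrow> rvec" where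
  "nested A k f g j = (if j \<le> k then A (f j (nested A k f g (Suc j))) else A g)"
  by pat_completeness auto
termination by (relation "Wellfounded.measure (\<lambda>(A, k, f, g, j). Suc k - j)") auto

declare nested.simps [simp del]

definition fbar :: "'x measure \<Rightarrow> (nat \<Rightarrow> rvec \<Rightarrow> 'x \<Rightarrow> rvec) \<Rightarrow> nat \<Rightarrow> rvec \<Rightarrow> rvec" where
  "fbar P f j \<eta> = vint P (f j \<eta>)"

definition mu ::
  "'x measure \<Rightarrow> nat \<Rightarrow> (nat \<Rightarrow> rvec \<Rightarrow> 'x \<Rightarrow> rvec) \<Rightarrow> ('x \<Rightarrow> rvec) \<Rightarrow> nat \<Rightarrow> rvec" where
  "mu P k f g j = nested (vint P) k f g j"

lemma mu_last: "mu P k f g (Suc k) = vint P g"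
  unfolding mu_def by (subst nested.simps) simp

lemma mu_step: "j \<le> k \<Longrightarrow> mu P k f g j = fbar P f j (mu P k f g (Suc j))"
  unfolding mu_def fbar_def by (subst nested.simps) simp

text \<open>Level \<open>1\<close> takes values in \<open>\<real>\<^sup>1\<close>; the functionals are its only coordinate.\<close>

definition rho :: "'x measure \<Rightarrow> nat \<Rightarrow> (nat \<Rightarrow> rvec \<Rightarrow> 'x \<Rightarrow> rvec) \<Rightarrow> ('x \<Rightarrow> rvec) \<Rightarrow> real" where
  "rho P k f g = nested (vint P) k f g 1 0"

definition rho_emp ::
  "nat \<Rightarrow> (nat \<Rightarrow> rvec \<Rightarrow> 'x \<Rightarrow> rvec) \<Rightarrow> ('x \<Rightarrow> rvec) \<Rightarrow> (nat \<Rightarrow> 'x) \<Rightarrow> nat \<Rightarrow> real" where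
  "rho_emp k f g x n = nested (sample_mean x n) k f g 1 0"


section \<open>Hadamard directional derivatives\<close>

definition has_hadamard_deriv ::
  "nat \<Rightarrow> nat \<Rightarrow> (rvec \<Rightarrow> rvec) \<Rightarrow> rvec \<Rightarrow> rvec \<Rightarrow> rvec \<Rightarrow> bool" where
  "has_hadamard_deriv d d' h v \<zeta> L \<longleftrightarrow>
     limitin (Euclidean_space d')
       (\<lambda>(t, s). (\<lambda>i. (1 / t) * (h (\<lambda>l. v l + t * s l) i - h v i))) L
       (at_right 0 \<times>\<^sub>F nhdsin (Euclidean_space d) \<zeta>)"

definition hadamard_differentiable_at ::
  "nat \<Rightarrow> nat \<Rightarrow> (rvec \<Rightarrow> rvec) \<Rightarrow> rvec \<Rightarrow> bool" where
  "hadamard_differentiable_at d d' h v \<longleftrightarrow>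
     (\<forall>\<zeta>\<in>Rvec d. \<exists>L. has_hadamard_deriv d d' h v \<zeta> L)"

definition hadamard_deriv ::
  "nat \<Rightarrow> nat \<Rightarrow> (rvec \<Rightarrow> rvec) \<Rightarrow> rvec \<Rightarrow> rvec \<Rightarrow> rvec" where
  "hadamard_deriv d d' h v \<zeta> = (THE L. has_hadamard_deriv d d' h v \<zeta> L)"


section \<open>The product space and the functionals on it\<close>

text \<open>
  An element of the product space is a pair of the family \<open>(d\<^sub>1, \<dots>, d\<^sub>k)\<close> and the vector
  \<open>d\<^bsub>k+1\<^esub>\<close>.  Functions are extensional, so that they are determined by their values on \<open>I j\<close>.
\<close>

type_synonym path = "(nat \<Rightarrow> rvec \<Rightarrow> rvec) \<times> rvec"

definition cont_funs :: "nat \<Rightarrow> nat \<Rightarrow> rvec set \<Rightarrow> (rvec \<Rightarrow> rvec) set" where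
  "cont_funs d d' J =
     {h \<in> extensional J. continuous_map (subtopology (Euclidean_space d) J) (Euclidean_space d') h}"

definition path_space :: "nat \<Rightarrow> (nat \<Rightarrow> nat) \<Rightarrow> (nat \<Rightarrow> rvec set) \<Rightarrow> path set" where
  "path_space k m I = (\<Pi>\<^sub>E j\<in>{1..k}. cont_funs (m j) (m (j - 1)) (I j)) \<times> Rvec (m k)"

function xi ::
  "'x measure \<Rightarrow> nat \<Rightarrow> (nat \<Rightarrow> nat) \<Rightarrow> (nat \<Rightarrow> rvec \<Rightarrow> 'x \<Rightarrow> rvec) \<Rightarrow> ('x \<Rightarrow> rvec) \<Rightarrow> path \<Rightarrow> nat \<Rightarrow> rvec"
  where
  "xi P k m f g d j =
     (if j \<le> k
      then (\<lambda>i. vint P (\<lambda>x. hadamard_deriv (m j) (m (j - 1)) (\<lambda>\<eta>. f j \<eta> x)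
                               (mu P k f g (Suc j)) (xi P k m f g d (Suc j))) i
                + fst d j (mu P k f g (Suc j)) i)
      else snd d)"
  by pat_completeness auto
termination by (relation "Wellfounded.measure (\<lambda>(P, k, m, f, g, d, j). Suc k - j)") auto

declare xi.simps [simp del]


section \<open>Gaussian processes\<close>

text \<open>Degenerate normal distributions are admitted, as covariance matrices may be singular.\<close>

definition normal_rv :: "'w measure \<Rightarrow> ('w \<Rightarrow> real) \<Rightarrow> bool" where
  "normal_rv N Y \<longleftrightarrow> Y \<in> borel_measurable N \<and>
     ((\<exists>a. AE w in N. Y w = a) \<or>
      (\<exists>a \<sigma>. 0 < \<sigma> \<and> distributed N lborel Y (\<lambda>y. ennreal (normal_density a \<sigma> y))))"

definition gaussian_process :: "'w measure \<Rightarrow> 't set \<Rightarrow> ('t \<Rightarrow> 'w \<Rightarrow> real) \<Rightarrow> bool" where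
  "gaussian_process N T Z \<longleftrightarrow>
     (\<forall>S a. finite S \<and> S \<subseteq> T \<longrightarrow> normal_rv N (\<lambda>w. \<Sum>t\<in>S. a t * Z t w))"

definition mean :: "'w measure \<Rightarrow> ('w \<Rightarrow> real) \<Rightarrow> real" where
  "mean N Y = (\<integral>w. Y w \<partial>N)"

definition cov :: "'w measure \<Rightarrow> ('w \<Rightarrow> real) \<Rightarrow> ('w \<Rightarrow> real) \<Rightarrow> real" where
  "cov N Y Z = (\<integral>w. (Y w - mean N Y) * (Z w - mean N Z) \<partial>N)"

text \<open>
  The scalar coordinates of an element of the product space: \<open>Inl (j, \<eta>, a)\<close> stands for
  coordinate \<open>a\<close> of \<open>d\<^sub>j(\<eta>)\<close>, and \<open>Inr b\<close> for coordinate \<open>b\<close> of \<open>d\<^bsub>k+1\<^esub>\<close>.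
\<close>

type_synonym index = "(nat \<times> rvec \<times> nat) + nat"

definition index_set :: "nat \<Rightarrow> (nat \<Rightarrow> nat) \<Rightarrow> (nat \<Rightarrow> rvec set) \<Rightarrow> index set" where
  "index_set k m I = {(j, \<eta>, a). j \<in> {1..k} \<and> \<eta> \<in> I j \<and> a < m (j - 1)} <+> {..<m k}"

definition coord :: "path \<Rightarrow> index \<Rightarrow> real" where
  "coord d t = (case t of Inl (j, \<eta>, a) \<Rightarrow> fst d j \<eta> a | Inr b \<Rightarrow> snd d b)"

text \<open>The covariance matrices are given entrywise.\<close>

definition brownian_process ::
  "'w measure \<Rightarrow> 'x measure \<Rightarrow> nat \<Rightarrow> (nat \<Rightarrow> nat) \<Rightarrow> (nat \<Rightarrow> rvec set) \<Rightarrow>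
   (nat \<Rightarrow> rvec \<Rightarrow> 'x \<Rightarrow> rvec) \<Rightarrow> ('x \<Rightarrow> rvec) \<Rightarrow> ('w \<Rightarrow> path) \<Rightarrow> bool" where
  "brownian_process N P k m I f g W \<longleftrightarrow>
     prob_space N \<and>
     W \<in> space N \<rightarrow> path_space k m I \<and>
     gaussian_process N (index_set k m I) (\<lambda>t w. coord (W w) t) \<and>
     (\<forall>t\<in>index_set k m I. mean N (\<lambda>w. coord (W w) t) = 0) \<and>
     (\<forall>i\<in>{1..k}. \<forall>j\<in>{1..k}. \<forall>\<eta>\<in>I i. \<forall>\<theta>\<in>I j. \<forall>a<m (i - 1). \<forall>b<m (j - 1).
        cov N (\<lambda>w. fst (W w) i \<eta> a) (\<lambda>w. fst (W w) j \<theta> b) =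
          (\<integral>x. (f i \<eta> x a - fbar P f i \<eta> a) * (f j \<theta> x b - fbar P f j \<theta> b) \<partial>P)) \<and>
     (\<forall>i\<in>{1..k}. \<forall>\<eta>\<in>I i. \<forall>a<m (i - 1). \<forall>b<m k.
        cov N (\<lambda>w. fst (W w) i \<eta> a) (\<lambda>w. snd (W w) b) =
          (\<integral>x. (f i \<eta> x a - fbar P f i \<eta> a) * (g x b - mu P k f g (Suc k) b) \<partial>P)) \<and>
     (\<forall>a<m k. \<forall>b<m k.
        cov N (\<lambda>w. snd (W w) a) (\<lambda>w. snd (W w) b) =
          (\<integral>x. (g x a - mu P k f g (Suc k) a) * (g x b - mu P k f g (Suc k) b) \<partial>P))"


section \<open>Convergence in distribution\<close>

definition converges_in_distribution ::
  "'a measure \<Rightarrow> (nat \<Rightarrow> 'a \<Rightarrow> real) \<Rightarrow> 'w measure \<Rightarrow> ('w \<Rightarrow> real) \<Rightarrow> bool" where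
  "converges_in_distribution M Y N Z \<longleftrightarrow>
     (\<forall>n. Y n \<in> borel_measurable M) \<and> Z \<in> borel_measurable N \<and>
     weak_conv_m (\<lambda>n. distr M borel (Y n)) (distr N borel Z)"

end

theory Submission
  imports Defs "HOL-Real_Asymp.Real_Asymp"
begin

text \<open>
  Although the limit is expressed through a process, \<open>\<xi>\<^sub>1(W)\<close> depends on \<open>W\<close> only through \<open>W\<^sub>j(\<mu>\<^bsub>j+1\<^esub>)\<close> and
  \<open>W\<^bsub>k+1\<^esub>\<close>, so a finite-dimensional central limit theorem suffices for the convergence. With \<open>\<nu>\<^sub>j\<close> the
  empirical counterpart of \<open>\<mu>\<^sub>j\<close> and \<open>\<zeta>\<^sub>j = sqrt n (\<nu>\<^sub>j - \<mu>\<^sub>j)\<close>, one has \<open>\<zeta>\<^sub>j = A\<^sub>j(\<zeta>\<^bsub>j+1\<^esub>) + G\<^sub>j\<close>, where \<open>G\<^sub>j\<close> is the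
  normalized empirical mean of \<open>f\<^sub>j(\<mu>\<^bsub>j+1\<^esub>, \<cdot>)\<close> and \<open>A\<^sub>j(s)\<close> averages the difference quotients
  \<open>sqrt n (f\<^sub>j(\<mu>\<^bsub>j+1\<^esub> + s / sqrt n, X\<^sub>i) - f\<^sub>j(\<mu>\<^bsub>j+1\<^esub>, X\<^sub>i))\<close>. On bounded sets of \<open>s\<close> these averages converge uniformly in
  probability to the integrated directional derivative: pointwise by Chebyshev's inequality and dominated
  convergence, uniformly because they are Lipschitz in \<open>s\<close> with a constant bounded in probability. Hence
  \<open>\<zeta>\<^sub>1\<close> differs from a Lipschitz function of \<open>G\<close> by a null sequence.

  The process \<open>W\<close> is built from independent normal variables: a Gram--Schmidt process in \<open>L\<^sup>2(P)\<close> gives its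
  values on finite nets of mesh \<open>4\<^sup>-\<^sup>p\<close>, and the continuous interpolations of these values converge uniformly
  almost surely by the Borel--Cantelli lemma, since Gaussian increments have moments of all orders.
\<close>

section \<open>Centred Gaussian random variables\<close>

text \<open>A Hadamard directional derivative is in general not linear in its direction, so the
  limit need not be Gaussian and characteristic functions cannot be compared after the recursion.
  They are compared before it: a linear combination of empirical means is itself an empirical mean,
  so the one-dimensional central limit theorem yields the limit of its characteristic function. A
  Cramer--Wold argument for bounded Lipschitz functions then carries the comparison through the
  recursion, which is a Lipschitz map of finitely many numbers. A second obstacle is that the
  Lipschitz condition holds only on \<open>I j\<close>, whereas the inner empirical averages may
  leave that set. Tightness resolves it: with high probability they differ from their limits by a
  bounded multiple of \<open>1 / sqrt n\<close>, hence lie in a ball inside \<open>I j\<close>.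
  Tightness must therefore be propagated from the innermost level outwards together with the
  linearization.\<close>

text \<open>The law is written as an image of the standard normal law instead of by a density, so
  that variance \<open>v = 0\<close>, the point mass at 0, is no exception.\<close>

definition centred_gaussian :: "'w measure \<Rightarrow> ('w \<Rightarrow> real) \<Rightarrow> real \<Rightarrow> bool" where
  "centred_gaussian N Y v \<longleftrightarrow> Y \<in> borel_measurable N \<and> 0 \<le> v \<and>
     distr N borel Y = distr std_normal_distribution borel (\<lambda>z. sqrt v * z)"

lemma centred_gaussianD:
  assumes "centred_gaussian N Y v"
  shows "Y \<in> borel_measurable N" "0 \<le> v"
    "distr N borel Y = distr std_normal_distribution borel (\<lambda>z. sqrt v * z)"
  using assms by (auto simp: centred_gaussian_def)

interpretation std_normal: real_distribution std_normal_distribution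
  by (rule real_dist_normal_dist)

lemma char_distr_eq:
  assumes "Y \<in> borel_measurable N"
  shows "char (distr N borel Y) t = (CLINT w|N. iexp (t * Y w))"
  unfolding char_def using assms by (subst integral_distr) auto

lemma char_scaled_std_normal:
  assumes "0 \<le> v"
  shows "char (distr std_normal_distribution borel (\<lambda>z. sqrt v * z)) t = complex_of_real (exp (- (t\<^sup>2 * v) / 2))"
proof -
  have "char (distr std_normal_distribution borel (\<lambda>z. sqrt v * z)) t
      = (CLINT z|std_normal_distribution. iexp (t * (sqrt v * z)))"
    by (rule char_distr_eq) simp
  also have "\<dots> = char std_normal_distribution (t * sqrt v)"
    by (simp add: char_def mult.assoc)
  also have "\<dots> = complex_of_real (exp (- (t\<^sup>2 * v) / 2))"
    using assms by (simp add: char_std_normal_distribution power_mult_distrib)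
  finally show ?thesis .
qed

lemma centred_gaussian_char:
  assumes "centred_gaussian N Y v"
  shows "char (distr N borel Y) t = complex_of_real (exp (- (t\<^sup>2 * v) / 2))"
  using char_scaled_std_normal centred_gaussianD[OF assms] by simp

lemma (in prob_space) centred_gaussianI_char:
  assumes Y: "Y \<in> borel_measurable M" and v: "0 \<le> v"
    and ch: "\<And>t. char (distr M borel Y) t = complex_of_real (exp (- (t\<^sup>2 * v) / 2))"
  shows "centred_gaussian M Y v"
proof -
  have "distr M borel Y = distr std_normal_distribution borel (\<lambda>z. sqrt v * z)"
  proof (rule Levy_uniqueness)
    show "real_distribution (distr M borel Y)" using Y by (rule real_distribution_distr)
    show "real_distribution (distr std_normal_distribution borel (\<lambda>z. sqrt v * z))"
      by (rule std_normal.real_distribution_distr) simp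
    show "char (distr M borel Y) = char (distr std_normal_distribution borel (\<lambda>z. sqrt v * z))"
      using ch char_scaled_std_normal[OF v] by auto
  qed
  then show ?thesis using Y v by (simp add: centred_gaussian_def)
qed

lemma centred_gaussian_moment:
  assumes "centred_gaussian N Y v"
  shows "integrable N (\<lambda>w. Y w ^ p)"
    and "(\<integral>w. Y w ^ p \<partial>N) = sqrt v ^ p * (\<integral>z. z ^ p \<partial>std_normal_distribution)"
proof -
  note Y = centred_gaussianD[OF assms]
  have "integrable (distr std_normal_distribution borel (\<lambda>z. sqrt v * z)) (\<lambda>y. y ^ p)"
    using integrable_std_normal_distribution_moment[of p]
    by (subst integrable_distr_eq) (auto simp: power_mult_distrib)
  then have "integrable (distr N borel Y) (\<lambda>y. y ^ p)" by (simp add: Y(3))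
  then show "integrable N (\<lambda>w. Y w ^ p)" using Y(1) by (subst (asm) integrable_distr_eq) auto
  have "(\<integral>w. Y w ^ p \<partial>N) = (\<integral>y. y ^ p \<partial>distr N borel Y)"
    using Y(1) by (subst integral_distr) auto
  also have "\<dots> = (\<integral>z. (sqrt v * z) ^ p \<partial>std_normal_distribution)"
    unfolding Y(3) by (subst integral_distr) auto
  finally show "(\<integral>w. Y w ^ p \<partial>N) = sqrt v ^ p * (\<integral>z. z ^ p \<partial>std_normal_distribution)"
    by (simp add: power_mult_distrib)
qed

lemma centred_gaussian_mean:
  assumes "centred_gaussian N Y v"
  shows "integrable N Y" "mean N Y = 0"
  using centred_gaussian_moment[OF assms, of 1] integral_std_normal_distribution_moment_odd[of 1]
  by (auto simp: mean_def)

lemma centred_gaussian_variance: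
  assumes "centred_gaussian N Y v"
  shows "integrable N (\<lambda>w. (Y w)\<^sup>2)" "(\<integral>w. (Y w)\<^sup>2 \<partial>N) = v"
  using centred_gaussian_moment[OF assms, of 2] std_normal_distribution_even_moments(1)[of 1]
    centred_gaussianD(2)[OF assms]
  by (auto simp: fact_numeral)

lemma (in prob_space) centred_gaussian_imp_normal_rv:
  assumes "centred_gaussian M Y v"
  shows "normal_rv M Y"
proof -
  note Y = centred_gaussianD[OF assms]
  show ?thesis
  proof (cases "v = 0")
    case True
    have "(\<integral>w. (Y w)\<^sup>2 \<partial>M) = 0" using centred_gaussian_variance(2)[OF assms] True by simp
    then have "AE w in M. (Y w)\<^sup>2 = 0"
      using centred_gaussian_variance(1)[OF assms]
      by (subst (asm) integral_nonneg_eq_0_iff_AE) auto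
    then have "AE w in M. Y w = 0" by auto
    then show ?thesis using Y(1) unfolding normal_rv_def by auto
  next
    case False
    then have v: "0 < sqrt v" using Y(2) by auto
    have "distributed std_normal_distribution lborel (\<lambda>z. z) (\<lambda>x. ennreal (normal_density 0 1 x))"
      unfolding distributed_def by (auto simp: distr_id2)
    from std_normal.normal_density_affine[OF this, of "sqrt v" 0]
    have "distributed std_normal_distribution lborel (\<lambda>z. sqrt v * z) (\<lambda>x. ennreal (normal_density 0 (sqrt v) x))"
      using v by simp
    then have "distr std_normal_distribution lborel (\<lambda>z. sqrt v * z) = density lborel (normal_density 0 (sqrt v))"
      by (simp add: distributed_def)
    \<comment> \<open>\<open>distributed\<close> refers to \<open>lborel\<close>,
      \<open>centred_gaussian\<close> to \<open>borel\<close>; both have the same sets, so the image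
      measures coincide.\<close>
    moreover have "distr M lborel Y = distr M borel Y"
      "distr std_normal_distribution lborel (\<lambda>z. sqrt v * z) = distr std_normal_distribution borel (\<lambda>z. sqrt v * z)"
      by (auto intro!: distr_cong)
    ultimately have "distributed M lborel Y (\<lambda>x. ennreal (normal_density 0 (sqrt v) x))"
      using Y unfolding distributed_def by auto
    then show ?thesis using Y(1) v unfolding normal_rv_def by blast
  qed
qed

text \<open>With mean zero the only remaining parameter is the variance, which is the second moment.
  This is how an arbitrary process satisfying \<open>brownian_process\<close> enters the
  argument.\<close>

lemma (in prob_space) normal_rv_imp_centred_gaussian:
  assumes Y: "normal_rv M Y" and m0: "mean M Y = 0"
  shows "centred_gaussian M Y (\<integral>w. (Y w)\<^sup>2 \<partial>M)"
proof -
  have Ym: "Y \<in> borel_measurable M" using Y by (simp add: normal_rv_def)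
  from Y consider (const) a where "AE w in M. Y w = a"
    | (dens) a \<sigma> where "0 < \<sigma>" "distributed M lborel Y (\<lambda>y. ennreal (normal_density a \<sigma> y))"
    unfolding normal_rv_def by blast
  then show ?thesis
  proof cases
    case const
    have "(\<integral>w. Y w \<partial>M) = (\<integral>w. a \<partial>M)" using const Ym by (intro integral_cong_AE) auto
    then have a: "a = 0" using m0 by (simp add: mean_def prob_space)
    have "(\<integral>w. (Y w)\<^sup>2 \<partial>M) = (\<integral>w. 0 \<partial>M)" using const Ym a by (intro integral_cong_AE) auto
    then have v: "(\<integral>w. (Y w)\<^sup>2 \<partial>M) = 0" by simp
    show ?thesis unfolding v
    proof (rule centred_gaussianI_char[OF Ym])
      fix t
      have "char (distr M borel Y) t = (CLINT w|M. 1)"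
        unfolding char_distr_eq[OF Ym] using const Ym a by (intro integral_cong_AE) auto
      then show "char (distr M borel Y) t = complex_of_real (exp (- (t\<^sup>2 * 0) / 2))"
        by (simp add: prob_space)
    qed simp
  next
    case dens
    have a: "a = 0" using normal_distributed_expectation[OF dens] m0 by (simp add: mean_def)
    have v: "(\<integral>w. (Y w)\<^sup>2 \<partial>M) = \<sigma>\<^sup>2"
      using normal_distributed_variance[OF dens] m0 by (simp add: mean_def)
    \<comment> \<open>Dividing by \<sigma> gives a standard normal variable; multiplying it by
      \<sigma>, the square root of the variance, recovers \<open>Y\<close> in the form that
      \<open>centred_gaussian\<close> asks for.\<close>
    have "distributed M lborel (\<lambda>w. 0 + inverse \<sigma> * Y w) (\<lambda>x. ennreal (normal_density (0 + inverse \<sigma> * a) (\<bar>inverse \<sigma>\<bar> * \<sigma>) x))"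
      by (rule normal_density_affine[OF dens(2)]) (use dens in auto)
    then have "distr M lborel (\<lambda>w. inverse \<sigma> * Y w) = std_normal_distribution"
      using dens(1) a by (simp add: distributed_def)
    moreover have "distr M lborel (\<lambda>w. inverse \<sigma> * Y w) = distr M borel (\<lambda>w. inverse \<sigma> * Y w)"
      by (auto intro!: distr_cong)
    ultimately have std: "distr M borel (\<lambda>w. inverse \<sigma> * Y w) = std_normal_distribution" by simp
    have "distr std_normal_distribution borel (\<lambda>z. sqrt (\<sigma>\<^sup>2) * z) = distr M borel Y"
      unfolding std[symmetric] using Ym dens(1) by (subst distr_distr) (auto simp: comp_def intro!: distr_cong)
    then show ?thesis unfolding v centred_gaussian_def using Ym by simp
  qed
qed

text \<open>Characteristic functions are bounded by 1, so dominated convergence applies to them, and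
  the limit of the variances passes into the exponent. Used to go from values on nets to the whole
  parameter set.\<close>

lemma (in prob_space) centred_gaussian_limit:
  assumes Y: "\<And>n. centred_gaussian M (Y n) (v n)" and Z: "Z \<in> borel_measurable M"
    and lim: "AE w in M. (\<lambda>n. Y n w) \<longlonglongrightarrow> Z w" and v: "v \<longlonglongrightarrow> v'"
  shows "centred_gaussian M Z v'"
proof (rule centred_gaussianI_char[OF Z])
  show "0 \<le> v'" using v centred_gaussianD(2)[OF Y] by (intro LIMSEQ_le_const) auto
  fix t
  have [measurable]: "\<And>n. Y n \<in> borel_measurable M" "Z \<in> borel_measurable M"
    using centred_gaussianD(1)[OF Y] Z by auto
  have "(\<lambda>n. CLINT w|M. iexp (t * Y n w)) \<longlonglongrightarrow> (CLINT w|M. iexp (t * Z w))"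
  proof (rule integral_dominated_convergence[where w = "\<lambda>_. 1"])
    show "AE w in M. (\<lambda>n. iexp (t * Y n w)) \<longlonglongrightarrow> iexp (t * Z w)"
      using lim by eventually_elim (intro tendsto_intros)
  qed (auto simp: prob_space)
  then have "(\<lambda>n. complex_of_real (exp (- (t\<^sup>2 * v n) / 2))) \<longlonglongrightarrow> char (distr M borel Z) t"
    using centred_gaussian_char[OF Y] by (simp add: char_distr_eq)
  moreover have "(\<lambda>n. complex_of_real (exp (- (t\<^sup>2 * v n) / 2))) \<longlonglongrightarrow> complex_of_real (exp (- (t\<^sup>2 * v') / 2))"
    using v by (intro tendsto_intros) auto
  ultimately show "char (distr M borel Z) t = complex_of_real (exp (- (t\<^sup>2 * v') / 2))"
    by (rule LIMSEQ_unique)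
qed

text \<open>Markov's inequality for the power \<open>2 * q\<close>; the quotient of factorials is
  the corresponding moment of the standard normal law. The order \<open>q\<close> stays free,
  because chaining has to adapt it to the dimension.\<close>

lemma (in prob_space) centred_gaussian_tail:
  assumes Y: "centred_gaussian M Y v" and l: "0 < l"
  shows "prob {w \<in> space M. l < \<bar>Y w\<bar>} \<le> v ^ q * (fact (2 * q) / (2 ^ q * fact q)) / l ^ (2 * q)"
proof -
  have [measurable]: "Y \<in> borel_measurable M" using Y by (rule centred_gaussianD)
  have eq: "(\<integral>w. Y w ^ (2 * q) \<partial>M) = v ^ q * (fact (2 * q) / (2 ^ q * fact q))"
    unfolding centred_gaussian_moment(2)[OF Y] std_normal_distribution_even_moments(1)
    using centred_gaussianD(2)[OF Y] by (simp add: power_mult)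
  have "prob {w \<in> space M. l < \<bar>Y w\<bar>} \<le> prob {w \<in> space M. l ^ (2 * q) \<le> Y w ^ (2 * q)}"
  proof (rule finite_measure_mono)
    show "{w \<in> space M. l < \<bar>Y w\<bar>} \<subseteq> {w \<in> space M. l ^ (2 * q) \<le> Y w ^ (2 * q)}"
    proof safe
      fix w assume "l < \<bar>Y w\<bar>"
      then have "l ^ (2 * q) \<le> \<bar>Y w\<bar> ^ (2 * q)" using l by (intro power_mono) auto
      then show "l ^ (2 * q) \<le> Y w ^ (2 * q)" by (simp add: power_mult)
    qed
  qed measurable
  also have "\<dots> \<le> (\<integral>w. Y w ^ (2 * q) \<partial>M) / l ^ (2 * q)"
    using l by (intro integral_Markov_inequality_measure[where A = "{}"] centred_gaussian_moment(1)[OF Y]) (auto simp: power_mult)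
  finally show ?thesis using eq by simp
qed

section \<open>Gaussian sequences with prescribed covariance\<close>

definition square_integrable :: "'x measure \<Rightarrow> ('x \<Rightarrow> real) \<Rightarrow> bool" where
  "square_integrable P u \<longleftrightarrow> u \<in> borel_measurable P \<and> integrable P (\<lambda>x. (u x)\<^sup>2)"

lemma square_integrable_measurable: "square_integrable P u \<Longrightarrow> u \<in> borel_measurable P"
  by (simp add: square_integrable_def)

lemma square_integrable_mult:
  assumes "square_integrable P u" "square_integrable P v"
  shows "integrable P (\<lambda>x. u x * v x)"
proof (rule Bochner_Integration.integrable_bound)
  show "integrable P (\<lambda>x. (u x)\<^sup>2 + (v x)\<^sup>2)" using assms by (auto simp: square_integrable_def)
  show "(\<lambda>x. u x * v x) \<in> borel_measurable P" using assms by (auto simp: square_integrable_def)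
  have "\<bar>u x * v x\<bar> \<le> (u x)\<^sup>2 + (v x)\<^sup>2" for x
    unfolding abs_mult using sum_squares_bound[of "\<bar>u x\<bar>" "\<bar>v x\<bar>", unfolded power2_abs]
      mult_nonneg_nonneg[OF abs_ge_zero[of "u x"] abs_ge_zero[of "v x"]] by linarith
  then show "AE x in P. norm (u x * v x) \<le> norm ((u x)\<^sup>2 + (v x)\<^sup>2)" by auto
qed

lemma square_integrable_cmult:
  "square_integrable P u \<Longrightarrow> square_integrable P (\<lambda>x. c * u x)"
  by (auto simp: square_integrable_def power_mult_distrib)

lemma square_integrable_add:
  assumes "square_integrable P u" "square_integrable P v"
  shows "square_integrable P (\<lambda>x. u x + v x)"
  using assms square_integrable_mult[OF assms]
  by (auto simp: square_integrable_def power2_sum mult.assoc)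

lemma integral_square_add:
  assumes "square_integrable P u" "square_integrable P v"
  shows "(\<integral>x. (u x + v x)\<^sup>2 \<partial>P) = (\<integral>x. (u x)\<^sup>2 \<partial>P) + (\<integral>x. (v x)\<^sup>2 \<partial>P) + 2 * (\<integral>x. u x * v x \<partial>P)"
  using assms square_integrable_mult[OF assms]
  by (simp add: power2_sum square_integrable_def mult.assoc)

lemma square_integrable_sum:
  assumes "\<And>i. i \<in> A \<Longrightarrow> square_integrable P (u i)"
  shows "square_integrable P (\<lambda>x. \<Sum>i\<in>A. u i x)"
  using assms
proof (induction A rule: infinite_finite_induct)
  case (insert i F)
  then show ?case by (simp add: square_integrable_add)
qed (simp_all add: square_integrable_def)

lemma square_integrable_diff:
  assumes "square_integrable P u" "square_integrable P v"
  shows "square_integrable P (\<lambda>x. u x - v x)"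
  using square_integrable_add[OF assms(1) square_integrable_cmult[OF assms(2), of "-1"]] by simp

lemma square_integrable_bound:
  assumes "square_integrable P u" "v \<in> borel_measurable P" "\<And>x. x \<in> space P \<Longrightarrow> \<bar>v x\<bar> \<le> \<bar>u x\<bar>"
  shows "square_integrable P v"
  unfolding square_integrable_def
proof
  show "integrable P (\<lambda>x. (v x)\<^sup>2)"
    by (rule Bochner_Integration.integrable_bound[of P "\<lambda>x. (u x)\<^sup>2"])
      (use assms in \<open>auto simp: square_integrable_def abs_le_square_iff\<close>)
qed fact

lemma (in prob_space) square_integrable_const: "square_integrable M (\<lambda>x. c)"
  by (simp add: square_integrable_def)

lemma (in prob_space) square_integrable_integrable:
  "square_integrable M u \<Longrightarrow> integrable M u"
  using square_integrable_mult[OF _ square_integrable_const[of 1]] by simp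

lemma (in prob_space) square_integrable_centred:
  "square_integrable M u \<Longrightarrow> square_integrable M (\<lambda>x. u x - expectation u)"
  by (intro square_integrable_diff square_integrable_const)

lemma integral_sum_squares:
  assumes "\<And>i. i \<in> A \<Longrightarrow> square_integrable P (u i)" "\<And>i. i \<in> B \<Longrightarrow> square_integrable P (v i)"
  shows "(\<integral>x. (\<Sum>i\<in>A. u i x) * (\<Sum>j\<in>B. v j x) \<partial>P) = (\<Sum>i\<in>A. \<Sum>j\<in>B. \<integral>x. u i x * v j x \<partial>P)"
  using assms unfolding sum_product
  by (subst Bochner_Integration.integral_sum)
    (auto intro!: square_integrable_mult Bochner_Integration.integrable_sum Bochner_Integration.integral_sum sum.cong)

lemma integral_scaled_product:
  fixes u v :: "'x \<Rightarrow> real"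
  shows "(\<integral>x. (a * u x) * (b * v x) \<partial>P) = a * b * (\<integral>x. u x * v x \<partial>P)"
proof -
  have "(\<lambda>x. (a * u x) * (b * v x)) = (\<lambda>x. (a * b) * (u x * v x))" by (simp add: fun_eq_iff)
  then show ?thesis by simp
qed

section \<open>Gram--Schmidt and Cholesky factorization in L2\<close>

text \<open>If the residual \<open>r\<close> has norm 0, division by zero makes the new vector 0.
  The resulting system thus consists of unit vectors and zeros, and linear dependence in
  \<open>h\<close> needs no separate treatment.\<close>

function gram_schmidt :: "'x measure \<Rightarrow> (nat \<Rightarrow> 'x \<Rightarrow> real) \<Rightarrow> nat \<Rightarrow> 'x \<Rightarrow> real" where
  "gram_schmidt P h n =
     (let r = (\<lambda>x. h n x - (\<Sum>i<n. (\<integral>y. h n y * gram_schmidt P h i y \<partial>P) * gram_schmidt P h i x))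
      in (\<lambda>x. r x / sqrt (\<integral>y. (r y)\<^sup>2 \<partial>P)))"
  by pat_completeness auto
termination by (relation "Wellfounded.measure (\<lambda>(P, h, n). n)") auto

declare gram_schmidt.simps [simp del]

text \<open>The coefficients of the \<open>h n\<close> in the Gram--Schmidt system form a triangular
  factor of the Gram matrix. Triangularity makes every sum finite, so one infinite matrix
  \<open>c\<close> serves all truncations \<open>N\<close>.\<close>

lemma Cholesky_L2:
  assumes h: "\<And>n. square_integrable P (h n)"
  obtains c :: "nat \<Rightarrow> nat \<Rightarrow> real" where
    "\<And>n i. n < i \<Longrightarrow> c n i = 0"
    "\<And>n m N. n < N \<Longrightarrow> m < N \<Longrightarrow> (\<integral>x. h n x * h m x \<partial>P) = (\<Sum>i<N. c n i * c m i)"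
proof -
  define e where "e = gram_schmidt P h"
  define ip where "ip u v = (\<integral>x. u x * v x \<partial>P)" for u v :: "'a \<Rightarrow> real"
  define r where "r n = (\<lambda>x. h n x - (\<Sum>i<n. ip (h n) (e i) * e i x))" for n
  define s where "s n = sqrt (\<integral>y. (r n y)\<^sup>2 \<partial>P)" for n
  have e: "e n = (\<lambda>x. r n x / s n)" for n
    unfolding e_def r_def s_def ip_def by (subst gram_schmidt.simps) (simp add: Let_def)
  have sqe: "square_integrable P (e n)" for n
  proof (induction n rule: less_induct)
    case (less n)
    then have "square_integrable P (r n)" unfolding r_def
      by (intro square_integrable_diff h square_integrable_sum square_integrable_cmult) auto
    then have "square_integrable P (\<lambda>x. inverse (s n) * r n x)" by (rule square_integrable_cmult)
    then show ?case by (simp add: e field_simps)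
  qed
  have sqr: "square_integrable P (r n)" for n
    unfolding r_def by (intro square_integrable_diff h square_integrable_sum square_integrable_cmult sqe)
  have s2: "(s n)\<^sup>2 = (\<integral>y. (r n y)\<^sup>2 \<partial>P)" for n unfolding s_def by simp
  have enorm: "ip (e n) (e n) = (if s n = 0 then 0 else 1)" for n
  proof -
    have "ip (e n) (e n) = (\<integral>y. (r n y)\<^sup>2 \<partial>P) / (s n)\<^sup>2"
      unfolding ip_def e by (simp add: power2_eq_square)
    then show ?thesis using s2[of n] by (cases "s n = 0") auto
  qed
  have e0: "ip u (e n) = 0" "ip (e n) u = 0" if "s n = 0" for n u using that by (auto simp: e ip_def)
  have orth: "ip (e n) (e m) = 0" if "m < n" for m n
    using that
  proof (induction n arbitrary: m rule: less_induct)
    case (less n)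
    have i1: "integrable P (\<lambda>x. h n x * e m x)" by (intro square_integrable_mult h sqe)
    have i2: "integrable P (\<lambda>x. \<Sum>i<n. ip (h n) (e i) * (e i x * e m x))"
      by (intro Bochner_Integration.integrable_sum integrable_mult_right square_integrable_mult sqe)
    have sy: "ip (e i) (e m) = (if i = m then if s m = 0 then 0 else 1 else 0)" if "i < n" for i
    proof (cases "i < m")
      case True
      then have "ip (e m) (e i) = 0" using less.IH[of m i] less.prems by simp
      then show ?thesis using True by (simp add: ip_def mult.commute)
    next
      case False
      then show ?thesis using less.IH[of i m] that enorm[of m] by auto
    qed
    have "ip (r n) (e m) = (\<integral>x. h n x * e m x - (\<Sum>i<n. ip (h n) (e i) * (e i x * e m x)) \<partial>P)"
      unfolding ip_def[of "r n"] by (simp add: r_def left_diff_distrib sum_distrib_right mult.assoc)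
    also have "\<dots> = ip (h n) (e m) - (\<integral>x. (\<Sum>i<n. ip (h n) (e i) * (e i x * e m x)) \<partial>P)"
      using i1 i2 by (simp add: ip_def)
    also have "(\<integral>x. (\<Sum>i<n. ip (h n) (e i) * (e i x * e m x)) \<partial>P)
        = (\<Sum>i<n. \<integral>x. ip (h n) (e i) * (e i x * e m x) \<partial>P)"
    proof (rule Bochner_Integration.integral_sum)
      fix i
      have "integrable P (\<lambda>x. e i x * e m x)" by (intro square_integrable_mult sqe)
      then show "integrable P (\<lambda>x. ip (h n) (e i) * (e i x * e m x))" by simp
    qed
    also have "\<dots> = (\<Sum>i<n. ip (h n) (e i) * ip (e i) (e m))"
      unfolding ip_def[of "e i" "e m" for i] by (intro sum.cong refl integral_mult_right_zero)
    also have "\<dots> = (\<Sum>i<n. if i = m then ip (h n) (e m) * (if s m = 0 then 0 else 1) else 0)"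
      by (intro sum.cong) (auto simp: sy)
    also have "\<dots> = ip (h n) (e m) * (if s m = 0 then 0 else 1)" using less.prems by simp
    finally have "ip (r n) (e m) = 0" using e0(1)[of m "h n"] by auto
    then show ?case unfolding ip_def e[of n] by simp
  qed
  have orth': "ip (e i) (e j) = (if i = j then (if s i = 0 then 0 else 1) else 0)" for i j
    using orth[of i j] orth[of j i] enorm[of i] by (auto simp: ip_def mult.commute neq_iff)
  \<comment> \<open>The diagonal entry is the norm of the residual, which is what is left of
    \<open>h n\<close> after projection.\<close>
  define c where "c n i = (if i < n then ip (h n) (e i) else if i = n then s n else 0)" for n i
  have hn: "AE x in P. h n x = (\<Sum>i<N. c n i * e i x)" if "n < N" for n N
  proof -
    \<comment> \<open>A residual of norm 0 vanishes only almost everywhere, while \<open>e n\<close>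
      is then 0 everywhere; so the expansion of \<open>h n\<close> holds only almost
      everywhere.\<close>
    have "AE x in P. r n x = s n * e n x"
    proof (cases "s n = 0")
      case True
      then have "(\<integral>y. (r n y)\<^sup>2 \<partial>P) = 0" using s2[of n] by simp
      then have "AE x in P. (r n x)\<^sup>2 = 0"
        using sqr[of n] by (subst (asm) integral_nonneg_eq_0_iff_AE) (auto simp: square_integrable_def)
      then show ?thesis using True by auto
    qed (auto simp: e)
    moreover have "(\<Sum>i<N. c n i * e i x) = (\<Sum>i<n. ip (h n) (e i) * e i x) + s n * e n x" for x
    proof -
      have "(\<Sum>i<N. c n i * e i x) = (\<Sum>i<Suc n. c n i * e i x)"
        using that by (intro sum.mono_neutral_right) (auto simp: c_def)
      then show ?thesis by (simp add: c_def)
    qed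
    ultimately show ?thesis by (auto simp: r_def)
  qed
  show ?thesis
  proof (rule that)
    show "c n i = 0" if "n < i" for n i using that by (simp add: c_def)
    fix n m N :: nat assume N: "n < N" "m < N"
    have [measurable]: "h i \<in> borel_measurable P" "e i \<in> borel_measurable P" for i
      using h sqe by (auto simp: square_integrable_def)
    have "(\<integral>x. h n x * h m x \<partial>P) = (\<integral>x. (\<Sum>i<N. c n i * e i x) * (\<Sum>i<N. c m i * e i x) \<partial>P)"
      using hn[OF N(1)] hn[OF N(2)] by (intro integral_cong_AE) auto
    also have "\<dots> = (\<Sum>i<N. \<Sum>j<N. \<integral>x. (c n i * e i x) * (c m j * e j x) \<partial>P)"
      by (intro integral_sum_squares square_integrable_cmult sqe)
    also have "\<dots> = (\<Sum>i<N. \<Sum>j<N. c n i * c m j * ip (e i) (e j))"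
      by (simp only: ip_def integral_scaled_product)
    also have "\<dots> = (\<Sum>i<N. \<Sum>j<N. if i = j then c n i * c m i * (if s i = 0 then 0 else 1) else 0)"
      by (intro sum.cong) (auto simp: orth')
    also have "\<dots> = (\<Sum>i<N. c n i * c m i * (if s i = 0 then 0 else 1))" by simp
    \<comment> \<open>Where \<open>s i = 0\<close>, the coefficient \<open>c n i\<close> is already
      0, either as an inner product with \<open>e i = 0\<close> or as the diagonal entry
      itself.\<close>
    also have "\<dots> = (\<Sum>i<N. c n i * c m i)"
      by (intro sum.cong) (auto simp: c_def e0)
    finally show "(\<integral>x. h n x * h m x \<partial>P) = (\<Sum>i<N. c n i * c m i)" .
  qed
qed

section \<open>Independent standard normal coordinates and linear forms in them\<close>

definition white_noise :: "(nat \<Rightarrow> real) measure" where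
  "white_noise = (\<Pi>\<^sub>M i\<in>UNIV. std_normal_distribution)"

lemma prob_space_white_noise: "prob_space white_noise"
  unfolding white_noise_def by (rule prob_space_PiM) (rule std_normal.prob_space_axioms)

lemma white_noise_coordinate [measurable]: "(\<lambda>z. z i) \<in> borel_measurable white_noise"
proof -
  have "(\<lambda>z. z i) \<in> white_noise \<rightarrow>\<^sub>M std_normal_distribution"
    unfolding white_noise_def by (rule measurable_component_singleton) (rule UNIV_I)
  then show ?thesis
    by (simp only: measurable_cong_sets[OF refl std_normal.events_eq_borel])
qed

lemma white_noise_linear:
  assumes "finite A"
  shows "centred_gaussian white_noise (\<lambda>z. \<Sum>i\<in>A. b i * z i) (\<Sum>i\<in>A. (b i)\<^sup>2)"
proof -
  interpret W: prob_space white_noise by (rule prob_space_white_noise)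
  have comp: "distr white_noise std_normal_distribution (\<lambda>z. z i) = std_normal_distribution" for i
    unfolding white_noise_def
    by (rule distr_PiM_component) (auto intro: std_normal.prob_space_axioms)
  have "W.indep_vars (\<lambda>_. std_normal_distribution) (\<lambda>i z. z i) UNIV"
  proof (subst W.indep_vars_iff_distr_eq_PiM)
    show "distr white_noise (Pi\<^sub>M UNIV (\<lambda>i. std_normal_distribution)) (\<lambda>x. \<lambda>i\<in>UNIV. x i) =
      Pi\<^sub>M UNIV (\<lambda>i. distr white_noise std_normal_distribution (\<lambda>z. z i))"
      unfolding comp by (simp add: white_noise_def restrict_UNIV)
  qed auto
  then have "W.indep_vars (\<lambda>_. borel) (\<lambda>i z. b i * z i) UNIV"
    by (rule W.indep_vars_compose2[where Y = "\<lambda>i y. b i * y"]) simp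
  then have ind: "W.indep_vars (\<lambda>_. borel) (\<lambda>i z. b i * z i) A"
    by (rule W.indep_vars_subset) simp
  show ?thesis
  proof (rule W.centred_gaussianI_char)
    fix t
    have bor: "distr white_noise borel (\<lambda>z. z i) = std_normal_distribution" for i
    proof -
      have "distr white_noise borel (\<lambda>z. z i) = distr white_noise std_normal_distribution (\<lambda>z. z i)"
        by (rule distr_cong) simp_all
      then show ?thesis using comp by simp
    qed
    have ch: "char (distr white_noise borel (\<lambda>z. b i * z i)) t = complex_of_real (exp (- ((t * b i)\<^sup>2) / 2))" for i
    proof -
      have "char (distr white_noise borel (\<lambda>z. b i * z i)) t = char (distr white_noise borel (\<lambda>z. z i)) (t * b i)"
        by (subst (1 2) char_distr_eq) (auto simp: mult.assoc)
      also have "\<dots> = char std_normal_distribution (t * b i)"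
        by (simp only: bor)
      finally show ?thesis by (simp add: char_std_normal_distribution)
    qed
    have "char (distr white_noise borel (\<lambda>z. \<Sum>i\<in>A. b i * z i)) t = (\<Prod>i\<in>A. complex_of_real (exp (- ((t * b i)\<^sup>2) / 2)))"
      using W.char_distr_sum[OF ind] ch by simp
    also have "\<dots> = complex_of_real (exp (\<Sum>i\<in>A. - ((t * b i)\<^sup>2) / 2))"
      using assms by (simp add: exp_sum)
    also have "(\<Sum>i\<in>A. - ((t * b i)\<^sup>2) / 2) = - (t\<^sup>2 * (\<Sum>i\<in>A. (b i)\<^sup>2)) / 2"
      by (simp add: sum_distrib_left power_mult_distrib sum_negf sum_divide_distrib)
    finally show "char (distr white_noise borel (\<lambda>z. \<Sum>i\<in>A. b i * z i)) t
      = complex_of_real (exp (- (t\<^sup>2 * (\<Sum>i\<in>A. (b i)\<^sup>2)) / 2))" .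
  qed (auto simp: sum_nonneg)
qed

text \<open>Let row \<open>n\<close> of the Cholesky factor act on white noise. A combination of the
  \<open>Z n\<close> is then a linear form in independent normal variables, and the sum of its
  squared coefficients is the squared L2 norm of the same combination of the \<open>h n\<close>: the
  map from \<open>h n\<close> to \<open>Z n\<close> is an isometry.\<close>

lemma isonormal_sequence:
  assumes h: "\<And>n. square_integrable P (h n)"
  obtains Z :: "nat \<Rightarrow> (nat \<Rightarrow> real) \<Rightarrow> real" where
    "\<And>S a. finite S \<Longrightarrow> centred_gaussian white_noise (\<lambda>z. \<Sum>n\<in>S. a n * Z n z) (\<integral>x. (\<Sum>n\<in>S. a n * h n x)\<^sup>2 \<partial>P)"
proof -
  obtain c where c: "\<And>n i. n < i \<Longrightarrow> c n i = 0"
    "\<And>n m N. n < N \<Longrightarrow> m < N \<Longrightarrow> (\<integral>x. h n x * h m x \<partial>P) = (\<Sum>i<N. c n i * c m i)"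
  proof (rule Cholesky_L2[of P h])
    show "square_integrable P (h n)" for n by (rule h)
  qed (rule that)
  define Z where "Z n z = (\<Sum>i\<le>n. c n i * z i)" for n and z :: "nat \<Rightarrow> real"
  show ?thesis
  proof (rule that)
    fix S :: "nat set" and a :: "nat \<Rightarrow> real" assume S: "finite S"
    \<comment> \<open>Large enough for all rows in \<open>S\<close>; inserting 0 covers the empty
      set.\<close>
    define N where "N = Suc (Max (insert 0 S))"
    have N: "n < N" if "n \<in> S" for n using S that by (simp add: N_def less_Suc_eq_le)
    define b where "b i = (\<Sum>n\<in>S. a n * c n i)" for i
    have Zn: "Z n z = (\<Sum>i<N. c n i * z i)" if "n \<in> S" for n z
      unfolding Z_def using N[OF that] c(1) by (intro sum.mono_neutral_left) (auto simp: not_le)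
    have 1: "(\<Sum>n\<in>S. a n * Z n z) = (\<Sum>i<N. b i * z i)" for z
    proof -
      have "(\<Sum>n\<in>S. a n * Z n z) = (\<Sum>n\<in>S. \<Sum>i<N. a n * (c n i * z i))"
        by (simp add: Zn sum_distrib_left)
      also have "\<dots> = (\<Sum>i<N. \<Sum>n\<in>S. a n * (c n i * z i))" by (rule sum.swap)
      finally show ?thesis by (simp add: b_def sum_distrib_right mult.assoc)
    qed
    have "(\<integral>x. (\<Sum>n\<in>S. a n * h n x)\<^sup>2 \<partial>P) = (\<Sum>n\<in>S. \<Sum>m\<in>S. \<integral>x. (a n * h n x) * (a m * h m x) \<partial>P)"
      unfolding power2_eq_square by (intro integral_sum_squares square_integrable_cmult h)
    also have "\<dots> = (\<Sum>n\<in>S. \<Sum>m\<in>S. a n * a m * (\<integral>x. h n x * h m x \<partial>P))"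
      by (simp only: integral_scaled_product)
    also have "\<dots> = (\<Sum>n\<in>S. \<Sum>m\<in>S. \<Sum>i<N. (a n * c n i) * (a m * c m i))"
      by (intro sum.cong refl) (simp add: c(2)[OF N N] sum_distrib_left ac_simps)
    also have "\<dots> = (\<Sum>n\<in>S. \<Sum>i<N. \<Sum>m\<in>S. (a n * c n i) * (a m * c m i))"
      by (intro sum.cong refl sum.swap)
    also have "\<dots> = (\<Sum>i<N. \<Sum>n\<in>S. \<Sum>m\<in>S. (a n * c n i) * (a m * c m i))"
      by (rule sum.swap)
    also have "\<dots> = (\<Sum>i<N. (b i)\<^sup>2)" by (simp add: b_def power2_eq_square sum_product)
    finally have 2: "(\<integral>x. (\<Sum>n\<in>S. a n * h n x)\<^sup>2 \<partial>P) = (\<Sum>i<N. (b i)\<^sup>2)" .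
    show "centred_gaussian white_noise (\<lambda>z. \<Sum>n\<in>S. a n * Z n z) (\<integral>x. (\<Sum>n\<in>S. a n * h n x)\<^sup>2 \<partial>P)"
      unfolding 1 2 by (rule white_noise_linear) simp
  qed
qed

section \<open>Chaining\<close>

text \<open>The l1 distance on the first \<open>d\<close> coordinates. Errors of single coordinates
  simply add up in it, and it dominates the Euclidean norm of the hypotheses.\<close>

definition dist1 :: "nat \<Rightarrow> rvec \<Rightarrow> rvec \<Rightarrow> real" where
  "dist1 d u v = (\<Sum>i<d. \<bar>u i - v i\<bar>)"

lemma dist1_nonneg: "0 \<le> dist1 d u v"
  by (simp add: dist1_def sum_nonneg)

lemma dist1_commute: "dist1 d u v = dist1 d v u"
  by (simp add: dist1_def abs_minus_commute)

lemma dist1_triangle: "dist1 d u w \<le> dist1 d u v + dist1 d v w"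
  unfolding dist1_def sum.distrib[symmetric] by (rule sum_mono) arith

lemma continuous_on_dist1: "continuous_on X (\<lambda>u. dist1 d u v)"
  unfolding dist1_def
  by (intro continuous_intros continuous_on_subset[OF continuous_on_product_coordinates]) auto

text \<open>Round every coordinate down to a multiple of \<open>1 / N\<close> and choose one point
  of \<open>J\<close> in each occupied cell. Each rounded coordinate takes one of
  \<open>2 * R * N + 1\<close> values, and points of one cell differ by at most \<open>1 / N\<close>
  in each coordinate. Choosing in \<open>J\<close> keeps the net where the fields are
  defined.\<close>

lemma finite_net:
  fixes J :: "rvec set" and R N :: nat
  assumes R: "\<And>v i. v \<in> J \<Longrightarrow> i < d \<Longrightarrow> \<bar>v i\<bar> \<le> real R" and N: "0 < N"
  obtains S where "finite S" "S \<subseteq> J" "card S \<le> (2 * R * N + 1) ^ d"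
    "\<And>v. v \<in> J \<Longrightarrow> \<exists>u\<in>S. dist1 d v u \<le> real d / real N"
proof -
  define c where "c v = (\<lambda>i\<in>{..<d}. \<lfloor>v i * real N\<rfloor>)" for v :: rvec
  have cJ: "c ` J \<subseteq> {..<d} \<rightarrow>\<^sub>E {- int (R * N) .. int (R * N)}"
  proof (intro image_subsetI PiE_I)
    fix v i assume v: "v \<in> J" and "i \<in> {..<d}"
    then have i: "i < d" by simp
    have "\<bar>v i * real N\<bar> \<le> real R * real N"
      using R[OF v i] by (simp add: abs_mult mult_right_mono)
    then have "- real (R * N) \<le> v i * real N" "v i * real N \<le> real (R * N)" by auto
    then show "c v i \<in> {- int (R * N) .. int (R * N)}"
      using i by (simp add: c_def le_floor_iff floor_le_iff)
  qed (auto simp: c_def)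
  have fin: "finite ({..<d} \<rightarrow>\<^sub>E {- int (R * N) .. int (R * N)})" by (intro finite_PiE) auto
  have card: "card ({..<d} \<rightarrow>\<^sub>E {- int (R * N) .. int (R * N)}) = (2 * R * N + 1) ^ d"
    by (subst card_PiE) (auto simp: nat_add_distrib nat_mult_distrib ac_simps)
  define S where "S = inv_into J c ` (c ` J)"
  show ?thesis
  proof (rule that)
    show "finite S" unfolding S_def using finite_subset[OF cJ fin] by auto
    show "S \<subseteq> J" unfolding S_def by (auto intro: inv_into_into)
    have "card S \<le> card (c ` J)" unfolding S_def
      by (rule card_image_le) (use finite_subset[OF cJ fin] in auto)
    also have "\<dots> \<le> (2 * R * N + 1) ^ d" using card_mono[OF fin cJ] card by simp
    finally show "card S \<le> (2 * R * N + 1) ^ d" .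
    fix v assume v: "v \<in> J"
    define u where "u = inv_into J c (c v)"
    have cu: "c u = c v" unfolding u_def using v by (simp add: f_inv_into_f)
    have "\<bar>v i - u i\<bar> \<le> 1 / real N" if "i < d" for i
    proof -
      have "\<lfloor>u i * real N\<rfloor> = \<lfloor>v i * real N\<rfloor>"
        using cu that by (auto simp: c_def restrict_def fun_eq_iff split: if_splits)
      then have "\<bar>v i * real N - u i * real N\<bar> \<le> 1" by linarith
      then have "\<bar>v i - u i\<bar> * real N \<le> 1" by (simp add: abs_mult flip: left_diff_distrib)
      then show ?thesis using N by (simp add: field_simps)
    qed
    then have "dist1 d v u \<le> (\<Sum>i<d. 1 / real N)" unfolding dist1_def by (intro sum_mono) auto
    then have "dist1 d v u \<le> real d / real N" by simp
    then show "\<exists>u\<in>S. dist1 d v u \<le> real d / real N" using v unfolding S_def u_def by blast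
  qed
qed

lemma geometric_nets:
  fixes J :: "rvec set"
  assumes R: "\<And>v i. v \<in> J \<Longrightarrow> i < d \<Longrightarrow> \<bar>v i\<bar> \<le> R"
  obtains S B where "\<And>p. finite (S p)" "\<And>p. S p \<subseteq> J" "\<And>p. real (card (S p)) \<le> B * 4 ^ (p * d)"
    "\<And>p v. v \<in> J \<Longrightarrow> \<exists>u\<in>S p. dist1 d v u \<le> 1 / 4 ^ p"
proof -
  obtain R' :: nat where R': "R \<le> real R'" using real_arch_simple by blast
  \<comment> \<open>The factor \<open>d + 1\<close> turns the mesh \<open>d / N\<close> into at most
    \<open>1 / 4 ^ p\<close> and is positive even for \<open>d = 0\<close>.\<close>
  define N :: "nat \<Rightarrow> nat" where "N p = (d + 1) * 4 ^ p" for p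
  have "\<exists>S. finite S \<and> S \<subseteq> J \<and> card S \<le> (2 * R' * N p + 1) ^ d \<and>
      (\<forall>v\<in>J. \<exists>u\<in>S. dist1 d v u \<le> real d / real (N p))" for p
  proof -
    show ?thesis
    proof (rule finite_net[of J d R' "N p"])
      show "\<bar>v i\<bar> \<le> real R'" if "v \<in> J" "i < d" for v i
        using R[OF that] R' by simp
      show "0 < N p" by (simp add: N_def)
    qed blast
  qed
  then obtain S where S: "\<And>p. finite (S p)" "\<And>p. S p \<subseteq> J" "\<And>p. card (S p) \<le> (2 * R' * N p + 1) ^ d"
    "\<And>p v. v \<in> J \<Longrightarrow> \<exists>u\<in>S p. dist1 d v u \<le> real d / real (N p)"
    by metis
  show ?thesis
  proof (rule that[of S "real ((2 * R' + 1) * (d + 1)) ^ d"])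
    fix p
    have N: "0 < N p" by (simp add: N_def)
    then have "2 * R' * N p + 1 \<le> (2 * R' + 1) * N p" by (simp add: algebra_simps)
    then have "(2 * R' * N p + 1) ^ d \<le> ((2 * R' + 1) * N p) ^ d" by (rule power_mono) simp
    then have "card (S p) \<le> ((2 * R' + 1) * N p) ^ d" using S(3)[of p] by simp
    then have "real (card (S p)) \<le> real (((2 * R' + 1) * N p) ^ d)" by (rule of_nat_mono)
    also have "((2 * R' + 1) * N p) ^ d = ((2 * R' + 1) * (d + 1)) ^ d * 4 ^ (p * d)"
      by (simp only: N_def mult.assoc[symmetric] power_mult_distrib power_mult)
    also have "real \<dots> = real ((2 * R' + 1) * (d + 1)) ^ d * 4 ^ (p * d)"
      by (simp only: of_nat_mult of_nat_power of_nat_numeral)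
    finally show "real (card (S p)) \<le> real ((2 * R' + 1) * (d + 1)) ^ d * 4 ^ (p * d)" .
    fix v assume "v \<in> J"
    then obtain u where u: "u \<in> S p" "dist1 d v u \<le> real d / real (N p)" using S(4) by blast
    have "real d * 4 ^ p \<le> real (N p)" by (simp add: N_def)
    then have "real d / real (N p) \<le> 1 / 4 ^ p" using N by (simp add: field_simps)
    then show "\<exists>u\<in>S p. dist1 d v u \<le> 1 / 4 ^ p" using u by force
  qed (use S in auto)
qed

text \<open>
  Interpolation between the points of a \<open>\<delta>\<close>-net \<open>S\<close> by a continuous partition of unity, in which
  only the points at distance less than \<open>2\<delta>\<close> contribute.
\<close>

definition net_weight :: "rvec set \<Rightarrow> real \<Rightarrow> nat \<Rightarrow> rvec \<Rightarrow> rvec \<Rightarrow> real" where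
  "net_weight S \<delta> d \<eta> v = max 0 (2 * \<delta> - dist1 d \<eta> v) / (\<Sum>u\<in>S. max 0 (2 * \<delta> - dist1 d \<eta> u))"

definition net_interp :: "rvec set \<Rightarrow> real \<Rightarrow> nat \<Rightarrow> (rvec \<Rightarrow> real) \<Rightarrow> rvec \<Rightarrow> real" where
  "net_interp S \<delta> d z \<eta> = (\<Sum>v\<in>S. net_weight S \<delta> d \<eta> v * z v)"

lemma net_weight_total_pos:
  assumes "finite S" "0 < \<delta>" "\<exists>u\<in>S. dist1 d \<eta> u \<le> \<delta>"
  shows "0 < (\<Sum>u\<in>S. max 0 (2 * \<delta> - dist1 d \<eta> u))"
proof -
  from assms(3) obtain u where "u \<in> S" "dist1 d \<eta> u \<le> \<delta>" by blast
  then show ?thesis using assms by (intro sum_pos2[of _ u]) auto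
qed

lemma net_weight_nonneg: "finite S \<Longrightarrow> 0 \<le> net_weight S \<delta> d \<eta> v"
  by (simp add: net_weight_def sum_nonneg)

lemma net_weight_sum:
  assumes "finite S" "0 < \<delta>" "\<exists>u\<in>S. dist1 d \<eta> u \<le> \<delta>"
  shows "(\<Sum>v\<in>S. net_weight S \<delta> d \<eta> v) = 1"
  using net_weight_total_pos[OF assms] by (simp add: net_weight_def flip: sum_divide_distrib)

lemma net_weight_support: "net_weight S \<delta> d \<eta> v \<noteq> 0 \<Longrightarrow> dist1 d \<eta> v < 2 * \<delta>"
  by (auto simp: net_weight_def max_def split: if_splits)

lemma continuous_on_net_interp:
  assumes "finite S" "0 < \<delta>" "\<And>\<eta>. \<eta> \<in> J \<Longrightarrow> \<exists>u\<in>S. dist1 d \<eta> u \<le> \<delta>"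
  shows "continuous_on J (net_interp S \<delta> d z)"
  unfolding net_interp_def net_weight_def
  using net_weight_total_pos[OF assms(1,2) assms(3)]
  by (intro continuous_intros continuous_on_dist1) force

text \<open>The interpolated value is a convex combination of values at net points within
  \<open>2 * \<delta>\<close> of \<eta>, so it inherits any bound that they share.\<close>

lemma net_interp_close:
  assumes S: "finite S" "0 < \<delta>" "\<exists>u\<in>S. dist1 d \<eta> u \<le> \<delta>"
    and b: "\<And>v. v \<in> S \<Longrightarrow> dist1 d \<eta> v < 2 * \<delta> \<Longrightarrow> \<bar>z v - c\<bar> \<le> b"
  shows "\<bar>net_interp S \<delta> d z \<eta> - c\<bar> \<le> b"
proof -
  have "net_interp S \<delta> d z \<eta> - c = (\<Sum>v\<in>S. net_weight S \<delta> d \<eta> v * (z v - c))"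
    using net_weight_sum[OF S] by (simp add: net_interp_def right_diff_distrib sum_subtractf flip: sum_distrib_right)
  also have "\<bar>\<dots>\<bar> \<le> (\<Sum>v\<in>S. net_weight S \<delta> d \<eta> v * b)"
  proof (rule order_trans[OF sum_abs sum_mono])
    fix v assume v: "v \<in> S"
    show "\<bar>net_weight S \<delta> d \<eta> v * (z v - c)\<bar> \<le> net_weight S \<delta> d \<eta> v * b"
    proof (cases "net_weight S \<delta> d \<eta> v = 0")
      case False
      then show ?thesis using b[OF v net_weight_support[OF False]] net_weight_nonneg[OF S(1), of \<delta> d \<eta> v]
        by (simp add: abs_mult mult_left_mono)
    qed simp
  qed
  also have "\<dots> = b" using net_weight_sum[OF S] by (simp flip: sum_distrib_right)
  finally show ?thesis .
qed

section \<open>Uniform convergence of the interpolations\<close>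

text \<open>Net points of levels \<open>p\<close> and \<open>p + 1\<close> that contribute at the
  same \<eta> are at distance at most \<open>2 / 4 ^ p + 2 / 4 ^ (p + 1)\<close>, which is below
  \<open>3 / 4 ^ p\<close>. Consecutive interpolations hence differ by at most
  \<open>1 / 2 ^ p\<close>, and the M-test applies to the telescoping series.\<close>

lemma chaining_uniform_limit:
  fixes S :: "nat \<Rightarrow> rvec set"
  assumes S: "\<And>p. finite (S p)" "\<And>p v. v \<in> J \<Longrightarrow> \<exists>u\<in>S p. dist1 d v u \<le> 1 / 4 ^ p"
    and z: "\<forall>\<^sub>F p in sequentially. \<forall>u\<in>S p. \<forall>v\<in>S (Suc p).
              dist1 d u v \<le> 3 / 4 ^ p \<longrightarrow> \<bar>z v - z u\<bar> \<le> 1 / 2 ^ p"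
  shows "\<exists>V. uniform_limit J (\<lambda>p. net_interp (S p) (1 / 4 ^ p) d z) V sequentially"
proof -
  define I where "I p = net_interp (S p) (1 / 4 ^ p) d z" for p
  have "\<forall>\<^sub>F p in sequentially. \<forall>\<eta>\<in>J. norm (I (Suc p) \<eta> - I p \<eta>) \<le> (1 / 2) ^ p"
    using z
  proof eventually_elim
    case (elim p)
    show ?case
    proof
      fix \<eta> assume \<eta>: "\<eta> \<in> J"
      have "\<bar>I (Suc p) \<eta> - I p \<eta>\<bar> \<le> 1 / 2 ^ p" unfolding I_def[of "Suc p"]
      proof (rule net_interp_close)
        fix v assume v: "v \<in> S (Suc p)" "dist1 d \<eta> v < 2 * (1 / 4 ^ Suc p)"
        have "\<bar>I p \<eta> - z v\<bar> \<le> 1 / 2 ^ p" unfolding I_def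
        proof (rule net_interp_close)
          fix u assume u: "u \<in> S p" "dist1 d \<eta> u < 2 * (1 / 4 ^ p)"
          have "dist1 d u v \<le> 2 * (1 / 4 ^ p) + 2 * (1 / 4 ^ Suc p)"
            using dist1_triangle[of d u v \<eta>] dist1_commute[of d u \<eta>] u v by linarith
          also have "\<dots> \<le> 3 / 4 ^ p" by (simp add: field_simps)
          finally show "\<bar>z u - z v\<bar> \<le> 1 / 2 ^ p" using elim u v by (simp add: abs_minus_commute)
        qed (use S \<eta> in auto)
        then show "\<bar>z v - I p \<eta>\<bar> \<le> 1 / 2 ^ p" by (simp add: abs_minus_commute)
      qed (use S(1) S(2)[OF \<eta>, of "Suc p"] in auto)
      then show "norm (I (Suc p) \<eta> - I p \<eta>) \<le> (1 / 2) ^ p" by (simp add: power_one_over)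
    qed
  qed
  then have "uniform_limit J (\<lambda>n \<eta>. \<Sum>p<n. I (Suc p) \<eta> - I p \<eta>) (\<lambda>\<eta>. \<Sum>p. I (Suc p) \<eta> - I p \<eta>) sequentially"
    by (rule Weierstrass_m_test_ev) (simp add: summable_geometric)
  then have "uniform_limit J (\<lambda>n \<eta>. (\<Sum>p<n. I (Suc p) \<eta> - I p \<eta>) + I 0 \<eta>) (\<lambda>\<eta>. (\<Sum>p. I (Suc p) \<eta> - I p \<eta>) + I 0 \<eta>) sequentially"
    by (intro uniform_limit_add) (auto intro: uniform_limit_const)
  moreover have "(\<Sum>p<n. I (Suc p) \<eta> - I p \<eta>) + I 0 \<eta> = I n \<eta>" for n \<eta>
    using sum_lessThan_telescope[of "\<lambda>p. I p \<eta>" n] by simp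
  ultimately show ?thesis unfolding I_def by auto
qed

text \<open>Level \<open>p\<close> has at most a constant times \<open>4 ^ (2 * p * d)\<close>
  pairs, and each of the close ones violates the bound with probability at most a constant times
  \<open>1 / 4 ^ (p * q)\<close>. With \<open>q = 2 * d + 1\<close> the product is of order
  \<open>1 / 4 ^ p\<close>, which is summable.\<close>

lemma (in prob_space) chaining_AE:
  fixes S :: "nat \<Rightarrow> rvec set"
  assumes S: "\<And>p. finite (S p)" "\<And>p. real (card (S p)) \<le> B * 4 ^ (p * d)"
    and Z: "\<And>p u v. u \<in> S p \<Longrightarrow> v \<in> S (Suc p) \<Longrightarrow> centred_gaussian M (\<lambda>w. Z v w - Z u w) (\<sigma> u v)"
    and \<sigma>: "\<And>p u v. u \<in> S p \<Longrightarrow> v \<in> S (Suc p) \<Longrightarrow> \<sigma> u v \<le> C * (dist1 d u v)\<^sup>2"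
  shows "AE w in M. \<forall>\<^sub>F p in sequentially. \<forall>u\<in>S p. \<forall>v\<in>S (Suc p).
           dist1 d u v \<le> 3 / 4 ^ p \<longrightarrow> \<bar>Z v w - Z u w\<bar> \<le> 1 / 2 ^ p"
proof -
  define q where "q = 2 * d + 1"
  define \<kappa> :: real where "\<kappa> = fact (2 * q) / (2 ^ q * fact q)"
  \<comment> \<open>\<open>C\<close> carries no sign assumption; the maximum makes the bounds below
    monotone.\<close>
  define C' where "C' = max C 0"
  have \<kappa>: "0 \<le> \<kappa>" by (simp add: \<kappa>_def)
  have B: "0 \<le> B" using S(2)[of 0] order_trans[OF of_nat_0_le_iff, of "card (S 0)" B] by simp
  define E where "E p u v = {w \<in> space M. 1 / 2 ^ p < \<bar>Z v w - Z u w\<bar>}" for p u v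
  define V where "V p u = {v \<in> S (Suc p). dist1 d u v \<le> 3 / 4 ^ p}" for p u
  have V: "finite (V p u)" "V p u \<subseteq> S (Suc p)" for p u using S(1) by (auto simp: V_def)
  define A where "A p = (\<Union>u\<in>S p. \<Union>v\<in>V p u. E p u v)" for p
  have meas: "E p u v \<in> events" if "u \<in> S p" "v \<in> V p u" for u v p
  proof -
    have "(\<lambda>w. Z v w - Z u w) \<in> borel_measurable M"
      using Z[of u p v] that V(2) by (auto intro: centred_gaussianD)
    then show ?thesis unfolding E_def by measurable
  qed
  have measU: "(\<Union>v\<in>V p u. E p u v) \<in> events" if "u \<in> S p" for u p
    by (rule sets.finite_UN) (use V meas that in auto)
  have A: "A p \<in> events" for p
    unfolding A_def by (rule sets.finite_UN) (use S(1) measU in auto)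
  \<comment> \<open>The variance is at most \<open>9 * C' / 16 ^ p\<close>, and the threshold
    \<open>1 / 2 ^ p\<close> enters to the power \<open>2 * q\<close>. The decay
    \<open>16 ^ (p * q)\<close> loses \<open>4 ^ (p * q)\<close> to the threshold and leaves
    \<open>4 ^ (p * q)\<close>.\<close>
  have tail: "prob (E p u v) \<le> (9 * C') ^ q * \<kappa> / 4 ^ (p * q)"
    if uv: "u \<in> S p" "v \<in> S (Suc p)" "dist1 d u v \<le> 3 / 4 ^ p" for u v p
  proof -
    have "\<sigma> u v \<le> C * (dist1 d u v)\<^sup>2" by (rule \<sigma>) fact+
    also have "\<dots> \<le> C' * (3 / 4 ^ p)\<^sup>2"
      by (rule mult_mono) (use uv dist1_nonneg[of d u v] in \<open>auto simp: C'_def intro!: power_mono\<close>)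
    finally have s: "\<sigma> u v \<le> 9 * C' / 16 ^ p"
      by (simp add: power_divide power_mult[symmetric] mult.commute[of p] power_mult) (simp add: mult.commute)
    have s0: "0 \<le> \<sigma> u v" using Z[OF uv(1,2)] by (rule centred_gaussianD)
    have "prob (E p u v) \<le> \<sigma> u v ^ q * \<kappa> / (1 / 2 ^ p) ^ (2 * q)"
      unfolding \<kappa>_def E_def by (rule centred_gaussian_tail[OF Z]) (use uv in auto)
    also have "\<dots> \<le> (9 * C' / 16 ^ p) ^ q * \<kappa> / (1 / 2 ^ p) ^ (2 * q)"
      using s s0 \<kappa> by (intro divide_right_mono mult_right_mono power_mono) auto
    also have "\<dots> = (9 * C') ^ q * \<kappa> / 4 ^ (p * q)"
    proof -
      have e1: "(9 * C' / 16 ^ p) ^ q = (9 * C') ^ q / 16 ^ (p * q)"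
        by (simp only: power_divide power_mult)
      have "(1 / 2 ^ p)\<^sup>2 = 1 / (4::real) ^ p"
        by (simp add: power2_eq_square flip: power_mult_distrib)
      then have e2: "(1 / 2 ^ p) ^ (2 * q) = 1 / (4::real) ^ (p * q)"
        by (simp only: power_mult power_divide power_one)
      have e3: "(16::real) ^ (p * q) = 4 ^ (p * q) * 4 ^ (p * q)"
        by (simp flip: power_mult_distrib)
      show ?thesis unfolding e1 e2 e3 by simp
    qed
    finally show ?thesis .
  qed
  define K where "K = B * B * 4 ^ d * ((9 * C') ^ q * \<kappa>)"
  have T0: "0 \<le> (9 * C') ^ q * \<kappa>" using \<kappa> by (simp add: C'_def)
  have PA: "prob (A p) \<le> K * (1 / 4) ^ p" for p
  proof -
    have "prob (A p) \<le> (\<Sum>u\<in>S p. prob (\<Union>v\<in>V p u. E p u v))" unfolding A_def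
      using S(1) measU by (intro finite_measure_subadditive_finite) auto
    also have "\<dots> \<le> (\<Sum>u\<in>S p. \<Sum>v\<in>S (Suc p). (9 * C') ^ q * \<kappa> / 4 ^ (p * q))"
    proof (rule sum_mono)
      fix u assume u: "u \<in> S p"
      have "prob (\<Union>v\<in>V p u. E p u v) \<le> (\<Sum>v\<in>V p u. prob (E p u v))"
        using V meas u by (intro finite_measure_subadditive_finite) auto
      also have "\<dots> \<le> (\<Sum>v\<in>V p u. (9 * C') ^ q * \<kappa> / 4 ^ (p * q))"
        using tail u by (intro sum_mono) (auto simp: V_def)
      also have "\<dots> \<le> (\<Sum>v\<in>S (Suc p). (9 * C') ^ q * \<kappa> / 4 ^ (p * q))"
        using S(1) T0 V by (intro sum_mono2) auto
      finally show "prob (\<Union>v\<in>V p u. E p u v) \<le> (\<Sum>v\<in>S (Suc p). (9 * C') ^ q * \<kappa> / 4 ^ (p * q))" .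
    qed
    also have "\<dots> = real (card (S p)) * real (card (S (Suc p))) * ((9 * C') ^ q * \<kappa> / 4 ^ (p * q))"
      by simp
    also have "\<dots> \<le> (B * 4 ^ (p * d)) * (B * 4 ^ (Suc p * d)) * ((9 * C') ^ q * \<kappa> / 4 ^ (p * q))"
      using S(2)[of p] S(2)[of "Suc p"] B T0 by (intro mult_right_mono mult_mono) auto
    also have "\<dots> = K * (4 ^ (2 * p * d) / 4 ^ (p * q))"
    proof -
      have "(4::real) ^ (2 * p * d) = 4 ^ (p * d) * 4 ^ (p * d)"
        by (simp add: power_add[symmetric])
      then show ?thesis by (simp add: K_def power_add)
    qed
    also have "(4::real) ^ (2 * p * d) / 4 ^ (p * q) = (1 / 4) ^ p"
    proof -
      have "p * q = 2 * p * d + p" by (simp add: q_def algebra_simps)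
      then show ?thesis by (simp add: power_add power_one_over)
    qed
    finally show ?thesis .
  qed
  have "AE w in M. \<forall>\<^sub>F p in sequentially. w \<in> space M - A p"
  proof (rule borel_cantelli_AE1)
    show "summable (\<lambda>p. prob (A p))"
      by (rule summable_comparison_test[of _ "\<lambda>p. K * (1 / 4) ^ p"])
        (use PA in \<open>auto intro!: summable_mult summable_geometric\<close>)
  qed (use A in \<open>auto simp: less_top[symmetric]\<close>)
  then show ?thesis
  proof eventually_elim
    case (elim w)
    then show ?case by eventually_elim (auto simp: A_def E_def V_def not_less)
  qed
qed

section \<open>Jointly Gaussian fields with continuous paths\<close>

text \<open>Regrouping by net points: the coefficient of a net point collects the weights of all
  \<open>t\<close> with the same field index. The coefficients do not involve \<open>q\<close>, so
  the same ones serve for the noise and for the functions in L2, which is how the variance is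
  identified.\<close>

lemma net_interp_combination:
  fixes S :: "'i \<Rightarrow> rvec set" and q :: "'i \<Rightarrow> rvec \<Rightarrow> real"
  assumes A: "finite A" "\<And>\<alpha>. \<alpha> \<in> A \<Longrightarrow> finite (S \<alpha>)" and T: "fst ` T \<subseteq> A"
  shows "(\<Sum>t\<in>T. a t * net_interp (S (fst t)) \<delta> (d (fst t)) (q (fst t)) (snd t))
    = (\<Sum>u\<in>Sigma A S. (\<Sum>t\<in>T. if fst u = fst t then a t * net_weight (S (fst t)) \<delta> (d (fst t)) (snd t) (snd u) else 0)
         * q (fst u) (snd u))"
proof -
  let ?w = "\<lambda>t v. a t * net_weight (S (fst t)) \<delta> (d (fst t)) (snd t) v"
  have "(\<Sum>u\<in>Sigma A S. (\<Sum>t\<in>T. if fst u = fst t then ?w t (snd u) else 0)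
         * q (fst u) (snd u))
      = (\<Sum>u\<in>Sigma A S. \<Sum>t\<in>T. if fst u = fst t then ?w t (snd u) * q (fst u) (snd u) else 0)"
    unfolding sum_distrib_right by (intro sum.cong) auto
  also have "\<dots> = (\<Sum>t\<in>T. \<Sum>u\<in>Sigma A S. if fst u = fst t then ?w t (snd u) * q (fst u) (snd u) else 0)"
    by (rule sum.swap)
  also have "\<dots> = (\<Sum>t\<in>T. a t * net_interp (S (fst t)) \<delta> (d (fst t)) (q (fst t)) (snd t))"
  proof (intro sum.cong refl)
    fix t assume t: "t \<in> T"
    have "(\<Sum>u\<in>Sigma A S. if fst u = fst t then ?w t (snd u) * q (fst u) (snd u) else 0)
      = (\<Sum>\<alpha>\<in>A. \<Sum>v\<in>S \<alpha>. if \<alpha> = fst t then ?w t v * q \<alpha> v else 0)"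
      using A by (subst sum.Sigma) (auto simp: split_def)
    also have "\<dots> = (\<Sum>\<alpha>\<in>A. if \<alpha> = fst t then (\<Sum>v\<in>S (fst t). ?w t v * q (fst t) v) else 0)"
      by (intro sum.cong) auto
    also have "\<dots> = (\<Sum>v\<in>S (fst t). ?w t v * q (fst t) v)"
      using A T t by (subst sum.delta) auto
    also have "\<dots> = a t * net_interp (S (fst t)) \<delta> (d (fst t)) (q (fst t)) (snd t)"
      by (simp add: net_interp_def sum_distrib_left mult.assoc)
    finally show "(\<Sum>u\<in>Sigma A S. if fst u = fst t then ?w t (snd u) * q (fst u) (snd u) else 0)
      = a t * net_interp (S (fst t)) \<delta> (d (fst t)) (q (fst t)) (snd t)" .
  qed
  finally show ?thesis by simp
qed

lemma isonormal_countable: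
  fixes H :: "'t \<Rightarrow> 'x \<Rightarrow> real"
  assumes D: "countable D" and H: "\<And>t. t \<in> D \<Longrightarrow> square_integrable P (H t)"
  obtains Z :: "'t \<Rightarrow> (nat \<Rightarrow> real) \<Rightarrow> real" where
    "\<And>S a. finite S \<Longrightarrow> S \<subseteq> D \<Longrightarrow> centred_gaussian white_noise (\<lambda>z. \<Sum>t\<in>S. a t * Z t z) (\<integral>x. (\<Sum>t\<in>S. a t * H t x)\<^sup>2 \<partial>P)"
proof -
  \<comment> \<open>\<open>from_nat_into\<close> stays inside a nonempty \<open>D\<close>; the zero
    function covers the empty one.\<close>
  define h where "h n = (if from_nat_into D n \<in> D then H (from_nat_into D n) else (\<lambda>_. 0))" for n
  have "square_integrable P (h n)" for n
    using H by (simp add: h_def) (simp add: square_integrable_def)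
  then obtain Y where Y: "\<And>S a. finite S \<Longrightarrow> centred_gaussian white_noise (\<lambda>z. \<Sum>n\<in>S. a n * Y n z) (\<integral>x. (\<Sum>n\<in>S. a n * h n x)\<^sup>2 \<partial>P)"
    using isonormal_sequence[of P h] by blast
  define \<tau> where "\<tau> = to_nat_on D"
  have \<tau>: "from_nat_into D (\<tau> t) = t" if "t \<in> D" for t
    using D that by (simp add: \<tau>_def)
  show ?thesis
  proof (rule that)
    fix S and a :: "'t \<Rightarrow> real" assume S: "finite S" "S \<subseteq> D"
    have inj: "inj_on \<tau> S" by (rule inj_on_inverseI[of _ "from_nat_into D"]) (use \<tau> S in auto)
    have eq: "(\<Sum>n\<in>\<tau> ` S. a (from_nat_into D n) * q n) = (\<Sum>t\<in>S. a t * q (\<tau> t))" for q :: "nat \<Rightarrow> real"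
      unfolding sum.reindex[OF inj] using \<tau> S by (intro sum.cong) auto
    have "h (\<tau> t) = H t" if "t \<in> S" for t using that S \<tau> by (auto simp: h_def)
    then have "(\<Sum>t\<in>S. a t * h (\<tau> t) x) = (\<Sum>t\<in>S. a t * H t x)" for x by (intro sum.cong) auto
    then show "centred_gaussian white_noise (\<lambda>z. \<Sum>t\<in>S. a t * Y (\<tau> t) z) (\<integral>x. (\<Sum>t\<in>S. a t * H t x)\<^sup>2 \<partial>P)"
      using Y[of "\<tau> ` S" "\<lambda>n. a (from_nat_into D n)"] S(1) by (simp add: eq)
  qed
qed

text \<open>All fields are built from one isonormal family indexed by the union of their nets, which
  makes them jointly Gaussian. The Lipschitz bound with a square-integrable constant is used twice:
  it bounds the variance of increments for chaining, and it shows that interpolating the functions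
  \<open>H\<close> converges in L2, so the limit has the right covariance.\<close>

theorem gaussian_continuous_process:
  fixes A :: "'i set" and H :: "'i \<Rightarrow> rvec \<Rightarrow> 'x \<Rightarrow> real" and d :: "'i \<Rightarrow> nat"
  assumes A: "finite A"
    and H: "\<And>\<alpha> \<eta>. \<alpha> \<in> A \<Longrightarrow> \<eta> \<in> J \<alpha> \<Longrightarrow> square_integrable P (H \<alpha> \<eta>)"
    and \<Gamma>: "\<And>\<alpha>. \<alpha> \<in> A \<Longrightarrow> square_integrable P (\<Gamma> \<alpha>)"
    and Lip: "\<And>\<alpha> \<eta> \<theta> x. \<alpha> \<in> A \<Longrightarrow> \<eta> \<in> J \<alpha> \<Longrightarrow> \<theta> \<in> J \<alpha> \<Longrightarrow> x \<in> space P \<Longrightarrow>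
      \<bar>H \<alpha> \<eta> x - H \<alpha> \<theta> x\<bar> \<le> \<Gamma> \<alpha> x * dist1 (d \<alpha>) \<eta> \<theta>"
    and bdd: "\<And>\<alpha>. \<alpha> \<in> A \<Longrightarrow> \<exists>R. \<forall>v\<in>J \<alpha>. \<forall>i<d \<alpha>. \<bar>v i\<bar> \<le> R"
  obtains V :: "(nat \<Rightarrow> real) \<Rightarrow> 'i \<Rightarrow> rvec \<Rightarrow> real" where
    "\<And>z \<alpha>. \<alpha> \<in> A \<Longrightarrow> continuous_on (J \<alpha>) (V z \<alpha>)"
    "\<And>T a. finite T \<Longrightarrow> T \<subseteq> Sigma A J \<Longrightarrow>
      centred_gaussian white_noise (\<lambda>z. \<Sum>t\<in>T. a t * V z (fst t) (snd t)) (\<integral>x. (\<Sum>t\<in>T. a t * H (fst t) (snd t) x)\<^sup>2 \<partial>P)"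
proof -
  interpret W: prob_space white_noise by (rule prob_space_white_noise)
  have "\<exists>S B. (\<forall>p. finite (S p) \<and> S p \<subseteq> J \<alpha> \<and> real (card (S p)) \<le> B * 4 ^ (p * d \<alpha>) \<and>
      (\<forall>v\<in>J \<alpha>. \<exists>u\<in>S p. dist1 (d \<alpha>) v u \<le> 1 / 4 ^ p))" if "\<alpha> \<in> A" for \<alpha>
  proof -
    obtain R where R: "\<forall>v\<in>J \<alpha>. \<forall>i<d \<alpha>. \<bar>v i\<bar> \<le> R" using bdd[OF \<open>\<alpha> \<in> A\<close>] by blast
    show ?thesis
    proof (rule geometric_nets[of "J \<alpha>" "d \<alpha>" R])
      show "\<bar>v i\<bar> \<le> R" if "v \<in> J \<alpha>" "i < d \<alpha>" for v i using R that by auto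
      fix S :: "nat \<Rightarrow> rvec set" and B :: real
      assume "\<And>p. finite (S p)" "\<And>p. S p \<subseteq> J \<alpha>" "\<And>p. real (card (S p)) \<le> B * 4 ^ (p * d \<alpha>)"
        "\<And>p v. v \<in> J \<alpha> \<Longrightarrow> \<exists>u\<in>S p. dist1 (d \<alpha>) v u \<le> 1 / 4 ^ p"
      then show ?thesis by (intro exI[of _ S] exI[of _ B]) simp
    qed
  qed
  then obtain S B where S: "\<And>\<alpha> p. \<alpha> \<in> A \<Longrightarrow> finite (S \<alpha> p)" "\<And>\<alpha> p. \<alpha> \<in> A \<Longrightarrow> S \<alpha> p \<subseteq> J \<alpha>"
    "\<And>\<alpha> p. \<alpha> \<in> A \<Longrightarrow> real (card (S \<alpha> p)) \<le> B \<alpha> * 4 ^ (p * d \<alpha>)"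
    "\<And>\<alpha> p v. \<alpha> \<in> A \<Longrightarrow> v \<in> J \<alpha> \<Longrightarrow> \<exists>u\<in>S \<alpha> p. dist1 (d \<alpha>) v u \<le> 1 / 4 ^ p"
    by metis
  define D where "D = (SIGMA \<alpha>:A. \<Union>p. S \<alpha> p)"
  have "countable D" unfolding D_def
    using A S(1) by (intro countable_SIGMA countable_UN) (auto intro: countable_finite)
  moreover have "square_integrable P (H (fst t) (snd t))" if "t \<in> D" for t
    using that H S(2) by (force simp: D_def)
  ultimately obtain Z where Z: "\<And>T a. finite T \<Longrightarrow> T \<subseteq> D \<Longrightarrow>
      centred_gaussian white_noise (\<lambda>z. \<Sum>t\<in>T. a t * Z t z) (\<integral>x. (\<Sum>t\<in>T. a t * H (fst t) (snd t) x)\<^sup>2 \<partial>P)"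
    using isonormal_countable[of D P "\<lambda>t. H (fst t) (snd t)"] by blast
  have Zm [measurable]: "Z t \<in> borel_measurable white_noise" if "t \<in> D" for t
    using Z[of "{t}" "\<lambda>_. 1"] that by (auto dest: centred_gaussianD)
  define I where "I p \<alpha> z = net_interp (S \<alpha> p) (1 / 4 ^ p) (d \<alpha>) (\<lambda>v. Z (\<alpha>, v) z)" for p \<alpha> z

  have chain: "AE z in white_noise. \<forall>\<^sub>F p in sequentially. \<forall>u\<in>S \<alpha> p. \<forall>v\<in>S \<alpha> (Suc p).
      dist1 (d \<alpha>) u v \<le> 3 / 4 ^ p \<longrightarrow> \<bar>Z (\<alpha>, v) z - Z (\<alpha>, u) z\<bar> \<le> 1 / 2 ^ p" if \<alpha>: "\<alpha> \<in> A" for \<alpha>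
  proof (rule W.chaining_AE[where \<sigma> = "\<lambda>u v. \<integral>x. (H \<alpha> v x - H \<alpha> u x)\<^sup>2 \<partial>P" and C = "\<integral>x. (\<Gamma> \<alpha> x)\<^sup>2 \<partial>P" and B = "B \<alpha>"])
    fix p u v assume uv: "u \<in> S \<alpha> p" "v \<in> S \<alpha> (Suc p)"
    then have J: "u \<in> J \<alpha>" "v \<in> J \<alpha>" and uvD: "(\<alpha>, u) \<in> D" "(\<alpha>, v) \<in> D" using S(2)[OF \<alpha>] \<alpha> by (auto simp: D_def)
    show "centred_gaussian white_noise (\<lambda>z. Z (\<alpha>, v) z - Z (\<alpha>, u) z) (\<integral>x. (H \<alpha> v x - H \<alpha> u x)\<^sup>2 \<partial>P)"
    \<comment> \<open>For \<open>u = v\<close> the two-point index set would collapse to one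
      point.\<close>
    proof (cases "u = v")
      case True
      then show ?thesis using Z[of "{}"] by simp
    next
      case False
      then show ?thesis
        using Z[of "{(\<alpha>, u), (\<alpha>, v)}" "\<lambda>t. if t = (\<alpha>, v) then 1 else -1"] uvD by simp
    qed
    have "(\<integral>x. (H \<alpha> v x - H \<alpha> u x)\<^sup>2 \<partial>P) \<le> (\<integral>x. (\<Gamma> \<alpha> x)\<^sup>2 * (dist1 (d \<alpha>) u v)\<^sup>2 \<partial>P)"
    proof (rule integral_mono)
      show "integrable P (\<lambda>x. (H \<alpha> v x - H \<alpha> u x)\<^sup>2)"
        using square_integrable_diff[OF H H, OF \<alpha> J(2) \<alpha> J(1)] by (simp add: square_integrable_def)
      show "integrable P (\<lambda>x. (\<Gamma> \<alpha> x)\<^sup>2 * (dist1 (d \<alpha>) u v)\<^sup>2)"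
        using \<Gamma>[OF \<alpha>] by (simp add: square_integrable_def)
      fix x assume x: "x \<in> space P"
      have "(H \<alpha> v x - H \<alpha> u x)\<^sup>2 = \<bar>H \<alpha> v x - H \<alpha> u x\<bar>\<^sup>2" by simp
      also have "\<dots> \<le> (\<Gamma> \<alpha> x * dist1 (d \<alpha>) u v)\<^sup>2"
        using Lip[OF \<alpha> J(2) J(1) x] by (intro power_mono) (auto simp: dist1_commute)
      finally show "(H \<alpha> v x - H \<alpha> u x)\<^sup>2 \<le> (\<Gamma> \<alpha> x)\<^sup>2 * (dist1 (d \<alpha>) u v)\<^sup>2" by (simp add: power_mult_distrib)
    qed
    then show "(\<integral>x. (H \<alpha> v x - H \<alpha> u x)\<^sup>2 \<partial>P) \<le> (\<integral>x. (\<Gamma> \<alpha> x)\<^sup>2 \<partial>P) * (dist1 (d \<alpha>) u v)\<^sup>2" by simp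
  qed (use S \<alpha> in auto)
  have "AE z in white_noise. \<forall>\<alpha>\<in>A. \<forall>\<^sub>F p in sequentially. \<forall>u\<in>S \<alpha> p. \<forall>v\<in>S \<alpha> (Suc p).
      dist1 (d \<alpha>) u v \<le> 3 / 4 ^ p \<longrightarrow> \<bar>Z (\<alpha>, v) z - Z (\<alpha>, u) z\<bar> \<le> 1 / 2 ^ p"
    using chain by (intro AE_finite_allI A)
  then obtain N where N: "N \<in> null_sets white_noise" and good: "\<And>z \<alpha>. z \<in> space white_noise - N \<Longrightarrow> \<alpha> \<in> A \<Longrightarrow>
     \<forall>\<^sub>F p in sequentially. \<forall>u\<in>S \<alpha> p. \<forall>v\<in>S \<alpha> (Suc p).
      dist1 (d \<alpha>) u v \<le> 3 / 4 ^ p \<longrightarrow> \<bar>Z (\<alpha>, v) z - Z (\<alpha>, u) z\<bar> \<le> 1 / 2 ^ p"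
    by (auto elim!: AE_E3)
  \<comment> \<open>Putting 0 on the exceptional null set makes every path continuous, not just
    almost every one.\<close>
  define V where "V z \<alpha> \<eta> = (if z \<in> space white_noise - N then lim (\<lambda>p. I p \<alpha> z \<eta>) else 0)" for z \<alpha> \<eta>
  have unif: "uniform_limit (J \<alpha>) (\<lambda>p. I p \<alpha> z) (V z \<alpha>) sequentially"
    if z: "z \<in> space white_noise - N" and \<alpha>: "\<alpha> \<in> A" for z \<alpha>
  proof -
    obtain U where U: "uniform_limit (J \<alpha>) (\<lambda>p. I p \<alpha> z) U sequentially"
      using chaining_uniform_limit[of "S \<alpha>" "J \<alpha>" "d \<alpha>" "\<lambda>v. Z (\<alpha>, v) z", OF S(1)[OF \<alpha>] S(4)[OF \<alpha>] good[OF z \<alpha>]]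
      unfolding I_def by blast
    have "V z \<alpha> \<eta> = U \<eta>" if "\<eta> \<in> J \<alpha>" for \<eta>
      using limI[OF tendsto_uniform_limitI[OF U that]] z by (simp add: V_def)
    then show ?thesis using U by (subst uniform_limit_cong'[where g = "\<lambda>p. I p \<alpha> z" and i = U]) auto
  qed
  show ?thesis
  proof (rule that)
    fix z \<alpha> assume \<alpha>: "\<alpha> \<in> A"
    show "continuous_on (J \<alpha>) (V z \<alpha>)"
    proof (cases "z \<in> space white_noise - N")
      case True
      show ?thesis
      proof (rule uniform_limit_theorem[OF _ unif[OF True \<alpha>]])
        show "\<forall>\<^sub>F p in sequentially. continuous_on (J \<alpha>) (I p \<alpha> z)"
          unfolding I_def using S(1,4)[OF \<alpha>]
          by (intro always_eventually allI continuous_on_net_interp) auto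
      qed simp
    next
      case False
      then have "V z \<alpha> = (\<lambda>_. 0)" by (auto simp: V_def fun_eq_iff)
      then show ?thesis by simp
    qed
  next
    fix T and a :: "'i \<times> rvec \<Rightarrow> real" assume T: "finite T" "T \<subseteq> Sigma A J"
    then have fT: "fst ` T \<subseteq> A" by auto
    have tT: "fst t \<in> A" "snd t \<in> J (fst t)" if "t \<in> T" for t using T that by auto
    define U where "U p = Sigma A (\<lambda>\<alpha>. S \<alpha> p)" for p
    define b where "b p u = (\<Sum>t\<in>T. if fst u = fst t then a t * net_weight (S (fst t) p) (1 / 4 ^ p) (d (fst t)) (snd t) (snd u) else 0)" for p u
    have comb: "(\<Sum>t\<in>T. a t * net_interp (S (fst t) p) (1 / 4 ^ p) (d (fst t)) (q (fst t)) (snd t)) = (\<Sum>u\<in>U p. b p u * q (fst u) (snd u))"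
      for p and q :: "'i \<Rightarrow> rvec \<Rightarrow> real"
      unfolding U_def b_def by (rule net_interp_combination) (use A S fT in auto)
    have U: "finite (U p)" "U p \<subseteq> D" for p
      unfolding U_def D_def using A S(1) by auto
    let ?G = "\<lambda>p x. \<Sum>u\<in>U p. b p u * H (fst u) (snd u) x"
    let ?L = "\<lambda>x. \<Sum>t\<in>T. a t * H (fst t) (snd t) x"
    \<comment> \<open>A combination of interpolated values is a finite combination of the
      \<open>Z\<close> with coefficients \<open>b p\<close>, so its variance is the squared norm of
      the same combination of the \<open>H\<close>.\<close>
    have g: "centred_gaussian white_noise (\<lambda>z. \<Sum>t\<in>T. a t * I p (fst t) z (snd t)) (\<integral>x. (?G p x)\<^sup>2 \<partial>P)" for p
      using Z[OF U[of p], of "b p"] comb[of _ "\<lambda>\<alpha> v. Z (\<alpha>, v) _"] by (simp add: I_def)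
    have Im: "(\<lambda>z. I p (fst t) z (snd t)) \<in> borel_measurable white_noise" if "t \<in> T" for p t
      unfolding I_def net_interp_def using tT(1)[OF that] Zm
      by (intro borel_measurable_sum borel_measurable_times borel_measurable_const) (auto intro!: Zm simp: D_def)
    have Nm [measurable]: "space white_noise - N \<in> sets white_noise" using N by auto
    have Vm: "(\<lambda>z. V z (fst t) (snd t)) \<in> borel_measurable white_noise" if t: "t \<in> T" for t
    proof (rule borel_measurable_LIMSEQ_real)
      show "(\<lambda>z. indicator (space white_noise - N) z * I p (fst t) z (snd t)) \<in> borel_measurable white_noise" for p
        using Im[OF t] by simp
      fix z assume "z \<in> space white_noise"
      show "(\<lambda>p. indicator (space white_noise - N) z * I p (fst t) z (snd t)) \<longlonglongrightarrow> V z (fst t) (snd t)"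
      proof (cases "z \<in> space white_noise - N")
        case True
        then show ?thesis using tendsto_uniform_limitI[OF unif[OF True tT(1)[OF t]] tT(2)[OF t]] by simp
      next
        case False
        then have "V z (fst t) (snd t) = 0" by (auto simp: V_def)
        then show ?thesis using False by simp
      qed
    qed
    have close: "\<bar>net_interp (S (fst t) p) (1 / 4 ^ p) (d (fst t)) (\<lambda>v. H (fst t) v x) (snd t) - H (fst t) (snd t) x\<bar>
        \<le> \<bar>\<Gamma> (fst t) x\<bar> * (2 * (1 / 4 ^ p))" if t: "t \<in> T" and x: "x \<in> space P" for t p x
    proof (rule net_interp_close)
      fix v assume v: "v \<in> S (fst t) p" "dist1 (d (fst t)) (snd t) v < 2 * (1 / 4 ^ p)"
      have "\<bar>H (fst t) v x - H (fst t) (snd t) x\<bar> \<le> \<Gamma> (fst t) x * dist1 (d (fst t)) v (snd t)"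
        using S(2) v tT[OF t] x by (intro Lip) auto
      also have "\<dots> \<le> \<bar>\<Gamma> (fst t) x\<bar> * (2 * (1 / 4 ^ p))"
        using v dist1_nonneg by (intro mult_mono) (auto simp: dist1_commute)
      finally show "\<bar>H (fst t) v x - H (fst t) (snd t) x\<bar> \<le> \<bar>\<Gamma> (fst t) x\<bar> * (2 * (1 / 4 ^ p))" .
    qed (use S tT[OF t] in auto)
    have GH: "?G p x = (\<Sum>t\<in>T. a t * net_interp (S (fst t) p) (1 / 4 ^ p) (d (fst t)) (\<lambda>v. H (fst t) v x) (snd t))" for p x
      using comb[of p "\<lambda>\<alpha> v. H \<alpha> v x"] by simp
    have conv: "(\<lambda>p. ?G p x) \<longlonglongrightarrow> ?L x" if x: "x \<in> space P" for x
      unfolding GH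
    proof (intro tendsto_sum tendsto_mult tendsto_const)
      fix t assume t: "t \<in> T"
      have "(\<lambda>p. \<bar>\<Gamma> (fst t) x\<bar> * (2 * (1 / 4 ^ p))) \<longlonglongrightarrow> \<bar>\<Gamma> (fst t) x\<bar> * (2 * 0)"
        by (intro tendsto_intros LIMSEQ_divide_realpow_zero) auto
      then have lim: "(\<lambda>p. \<bar>\<Gamma> (fst t) x\<bar> * (2 * (1 / 4 ^ p))) \<longlonglongrightarrow> 0" by simp
      have "(\<lambda>p. net_interp (S (fst t) p) (1 / 4 ^ p) (d (fst t)) (\<lambda>v. H (fst t) v x) (snd t) - H (fst t) (snd t) x) \<longlonglongrightarrow> 0"
        by (rule Lim_null_comparison[OF _ lim]) (intro always_eventually allI, unfold real_norm_def, rule close[OF t x])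
      then show "(\<lambda>p. net_interp (S (fst t) p) (1 / 4 ^ p) (d (fst t)) (\<lambda>v. H (fst t) v x) (snd t)) \<longlonglongrightarrow> H (fst t) (snd t) x"
        by (rule LIM_zero_cancel)
    qed
    \<comment> \<open>Interpolation moves \<open>H\<close> by at most \<open>2 / 4 ^ p\<close> times
      |\<Gamma>|, hence by at most \<open>2\<close> times |\<Gamma>| on every level; this is the
      dominating function.\<close>
    define K where "K x = (\<Sum>t\<in>T. \<bar>a t\<bar> * (\<bar>H (fst t) (snd t) x\<bar> + 2 * \<bar>\<Gamma> (fst t) x\<bar>))" for x
    have sqabs: "square_integrable P (\<lambda>x. \<bar>u x\<bar>)" if "square_integrable P u" for u :: "'x \<Rightarrow> real"
      using that by (rule square_integrable_bound) (use that in \<open>auto simp: square_integrable_def\<close>)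
    have K: "square_integrable P K" unfolding K_def
    proof (rule square_integrable_sum)
      fix t assume t: "t \<in> T"
      have "square_integrable P (\<lambda>x. \<bar>H (fst t) (snd t) x\<bar> + 2 * \<bar>\<Gamma> (fst t) x\<bar>)"
        by (rule square_integrable_add[OF sqabs[OF H[OF tT[OF t]]] square_integrable_cmult[OF sqabs[OF \<Gamma>[OF tT(1)[OF t]]]]])
      then show "square_integrable P (\<lambda>x. \<bar>a t\<bar> * (\<bar>H (fst t) (snd t) x\<bar> + 2 * \<bar>\<Gamma> (fst t) x\<bar>))"
        by (rule square_integrable_cmult)
    qed
    have Hm [measurable]: "H (fst u) (snd u) \<in> borel_measurable P" if "u \<in> D" for u
      using H[of "fst u" "snd u"] that S(2) by (force simp: D_def square_integrable_def)
    have Lm: "?L \<in> borel_measurable P"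
      by (intro borel_measurable_sum borel_measurable_times borel_measurable_const square_integrable_measurable H tT)
    have Gm: "?G p \<in> borel_measurable P" for p
      using U(2)[of p] by (intro borel_measurable_sum borel_measurable_times borel_measurable_const Hm) auto
    have var: "(\<lambda>p. \<integral>x. (?G p x)\<^sup>2 \<partial>P) \<longlonglongrightarrow> (\<integral>x. (?L x)\<^sup>2 \<partial>P)"
    proof (rule integral_dominated_convergence)
      show "integrable P (\<lambda>x. (K x)\<^sup>2)" using K by (simp add: square_integrable_def)
      show "(\<lambda>x. (?L x)\<^sup>2) \<in> borel_measurable P" using Lm by (rule borel_measurable_power)
      show "(\<lambda>x. (?G p x)\<^sup>2) \<in> borel_measurable P" for p using Gm by (rule borel_measurable_power)
      show "AE x in P. (\<lambda>p. (?G p x)\<^sup>2) \<longlonglongrightarrow> (?L x)\<^sup>2"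
        using conv by (intro AE_I2 tendsto_power)
      show "AE x in P. norm ((?G p x)\<^sup>2) \<le> (K x)\<^sup>2" for p
      proof (rule AE_I2)
        fix x assume x: "x \<in> space P"
        have "\<bar>?G p x\<bar> \<le> K x" unfolding GH K_def
        proof (rule order_trans[OF sum_abs sum_mono])
          fix t assume t: "t \<in> T"
          have "\<bar>\<Gamma> (fst t) x\<bar> * (2 * (1 / 4 ^ p)) \<le> \<bar>\<Gamma> (fst t) x\<bar> * (2 * 1)"
            by (intro mult_left_mono) (auto simp: divide_le_eq)
          then have "\<bar>net_interp (S (fst t) p) (1 / 4 ^ p) (d (fst t)) (\<lambda>v. H (fst t) v x) (snd t)\<bar>
              \<le> \<bar>H (fst t) (snd t) x\<bar> + 2 * \<bar>\<Gamma> (fst t) x\<bar>"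
            using close[OF t x, of p] by linarith
          then show "\<bar>a t * net_interp (S (fst t) p) (1 / 4 ^ p) (d (fst t)) (\<lambda>v. H (fst t) v x) (snd t)\<bar>
              \<le> \<bar>a t\<bar> * (\<bar>H (fst t) (snd t) x\<bar> + 2 * \<bar>\<Gamma> (fst t) x\<bar>)"
            unfolding abs_mult by (rule mult_left_mono) simp
        qed
        then have "\<bar>?G p x\<bar>\<^sup>2 \<le> (K x)\<^sup>2" by (rule power_mono) simp
        then show "norm ((?G p x)\<^sup>2) \<le> (K x)\<^sup>2" by simp
      qed
    qed
    show "centred_gaussian white_noise (\<lambda>z. \<Sum>t\<in>T. a t * V z (fst t) (snd t)) (\<integral>x. (?L x)\<^sup>2 \<partial>P)"
    proof (rule W.centred_gaussian_limit[OF g _ _ var])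
      show "(\<lambda>z. \<Sum>t\<in>T. a t * V z (fst t) (snd t)) \<in> borel_measurable white_noise"
        using Vm by (intro borel_measurable_sum borel_measurable_times borel_measurable_const)
      have "AE z in white_noise. z \<notin> N" using N by (rule AE_not_in)
      then show "AE z in white_noise. (\<lambda>p. \<Sum>t\<in>T. a t * I p (fst t) z (snd t)) \<longlonglongrightarrow> (\<Sum>t\<in>T. a t * V z (fst t) (snd t))"
        using AE_space
      proof eventually_elim
        case (elim z)
        then have z: "z \<in> space white_noise - N" by simp
        show ?case
          by (intro tendsto_sum tendsto_mult tendsto_const tendsto_uniform_limitI[OF unif[OF z]] tT)
      qed
    qed
  qed
qed

section \<open>Cramer--Wold device\<close>

text \<open>The free phase \<open>b\<close> covers sines and constants, so finite sums of these
  cosines form an algebra by the product formula. Their expectations are determined by the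
  characteristic functions of linear forms.\<close>

inductive trig_poly :: "'i set \<Rightarrow> (('i \<Rightarrow> real) \<Rightarrow> real) \<Rightarrow> bool" for S where
  cos: "trig_poly S (\<lambda>x. a * cos ((\<Sum>i\<in>S. t i * x i) + b))"
| add: "trig_poly S p \<Longrightarrow> trig_poly S q \<Longrightarrow> trig_poly S (\<lambda>x. p x + q x)"

lemma trig_poly_mult:
  assumes "trig_poly S p" "trig_poly S q"
  shows "trig_poly S (\<lambda>x. p x * q x)"
  using assms(1)
proof (induction rule: trig_poly.induct)
  case p: (cos a t b)
  from assms(2) show ?case
  proof (induction rule: trig_poly.induct)
    case (cos a' t' b')
    have "a * cos ((\<Sum>i\<in>S. t i * x i) + b) * (a' * cos ((\<Sum>i\<in>S. t' i * x i) + b'))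
      = (a * a' / 2) * cos ((\<Sum>i\<in>S. (t i - t' i) * x i) + (b - b'))
        + (a * a' / 2) * cos ((\<Sum>i\<in>S. (t i + t' i) * x i) + (b + b'))" for x :: "'a \<Rightarrow> real"
    proof -
      have "(\<Sum>i\<in>S. (t i - t' i) * x i) + (b - b') = ((\<Sum>i\<in>S. t i * x i) + b) - ((\<Sum>i\<in>S. t' i * x i) + b')"
        by (simp add: left_diff_distrib sum_subtractf)
      moreover have "(\<Sum>i\<in>S. (t i + t' i) * x i) + (b + b') = ((\<Sum>i\<in>S. t i * x i) + b) + ((\<Sum>i\<in>S. t' i * x i) + b')"
        by (simp add: distrib_right sum.distrib)
      moreover have "a * A * (a' * B) = a * a' * (A * B)" for A B :: real by simp
      ultimately show ?thesis by (simp only: cos_times_cos) (simp add: field_simps)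
    qed
    then show ?case by (simp only: trig_poly.intros)
  next
    case (add p q)
    then show ?case by (simp only: distrib_left trig_poly.add)
  qed
next
  case (add p p')
  then show ?case by (simp only: distrib_right trig_poly.add)
qed

text \<open>Only finitely many coordinates occur in the bound, and each is continuous in the product
  topology. The lemma also serves to prove Borel measurability of functions of a sequence.\<close>

lemma continuous_on_finite_Lipschitz:
  fixes F :: "('i \<Rightarrow> real) \<Rightarrow> real"
  assumes "\<And>u v. \<bar>F u - F v\<bar> \<le> K * (\<Sum>i\<in>S. \<bar>u i - v i\<bar>)"
  shows "continuous_on UNIV F"
  unfolding continuous_on_def
proof
  fix u :: "'i \<Rightarrow> real"
  have c: "((\<lambda>v. v i) \<longlongrightarrow> u i) (at u)" for i
    using continuous_on_product_coordinates[of i] unfolding continuous_on_def by auto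
  have "((\<lambda>v. K * (\<Sum>i\<in>S. \<bar>v i - u i\<bar>)) \<longlongrightarrow> K * (\<Sum>i\<in>S. \<bar>u i - u i\<bar>)) (at u)"
    by (intro tendsto_intros c)
  then have lim: "((\<lambda>v. K * (\<Sum>i\<in>S. \<bar>v i - u i\<bar>)) \<longlongrightarrow> 0) (at u)" by simp
  have "((\<lambda>v. F v - F u) \<longlongrightarrow> 0) (at u)"
    by (rule Lim_null_comparison[OF _ lim]) (intro always_eventually allI, unfold real_norm_def, rule assms)
  then show "(F \<longlongrightarrow> F u) (at u within UNIV)" by (rule LIM_zero_cancel)
qed

lemma compact_cube:
  fixes a b :: "'i \<Rightarrow> real"
  shows "compact {u. \<forall>i. u i \<in> {a i..b i}}"
proof -
  have "compactin (product_topology (\<lambda>_. euclidean) UNIV) (PiE UNIV (\<lambda>i. {a i..b i}))"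
    by (subst compactin_PiE) simp
  moreover have "PiE UNIV (\<lambda>i. {a i..b i}) = {u. \<forall>i. u i \<in> {a i..b i}}" by (auto simp: PiE_def)
  ultimately show ?thesis by (simp add: euclidean_product_topology)
qed

text \<open>
  On \<open>[-L, L]\<close> the function \<open>x \<mapsto> (2 L / \<pi>) arcsin (sin (\<pi> x / (2 L)))\<close> is the identity, and elsewhere it is
  bounded and periodic. After this change of coordinates \<open>F\<close> is a continuous function of sines on a
  cube, to which the Stone--Weierstrass theorem applies; tails are controlled by second moments.
\<close>

lemma trig_poly_approx:
  fixes F :: "('i::countable \<Rightarrow> real) \<Rightarrow> real"
  assumes S: "finite S" and F: "\<And>u v. \<bar>F u - F v\<bar> \<le> K * (\<Sum>i\<in>S. \<bar>u i - v i\<bar>)"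
    and B: "\<And>u. \<bar>F u\<bar> \<le> B" and e: "0 < e"
  obtains p where "trig_poly S p" "\<And>x. \<bar>F x - p x\<bar> \<le> e * (1 + (\<Sum>i\<in>S. (x i)\<^sup>2))"
proof -
  have B0: "0 \<le> B" using B[of undefined] by linarith
  \<comment> \<open>Chosen so that \<open>2 * B\<close> is at most \<open>e * L\<^sup>2\<close>: if
    some coordinate in \<open>S\<close> exceeds \<open>L\<close>, the trivial error
    \<open>2 * B\<close> is absorbed by \<open>e\<close> times its square.\<close>
  define L where "L = 1 + 2 * B / e"
  have L: "1 \<le> L" using B0 e by (simp add: L_def)
  have "2 * B \<le> e * L" using e by (simp add: L_def algebra_simps)
  also have "\<dots> \<le> e * L\<^sup>2" using e L by (intro mult_left_mono) (auto simp: power2_eq_square)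
  finally have LB: "2 * B \<le> e * L\<^sup>2" .
  define c where "c = pi / (2 * L)"
  have c: "0 < c" using L by (simp add: c_def)
  define a where "a y u = (\<lambda>i. if i \<in> S then y (u i) else 0)" for y :: "real \<Rightarrow> real" and u :: "'i \<Rightarrow> real"
  \<comment> \<open>Coordinates outside \<open>S\<close> are pinned to 0, so that distinct points of
    \<open>Q\<close> are separated by a coordinate in \<open>S\<close>.\<close>
  define Q where "Q = {u :: 'i \<Rightarrow> real. \<forall>i. u i \<in> {(if i \<in> S then -1 else 0)..(if i \<in> S then 1 else 0)}}"
  have Q: "-1 \<le> u i" "u i \<le> 1" if "u \<in> Q" for u i using that unfolding Q_def
    by (auto split: if_splits dest!: spec[of _ i])
  define H where "H u = F (a (\<lambda>y. arcsin y / c) u)" for u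
  define s where "s x = a (\<lambda>y. sin (c * y)) x" for x
  have sQ: "s x \<in> Q" for x by (auto simp: s_def a_def Q_def)
  have "\<exists>p. (continuous_on Q p \<and> trig_poly S (\<lambda>x. p (s x))) \<and> (\<forall>u\<in>Q. \<bar>H u - p u\<bar> < e)"
  proof (rule Stone_Weierstrass_HOL[where P = "\<lambda>p. continuous_on Q p \<and> trig_poly S (\<lambda>x. p (s x))"])
    show "compact Q" unfolding Q_def by (rule compact_cube)
    show "continuous_on Q (\<lambda>x. k) \<and> trig_poly S (\<lambda>x. k)" for k
      using trig_poly.cos[of S k "\<lambda>_. 0" 0] by simp
    show "continuous_on Q p" if "continuous_on Q p \<and> trig_poly S (\<lambda>x. p (s x))" for p using that by simp
    show "continuous_on Q (\<lambda>x. p x + q x) \<and> trig_poly S (\<lambda>x. p (s x) + q (s x))"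
      if "(continuous_on Q p \<and> trig_poly S (\<lambda>x. p (s x))) \<and> (continuous_on Q q \<and> trig_poly S (\<lambda>x. q (s x)))" for p q
      using that by (intro conjI continuous_on_add trig_poly.add) auto
    show "continuous_on Q (\<lambda>x. p x * q x) \<and> trig_poly S (\<lambda>x. p (s x) * q (s x))"
      if "(continuous_on Q p \<and> trig_poly S (\<lambda>x. p (s x))) \<and> (continuous_on Q q \<and> trig_poly S (\<lambda>x. q (s x)))" for p q
      using that by (intro conjI continuous_on_mult trig_poly_mult) auto
    show "\<exists>f. (continuous_on Q f \<and> trig_poly S (\<lambda>x. f (s x))) \<and> f u \<noteq> f v" if uv: "u \<in> Q \<and> v \<in> Q \<and> u \<noteq> v" for u v
    proof -
      obtain i where i: "u i \<noteq> v i" using uv by (auto simp: fun_eq_iff)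
      have "i \<in> S"
      proof (rule ccontr)
        assume "i \<notin> S"
        then have "u i = 0" "v i = 0" using uv by (auto simp: Q_def dest!: spec[of _ i])
        then show False using i by simp
      qed
      have "(\<Sum>j\<in>S. (if j = i then c else 0) * x j) = c * x i" for x :: "'i \<Rightarrow> real"
      proof -
        have "(\<Sum>j\<in>S. (if j = i then c else 0) * x j) = (\<Sum>j\<in>S. if j = i then c * x i else 0)"
          by (intro sum.cong) auto
        then show ?thesis using S \<open>i \<in> S\<close> by simp
      qed
      then have "1 * cos ((\<Sum>j\<in>S. (if j = i then c else 0) * x j) + (- pi / 2)) = s x i" for x
        using \<open>i \<in> S\<close> by (simp add: s_def a_def cos_diff flip: diff_conv_add_uminus)
      then have "trig_poly S (\<lambda>x. s x i)"
        using trig_poly.cos[of S 1 "\<lambda>j. if j = i then c else 0" "- pi / 2"] by simp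
      moreover have "continuous_on Q (\<lambda>u. u i)"
        by (rule continuous_on_subset[OF continuous_on_product_coordinates]) simp
      ultimately show ?thesis using i by blast
    qed
    show "continuous_on Q H" unfolding H_def
    proof (rule continuous_on_compose2[OF continuous_on_finite_Lipschitz[OF F]])
      show "continuous_on Q (a (\<lambda>y. arcsin y / c))"
      proof (rule continuous_on_coordinatewise_then_product)
        fix i
        have "continuous_on Q (\<lambda>u. u i)"
          by (rule continuous_on_subset[OF continuous_on_product_coordinates]) simp
        then have "continuous_on Q (\<lambda>u. arcsin (u i) / c)"
          using c Q by (intro continuous_intros) auto
        then show "continuous_on Q (\<lambda>u. a (\<lambda>y. arcsin y / c) u i)"
          by (cases "i \<in> S") (simp_all add: a_def)
      qed
    qed simp
    show "0 < e" by (rule e)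
  qed
  then obtain p where p: "trig_poly S (\<lambda>x. p (s x))" "\<And>u. u \<in> Q \<Longrightarrow> \<bar>H u - p u\<bar> < e" by blast
  have "\<bar>F x - p (s x)\<bar> \<le> e * (1 + (\<Sum>i\<in>S. (x i)\<^sup>2))" for x
  proof -
    have 1: "\<bar>H (s x) - p (s x)\<bar> < e" by (rule p(2)[OF sQ])
    have "\<bar>F x - H (s x)\<bar> \<le> e * (\<Sum>i\<in>S. (x i)\<^sup>2)"
    proof (cases "\<forall>i\<in>S. \<bar>x i\<bar> \<le> L")
      case True
      have "x i = a (\<lambda>y. arcsin y / c) (s x) i" if "i \<in> S" for i
      proof -
        have "\<bar>c * x i\<bar> = c * \<bar>x i\<bar>" using c by (simp add: abs_mult)
        also have "\<dots> \<le> c * L" using c True that by (intro mult_left_mono) auto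
        also have "c * L = pi / 2" using L by (simp add: c_def)
        finally have "arcsin (sin (c * x i)) = c * x i" by (intro arcsin_sin) auto
        then show ?thesis using c that by (simp add: s_def a_def)
      qed
      then have "(\<Sum>i\<in>S. \<bar>x i - a (\<lambda>y. arcsin y / c) (s x) i\<bar>) = 0" by (intro sum.neutral) auto
      then have "F x = H (s x)" using F[of x "a (\<lambda>y. arcsin y / c) (s x)"] by (simp add: H_def)
      then show ?thesis using e by (simp add: sum_nonneg)
    next
      case False
      then obtain i where i: "i \<in> S" "L < \<bar>x i\<bar>" by auto
      have "\<bar>F x - H (s x)\<bar> \<le> 2 * B" using B[of x] B[of "a (\<lambda>y. arcsin y / c) (s x)"] by (simp add: H_def)
      also have "\<dots> \<le> e * L\<^sup>2" by (rule LB)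
      also have "\<dots> \<le> e * (x i)\<^sup>2" using i L e by (intro mult_left_mono) (auto simp: abs_le_square_iff[symmetric])
      also have "\<dots> \<le> e * (\<Sum>i\<in>S. (x i)\<^sup>2)" using i S e by (intro mult_left_mono member_le_sum) auto
      finally show ?thesis .
    qed
    with 1 show ?thesis by (simp add: distrib_left)
  qed
  then show ?thesis using p(1) by (intro that[of "\<lambda>x. p (s x)"]) auto
qed

lemma trig_poly_integrable:
  assumes "finite_measure M" "trig_poly S p" "\<And>i. i \<in> S \<Longrightarrow> (\<lambda>w. U w i) \<in> borel_measurable M"
  shows "integrable M (\<lambda>w. p (U w))"
  using assms(2)
proof induction
  case (cos a t b)
  have [measurable]: "(\<lambda>w. \<Sum>i\<in>S. t i * U w i) \<in> borel_measurable M"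
    using assms(3) by (intro borel_measurable_sum borel_measurable_times) auto
  show ?case
    by (rule finite_measure.integrable_const_bound[OF assms(1), where B = "\<bar>a\<bar>"]) (auto simp: abs_mult mult_left_le)
qed auto

lemma integral_cos_eq_char:
  assumes M: "prob_space M" and Y [measurable]: "Y \<in> borel_measurable M"
  shows "(\<integral>w. cos (Y w + b) \<partial>M) = Re (iexp b * char (distr M borel Y) 1)"
proof -
  interpret prob_space M by fact
  have "iexp b * char (distr M borel Y) 1 = (CLINT w|M. iexp b * iexp (Y w))"
    by (simp add: char_distr_eq)
  also have "Re \<dots> = (\<integral>w. Re (iexp b * iexp (Y w)) \<partial>M)"
    by (rule integral_Re[symmetric]) (intro integrable_mult_right, rule integrable_const_bound[where B = 1], auto)
  also have "\<dots> = (\<integral>w. cos (Y w + b) \<partial>M)"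
    by (intro Bochner_Integration.integral_cong) (auto simp: cos_add Re_exp Im_exp)
  finally show ?thesis by simp
qed

lemma finite_Lipschitz_integral_approx:
  fixes Y :: "'l \<Rightarrow> 'i::countable \<Rightarrow> real"
  assumes L: "prob_space L" and F: "\<And>u v. \<bar>F u - F v\<bar> \<le> K * (\<Sum>i\<in>S. \<bar>u i - v i\<bar>)" and B: "\<And>u. \<bar>F u\<bar> \<le> B"
    and p: "trig_poly S p" "\<And>x. \<bar>F x - p x\<bar> \<le> e * (1 + (\<Sum>i\<in>S. (x i)\<^sup>2))" and e: "0 < e"
    and Y: "\<And>i. (\<lambda>w. Y w i) \<in> borel_measurable L"
    and Y2: "\<And>i. i \<in> S \<Longrightarrow> integrable L (\<lambda>w. (Y w i)\<^sup>2)" "\<And>i. i \<in> S \<Longrightarrow> (\<integral>w. (Y w i)\<^sup>2 \<partial>L) \<le> C"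
  shows "\<bar>(\<integral>w. F (Y w) \<partial>L) - (\<integral>w. p (Y w) \<partial>L)\<bar> \<le> e * (1 + real (card S) * C)"
proof -
  interpret L: prob_space L by fact
  have Fb: "F \<in> borel_measurable borel"
    by (rule borel_measurable_continuous_onI[OF continuous_on_finite_Lipschitz[OF F]])
  have "Y \<in> borel_measurable L" using Y by (rule measurable_coordinatewise_then_product)
  then have "(\<lambda>w. F (Y w)) \<in> borel_measurable L" using Fb by (rule measurable_compose)
  then have iF: "integrable L (\<lambda>w. F (Y w))"
    by (intro L.integrable_const_bound[where B = B]) (use B in auto)
  have ip: "integrable L (\<lambda>w. p (Y w))" using trig_poly_integrable[OF L.finite_measure_axioms p(1)] Y by auto
  have iq: "integrable L (\<lambda>w. \<Sum>i\<in>S. (Y w i)\<^sup>2)" using Y2 by (intro Bochner_Integration.integrable_sum)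
  have "\<bar>(\<integral>w. F (Y w) \<partial>L) - (\<integral>w. p (Y w) \<partial>L)\<bar> = \<bar>\<integral>w. F (Y w) - p (Y w) \<partial>L\<bar>" using iF ip by simp
  also have "\<dots> \<le> (\<integral>w. \<bar>F (Y w) - p (Y w)\<bar> \<partial>L)" by (rule integral_abs_bound)
  also have "\<dots> \<le> (\<integral>w. e * (1 + (\<Sum>i\<in>S. (Y w i)\<^sup>2)) \<partial>L)"
  proof (rule integral_mono)
    show "integrable L (\<lambda>w. \<bar>F (Y w) - p (Y w)\<bar>)" using iF ip by (intro integrable_abs Bochner_Integration.integrable_diff)
    show "integrable L (\<lambda>w. e * (1 + (\<Sum>i\<in>S. (Y w i)\<^sup>2)))" using iq by (intro integrable_mult_right Bochner_Integration.integrable_add) auto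
  qed (rule p(2))
  also have "\<dots> = e * (1 + (\<Sum>i\<in>S. \<integral>w. (Y w i)\<^sup>2 \<partial>L))"
    using iq Y2(1) by (simp add: L.prob_space)
  also have "\<dots> \<le> e * (1 + real (card S) * C)"
    using e Y2(2) sum_bounded_above[of S "\<lambda>i. \<integral>w. (Y w i)\<^sup>2 \<partial>L" C] by (intro mult_left_mono add_left_mono) auto
  finally show ?thesis .
qed

text \<open>Convergence of characteristic functions gives convergence of the expectations of
  trigonometric polynomials. These approximate \<open>F\<close> up to an error that is quadratic in
  the coordinates, and the common second moment bound \<open>C\<close> makes its mean small
  uniformly in \<open>n\<close>. Countability of the index type lets coordinatewise measurability
  suffice.\<close>

theorem Cramer_Wold_Lipschitz:
  fixes U :: "nat \<Rightarrow> 'a \<Rightarrow> 'i::countable \<Rightarrow> real" and V :: "'w \<Rightarrow> 'i \<Rightarrow> real"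
  assumes M: "prob_space M" and N: "prob_space N" and S: "finite S"
    and U: "\<And>n i. (\<lambda>w. U n w i) \<in> borel_measurable M" and V: "\<And>i. (\<lambda>w. V w i) \<in> borel_measurable N"
    and U2: "\<And>n i. i \<in> S \<Longrightarrow> integrable M (\<lambda>w. (U n w i)\<^sup>2)" "\<And>n i. i \<in> S \<Longrightarrow> (\<integral>w. (U n w i)\<^sup>2 \<partial>M) \<le> C"
    and V2: "\<And>i. i \<in> S \<Longrightarrow> integrable N (\<lambda>w. (V w i)\<^sup>2)" "\<And>i. i \<in> S \<Longrightarrow> (\<integral>w. (V w i)\<^sup>2 \<partial>N) \<le> C"
    and ch: "\<And>t. (\<lambda>n. char (distr M borel (\<lambda>w. \<Sum>i\<in>S. t i * U n w i)) 1)
      \<longlonglongrightarrow> char (distr N borel (\<lambda>w. \<Sum>i\<in>S. t i * V w i)) 1"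
    and F: "\<And>u v. \<bar>F u - F v\<bar> \<le> K * (\<Sum>i\<in>S. \<bar>u i - v i\<bar>)" and B: "\<And>u. \<bar>F u\<bar> \<le> B"
  shows "(\<lambda>n. \<integral>w. F (U n w) \<partial>M) \<longlonglongrightarrow> (\<integral>w. F (V w) \<partial>N)"
proof -
  interpret M: prob_space M by fact
  interpret N: prob_space N by fact
  have trig: "(\<lambda>n. \<integral>w. p (U n w) \<partial>M) \<longlonglongrightarrow> (\<integral>w. p (V w) \<partial>N)" if "trig_poly S p" for p
    using that
  proof induction
    case (cos a t b)
    have "(\<lambda>n. Re (iexp b * char (distr M borel (\<lambda>w. \<Sum>i\<in>S. t i * U n w i)) 1))
        \<longlonglongrightarrow> Re (iexp b * char (distr N borel (\<lambda>w. \<Sum>i\<in>S. t i * V w i)) 1)"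
      by (intro tendsto_intros ch)
    moreover have "(\<lambda>w. \<Sum>i\<in>S. t i * U n w i) \<in> borel_measurable M" "(\<lambda>w. \<Sum>i\<in>S. t i * V w i) \<in> borel_measurable N" for n
      using U V by (auto intro!: borel_measurable_sum borel_measurable_times)
    ultimately show ?case
      using integral_cos_eq_char[OF M] integral_cos_eq_char[OF N] by (simp add: tendsto_mult_left)
  next
    case (add p q)
    have "integrable M (\<lambda>w. p (U n w))" "integrable M (\<lambda>w. q (U n w))"
      "integrable N (\<lambda>w. p (V w))" "integrable N (\<lambda>w. q (V w))" for n
      by (rule trig_poly_integrable[OF M.finite_measure_axioms add.hyps(1) U]
          trig_poly_integrable[OF M.finite_measure_axioms add.hyps(2) U]
          trig_poly_integrable[OF N.finite_measure_axioms add.hyps(1) V]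
          trig_poly_integrable[OF N.finite_measure_axioms add.hyps(2) V])+
    then show ?case using add.IH by (simp add: tendsto_add)
  qed
  show ?thesis
  proof (rule LIMSEQ_I)
    fix r :: real assume r: "0 < r"
    \<comment> \<open>The absolute value is there because the sign of \<open>C\<close> is not known
      when \<open>S\<close> is empty.\<close>
    define D where "D = 1 + real (card S) * \<bar>C\<bar>"
    have D: "0 < D" "1 + real (card S) * C \<le> D" by (auto simp: D_def add_pos_nonneg mult_left_mono)
    define e where "e = r / (4 * D)"
    have e: "0 < e" using r D by (simp add: e_def)
    have eD: "e * (1 + real (card S) * C) \<le> r / 4"
      using mult_left_mono[OF D(2), of e] e D(1) by (simp add: e_def)
    obtain p where p: "trig_poly S p" "\<And>x. \<bar>F x - p x\<bar> \<le> e * (1 + (\<Sum>i\<in>S. (x i)\<^sup>2))"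
      using trig_poly_approx[OF S F B e] by blast
    obtain n0 where n0: "\<And>n. n0 \<le> n \<Longrightarrow> \<bar>(\<integral>w. p (U n w) \<partial>M) - (\<integral>w. p (V w) \<partial>N)\<bar> < r / 4"
      using LIMSEQ_D[OF trig[OF p(1)], of "r / 4"] r by auto
    have aU: "\<bar>(\<integral>w. F (U n w) \<partial>M) - (\<integral>w. p (U n w) \<partial>M)\<bar> \<le> e * (1 + real (card S) * C)" for n
      by (rule finite_Lipschitz_integral_approx[OF M F B p e U U2])
    have aV: "\<bar>(\<integral>w. F (V w) \<partial>N) - (\<integral>w. p (V w) \<partial>N)\<bar> \<le> e * (1 + real (card S) * C)"
      by (rule finite_Lipschitz_integral_approx[OF N F B p e V V2])
    have "\<bar>(\<integral>w. F (U n w) \<partial>M) - (\<integral>w. F (V w) \<partial>N)\<bar> < r" if "n0 \<le> n" for n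
      using n0[OF that] aU[of n] aV eD r by linarith
    then show "\<exists>no. \<forall>n\<ge>no. norm ((\<integral>w. F (U n w) \<partial>M) - (\<integral>w. F (V w) \<partial>N)) < r" by auto
  qed
qed

section \<open>Independent samples\<close>

definition average :: "(nat \<Rightarrow> 'x) \<Rightarrow> nat \<Rightarrow> ('x \<Rightarrow> real) \<Rightarrow> real" where
  "average x n u = (\<Sum>l=1..n. (1 / real n) * u (x l))"

lemma sample_mean_eq_average: "sample_mean x n h i = average x n (\<lambda>y. h y i)"
  by (simp add: sample_mean_def average_def)

lemma average_diff: "average x n (\<lambda>y. u y - v y) = average x n u - average x n v"
  by (simp add: average_def right_diff_distrib sum_subtractf)

lemma average_cmult: "average x n (\<lambda>y. c * u y) = c * average x n u"
  by (simp add: average_def sum_distrib_left algebra_simps)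

lemma average_sum: "average x n (\<lambda>y. \<Sum>i\<in>A. u i y) = (\<Sum>i\<in>A. average x n (u i))"
  by (simp add: average_def sum_distrib_left) (rule sum.swap)

lemma average_const: "1 \<le> n \<Longrightarrow> average x n (\<lambda>y. c) = c"
  by (simp add: average_def)

lemma average_mono:
  assumes "\<And>l. 1 \<le> l \<Longrightarrow> u (x l) \<le> v (x l)"
  shows "average x n u \<le> average x n v"
  unfolding average_def using assms by (intro sum_mono mult_left_mono) auto

lemma average_abs: "\<bar>average x n u\<bar> \<le> average x n (\<lambda>y. \<bar>u y\<bar>)"
  unfolding average_def by (rule order_trans[OF sum_abs]) (simp add: abs_mult)

text \<open>The sample is numbered from 1 but the central limit theorem from 0; this provides the
  shift.\<close>

lemma (in prob_space) indep_vars_reindex: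
  assumes "indep_vars M' X (f ` I)" and inj: "inj_on f I"
  shows "indep_vars (\<lambda>i. M' (f i)) (\<lambda>i. X (f i)) I"
  unfolding indep_vars_def2
proof
  show "\<forall>i\<in>I. random_variable (M' (f i)) (X (f i))" using assms(1) by (auto simp: indep_vars_def2)
  have sets: "indep_sets (\<lambda>i. {X i -` A \<inter> space M |A. A \<in> sets (M' i)}) (f ` I)"
    using assms(1) by (simp add: indep_vars_def2)
  show "indep_sets (\<lambda>i. {X (f i) -` A \<inter> space M |A. A \<in> sets (M' (f i))}) I"
    unfolding indep_sets_def
  proof (intro conjI ballI allI impI)
    show "{X (f i) -` A \<inter> space M |A. A \<in> sets (M' (f i))} \<subseteq> events" if "i \<in> I" for i
      using sets that unfolding indep_sets_def by auto
    fix J A assume J: "J \<subseteq> I" "J \<noteq> {}" "finite J"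
      and A: "A \<in> (\<Pi> i\<in>J. {X (f i) -` A \<inter> space M |A. A \<in> sets (M' (f i))})"
    have injJ: "inj_on f J" using inj J(1) by (rule inj_on_subset)
    define A' where "A' i = A (the_inv_into J f i)" for i
    have A': "A' (f j) = A j" if "j \<in> J" for j using that injJ by (simp add: A'_def the_inv_into_f_f)
    have "prob (\<Inter>i\<in>f ` J. A' i) = (\<Prod>i\<in>f ` J. prob (A' i))"
      using J A A' by (intro indep_setsD[OF sets]) auto
    then show "prob (\<Inter>j\<in>J. A j) = (\<Prod>j\<in>J. prob (A j))"
      using A' injJ by (simp add: prod.reindex)
  qed
qed

locale iid_sample = prob_space M for M :: "'a measure" +
  fixes P :: "'x measure" and X :: "nat \<Rightarrow> 'a \<Rightarrow> 'x"
  assumes X_indep: "indep_vars (\<lambda>_. P) X {1..}"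
    and X_distr: "\<And>i. 1 \<le> i \<Longrightarrow> distr M P (X i) = P"
begin

abbreviation avg :: "nat \<Rightarrow> 'a \<Rightarrow> ('x \<Rightarrow> real) \<Rightarrow> real" where
  "avg n w \<equiv> average (\<lambda>l. X l w) n"

lemma X_measurable: "1 \<le> i \<Longrightarrow> X i \<in> M \<rightarrow>\<^sub>M P"
  using X_indep by (auto simp: indep_vars_def)

lemma X_space: "1 \<le> i \<Longrightarrow> w \<in> space M \<Longrightarrow> X i w \<in> space P"
  using X_measurable by (rule measurable_space)

lemma compose_measurable: "u \<in> borel_measurable P \<Longrightarrow> 1 \<le> i \<Longrightarrow> (\<lambda>w. u (X i w)) \<in> borel_measurable M"
  using X_measurable by (rule measurable_compose)

lemma average_measurable:
  "u \<in> borel_measurable P \<Longrightarrow> (\<lambda>w. avg n w u) \<in> borel_measurable M"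
  unfolding average_def by (intro borel_measurable_sum borel_measurable_times compose_measurable) auto

lemma expectation_compose:
  fixes u :: "'x \<Rightarrow> real"
  assumes "u \<in> borel_measurable P" "1 \<le> i"
  shows "expectation (\<lambda>w. u (X i w)) = (\<integral>x. u x \<partial>P)"
proof -
  have "(\<integral>x. u x \<partial>P) = (\<integral>x. u x \<partial>distr M P (X i))" using X_distr[OF assms(2)] by simp
  also have "\<dots> = expectation (\<lambda>w. u (X i w))"
    using X_measurable[OF assms(2)] assms(1) by (rule integral_distr)
  finally show ?thesis by simp
qed

lemma integrable_compose:
  fixes u :: "'x \<Rightarrow> real"
  assumes "integrable P u" "1 \<le> i"
  shows "integrable M (\<lambda>w. u (X i w))"
proof -
  have "integrable (distr M P (X i)) u" using X_distr[OF assms(2)] assms(1) by simp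
  then show ?thesis using X_measurable[OF assms(2)] by (rule integrable_distr[rotated])
qed

lemma expectation_average:
  assumes "integrable P u" "1 \<le> n"
  shows "integrable M (\<lambda>w. avg n w u)"
    and "expectation (\<lambda>w. avg n w u) = (\<integral>x. u x \<partial>P)"
proof -
  have i: "integrable M (\<lambda>w. (1 / real n) * u (X l w))" if "l \<in> {1..n}" for l
    using assms that by (intro integrable_mult_right integrable_compose) auto
  then show "integrable M (\<lambda>w. avg n w u)"
    unfolding average_def by (rule Bochner_Integration.integrable_sum)
  have "expectation (\<lambda>w. avg n w u) = (\<Sum>l=1..n. expectation (\<lambda>w. (1 / real n) * u (X l w)))"
    unfolding average_def using i by (rule Bochner_Integration.integral_sum)
  also have "\<dots> = (\<Sum>l=1..n. (1 / real n) * (\<integral>x. u x \<partial>P))"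
    using assms(1) expectation_compose[of u] by (intro sum.cong refl) auto
  also have "\<dots> = (\<integral>x. u x \<partial>P)" using assms(2) by simp
  finally show "expectation (\<lambda>w. avg n w u) = (\<integral>x. u x \<partial>P)" .
qed

lemma uncorrelated:
  assumes u: "square_integrable P u" "(\<integral>x. u x \<partial>P) = 0" and l: "1 \<le> l" and k: "1 \<le> k" and lk: "l \<noteq> k"
  shows "expectation (\<lambda>w. u (X l w) * u (X k w)) = 0"
proof -
  interpret P: prob_space P
    using prob_space_distr[OF X_measurable[of 1]] X_distr[of 1] by simp
  have um: "u \<in> borel_measurable P" using u by (simp add: square_integrable_def)
  have "indep_vars (\<lambda>_. borel) (\<lambda>i w. u (X i w)) {1..}"
    by (rule indep_vars_compose2[OF X_indep, where Y = "\<lambda>_. u"]) (rule um)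
  then have ind: "indep_vars (\<lambda>_. borel) (\<lambda>i w. u (X i w)) {l, k}"
    by (rule indep_vars_subset) (use l k in auto)
  have "expectation (\<lambda>w. \<Prod>i\<in>{l, k}. u (X i w)) = (\<Prod>i\<in>{l, k}. expectation (\<lambda>w. u (X i w)))"
    by (rule indep_vars_lebesgue_integral[OF _ ind])
      (use l k in \<open>auto intro!: integrable_compose P.square_integrable_integrable u\<close>)
  also have "\<dots> = 0" using lk l expectation_compose[OF um] u(2) by simp
  finally show ?thesis using lk by simp
qed

text \<open>Independence removes the off-diagonal terms of the double sum. The formula includes
  \<open>n = 0\<close>, where the sum is empty and the quotient is 0 by division by zero.\<close>

lemma average_second_moment:
  assumes u: "square_integrable P u" "(\<integral>x. u x \<partial>P) = 0"
  shows "integrable M (\<lambda>w. (avg n w u)\<^sup>2)"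
    and "expectation (\<lambda>w. (avg n w u)\<^sup>2) = (\<integral>x. (u x)\<^sup>2 \<partial>P) / real n"
proof -
  have um [measurable]: "u \<in> borel_measurable P" using u by (simp add: square_integrable_def)
  have sq: "square_integrable M (\<lambda>w. (1 / real n) * u (X l w))" if "l \<in> {1..n}" for l
    using that u(1) integrable_compose[of "\<lambda>x. (u x)\<^sup>2" l] compose_measurable[of u l]
    by (intro square_integrable_cmult) (auto simp: square_integrable_def)
  have "square_integrable M (\<lambda>w. avg n w u)"
    unfolding average_def using sq by (rule square_integrable_sum)
  then show "integrable M (\<lambda>w. (avg n w u)\<^sup>2)" by (simp add: square_integrable_def)
  have c: "expectation (\<lambda>w. ((1 / real n) * u (X l w)) * ((1 / real n) * u (X k w)))
      = (if l = k then (\<integral>x. (u x)\<^sup>2 \<partial>P) / (real n)\<^sup>2 else 0)" if "l \<in> {1..n}" "k \<in> {1..n}" for l k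
  proof -
    have "expectation (\<lambda>w. ((1 / real n) * u (X l w)) * ((1 / real n) * u (X k w)))
        = (1 / real n) * (1 / real n) * expectation (\<lambda>w. u (X l w) * u (X k w))"
      by (rule integral_scaled_product)
    also have "expectation (\<lambda>w. u (X l w) * u (X k w)) = (if l = k then (\<integral>x. (u x)\<^sup>2 \<partial>P) else 0)"
      using that uncorrelated[OF u, of l k] expectation_compose[of "\<lambda>x. (u x)\<^sup>2" l]
      by (auto simp: power2_eq_square)
    finally show ?thesis by (auto simp: power2_eq_square)
  qed
  have "expectation (\<lambda>w. (avg n w u)\<^sup>2)
      = (\<Sum>l=1..n. \<Sum>k=1..n. expectation (\<lambda>w. ((1 / real n) * u (X l w)) * ((1 / real n) * u (X k w))))"
    unfolding average_def power2_eq_square by (rule integral_sum_squares[OF sq sq])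
  also have "\<dots> = (\<Sum>l=1..n. \<Sum>k=1..n. if l = k then (\<integral>x. (u x)\<^sup>2 \<partial>P) / (real n)\<^sup>2 else 0)"
    using c by (intro sum.cong refl) auto
  also have "\<dots> = (\<integral>x. (u x)\<^sup>2 \<partial>P) / real n" by (simp add: power2_eq_square)
  finally show "expectation (\<lambda>w. (avg n w u)\<^sup>2) = (\<integral>x. (u x)\<^sup>2 \<partial>P) / real n" .
qed

text \<open>The bound is an equality except possibly at \<open>n = 0\<close>, where the left side is
  0.\<close>

lemma scaled_average_second_moment:
  assumes u: "square_integrable P u" "(\<integral>x. u x \<partial>P) = 0"
  shows "integrable M (\<lambda>w. (sqrt (real n) * avg n w u)\<^sup>2)"
    and "expectation (\<lambda>w. (sqrt (real n) * avg n w u)\<^sup>2) \<le> (\<integral>x. (u x)\<^sup>2 \<partial>P)"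
  using average_second_moment[OF u, of n] by (auto simp: power_mult_distrib)

text \<open>The central limit theorem normalizes by a positive standard deviation, so variance 0 is
  treated apart: the averages then vanish almost surely. With characteristic functions both cases
  share one formula.\<close>

lemma CLT_char:
  assumes u: "square_integrable P u" "(\<integral>x. u x \<partial>P) = 0"
  shows "(\<lambda>n. char (distr M borel (\<lambda>w. sqrt (real n) * avg n w u)) t)
    \<longlonglongrightarrow> complex_of_real (exp (- (t\<^sup>2 * (\<integral>x. (u x)\<^sup>2 \<partial>P)) / 2))"
proof (cases "(\<integral>x. (u x)\<^sup>2 \<partial>P) = 0")
  case True
  have "char (distr M borel (\<lambda>w. sqrt (real n) * avg n w u)) t = 1" for n
  proof -
    let ?Y = "\<lambda>w. sqrt (real n) * avg n w u"
    have [measurable]: "(\<lambda>w. avg n w u) \<in> borel_measurable M"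
      using average_measurable u(1) by (auto simp: square_integrable_def)
    have Y: "?Y \<in> borel_measurable M" by measurable
    have "expectation (\<lambda>w. (?Y w)\<^sup>2) = 0"
      using scaled_average_second_moment(2)[OF u, of n] True by (simp add: antisym integral_nonneg)
    then have "AE w in M. (?Y w)\<^sup>2 = 0"
      using scaled_average_second_moment(1)[OF u, of n] by (subst (asm) integral_nonneg_eq_0_iff_AE) auto
    then have "AE w in M. ?Y w = 0" by auto
    then have "(CLINT w|M. iexp (t * ?Y w)) = (CLINT w|M. 1)"
      by (intro integral_cong_AE) auto
    then show ?thesis using Y by (simp add: char_distr_eq prob_space)
  qed
  then show ?thesis using True by simp
next
  case False
  interpret P: prob_space P
    using prob_space_distr[OF X_measurable[of 1]] X_distr[of 1] by simp
  have um: "u \<in> borel_measurable P" using u by (simp add: square_integrable_def)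
  define \<sigma> where "\<sigma> = sqrt (\<integral>x. (u x)\<^sup>2 \<partial>P)"
  have s0: "0 \<le> (\<integral>x. (u x)\<^sup>2 \<partial>P)" by (rule Bochner_Integration.integral_nonneg) simp
  then have \<sigma>: "0 < \<sigma>" "\<sigma>\<^sup>2 = (\<integral>x. (u x)\<^sup>2 \<partial>P)" using False by (auto simp: \<sigma>_def less_le)
  define Y where "Y i = (\<lambda>w. u (X (Suc i) w))" for i
  have Ym [measurable]: "Y i \<in> borel_measurable M" for i
    unfolding Y_def using um by (rule compose_measurable) simp
  have E0: "expectation (Y i) = 0" for i unfolding Y_def using expectation_compose[OF um] u(2) by simp
  have sqm: "(\<lambda>x. (u x)\<^sup>2) \<in> borel_measurable P" using um by (rule borel_measurable_power)
  have wc: "weak_conv_m (\<lambda>n. distr M borel (\<lambda>w. (\<Sum>i<n. Y i w) / sqrt (n * \<sigma>\<^sup>2))) std_normal_distribution"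
  proof (rule central_limit_theorem_zero_mean)
    have "indep_vars (\<lambda>_. borel) (\<lambda>i w. u (X i w)) {1..}"
      by (rule indep_vars_compose2[OF X_indep, where Y = "\<lambda>_. u"]) (rule um)
    moreover have "{1..} = range Suc" by (auto simp: image_iff) (metis Suc_le_D)
    ultimately show "indep_vars (\<lambda>i. borel) Y UNIV"
      unfolding Y_def by (intro indep_vars_reindex[where f = Suc and M' = "\<lambda>_. borel"]) auto
    show "integrable M (\<lambda>x. (Y n x)\<^sup>2)" for n
      unfolding Y_def using u(1) by (intro integrable_compose) (auto simp: square_integrable_def)
    show "variance (Y n) = \<sigma>\<^sup>2" for n
      unfolding E0 using expectation_compose[OF sqm, of "Suc n"] \<sigma>(2) by (simp add: Y_def)
    show "distr M borel (Y n) = distr P borel u" for n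
    proof -
      have "distr P borel u = distr (distr M P (X (Suc n))) borel u" using X_distr[of "Suc n"] by simp
      also have "\<dots> = distr M borel (u \<circ> X (Suc n))"
        using um X_measurable[of "Suc n"] by (intro distr_distr) auto
      finally show ?thesis by (simp add: Y_def comp_def)
    qed
  qed (use E0 \<sigma> in auto)
  \<comment> \<open>Evaluating at \<open>t * \<sigma>\<close> instead of \<open>t\<close> undoes the
    division by the standard deviation.\<close>
  have "(\<lambda>n. char (distr M borel (\<lambda>w. (\<Sum>i<n. Y i w) / sqrt (n * \<sigma>\<^sup>2))) (t * \<sigma>)) \<longlonglongrightarrow> char std_normal_distribution (t * \<sigma>)"
    by (rule levy_continuity1[OF _ real_dist_normal_dist wc]) (rule real_distribution_distr, measurable)
  moreover have "char (distr M borel (\<lambda>w. (\<Sum>i<n. Y i w) / sqrt (n * \<sigma>\<^sup>2))) (t * \<sigma>)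
    = char (distr M borel (\<lambda>w. sqrt (real n) * avg n w u)) t" for n
  proof -
    have eq: "t * \<sigma> * ((\<Sum>i<n. Y i w) / sqrt (n * \<sigma>\<^sup>2)) = t * (sqrt (real n) * avg n w u)" for w
    proof (cases "n = 0")
      case False
      have "(\<Sum>i<n. Y i w) = (\<Sum>l=1..n. u (X l w))"
        unfolding Y_def by (rule sum.reindex_bij_witness[of _ "\<lambda>l. l - 1" Suc]) auto
      then have av: "avg n w u = (\<Sum>i<n. Y i w) / real n"
        by (simp add: average_def sum_divide_distrib)
      have "sqrt (real n) * sqrt (real n) = real n" by simp
      then show ?thesis unfolding av using \<sigma>(1) False by (simp add: real_sqrt_mult field_simps)
    qed (simp add: average_def)
    have "(\<lambda>w. sqrt (real n) * avg n w u) \<in> borel_measurable M"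
      using average_measurable[OF um] by auto
    then show ?thesis by (subst (1 2) char_distr_eq) (auto simp only: eq, measurable)
  qed
  moreover have "char std_normal_distribution (t * \<sigma>) = complex_of_real (exp (- (t\<^sup>2 * (\<integral>x. (u x)\<^sup>2 \<partial>P)) / 2))"
    by (simp add: char_std_normal_distribution power_mult_distrib \<sigma>(2))
  ultimately show ?thesis by simp
qed

end

section \<open>Convergence and tightness in probability\<close>

context prob_space
begin

definition null_in_prob :: "(nat \<Rightarrow> 'a \<Rightarrow> real) \<Rightarrow> bool" where
  "null_in_prob Y \<longleftrightarrow> (\<forall>n. Y n \<in> borel_measurable M) \<and>
     (\<forall>e>0. \<forall>\<delta>>0. \<forall>\<^sub>F n in sequentially. prob {w \<in> space M. e < \<bar>Y n w\<bar>} \<le> \<delta>)"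

definition tight_in_prob :: "(nat \<Rightarrow> 'a \<Rightarrow> real) \<Rightarrow> bool" where
  "tight_in_prob Y \<longleftrightarrow> (\<forall>n. Y n \<in> borel_measurable M) \<and>
     (\<forall>\<delta>>0. \<exists>K. \<forall>\<^sub>F n in sequentially. prob {w \<in> space M. K < \<bar>Y n w\<bar>} \<le> \<delta>)"

lemma prob_abs_gt_subadditive:
  fixes U V W :: "'a \<Rightarrow> real"
  assumes m: "U \<in> borel_measurable M" "V \<in> borel_measurable M"
    and le: "\<And>w. w \<in> space M \<Longrightarrow> \<bar>W w\<bar> \<le> \<bar>U w\<bar> + \<bar>V w\<bar>"
  shows "prob {w \<in> space M. a + b < \<bar>W w\<bar>}
    \<le> prob {w \<in> space M. a < \<bar>U w\<bar>} + prob {w \<in> space M. b < \<bar>V w\<bar>}"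
proof -
  note [measurable] = m
  have s: "{w \<in> space M. a < \<bar>U w\<bar>} \<in> events" "{w \<in> space M. b < \<bar>V w\<bar>} \<in> events"
    by simp_all
  have "prob {w \<in> space M. a + b < \<bar>W w\<bar>}
      \<le> prob ({w \<in> space M. a < \<bar>U w\<bar>} \<union> {w \<in> space M. b < \<bar>V w\<bar>})"
  proof (rule finite_measure_mono)
    show "{w \<in> space M. a + b < \<bar>W w\<bar>} \<subseteq> {w \<in> space M. a < \<bar>U w\<bar>} \<union> {w \<in> space M. b < \<bar>V w\<bar>}"
    proof
      fix w assume w: "w \<in> {w \<in> space M. a + b < \<bar>W w\<bar>}"
      then have "a + b < \<bar>U w\<bar> + \<bar>V w\<bar>" using le[of w] by simp
      then have "a < \<bar>U w\<bar> \<or> b < \<bar>V w\<bar>" by linarith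
      then show "w \<in> {w \<in> space M. a < \<bar>U w\<bar>} \<union> {w \<in> space M. b < \<bar>V w\<bar>}"
        using w by auto
    qed
    show "{w \<in> space M. a < \<bar>U w\<bar>} \<union> {w \<in> space M. b < \<bar>V w\<bar>} \<in> events" using s by (rule sets.Un)
  qed
  also have "\<dots> \<le> prob {w \<in> space M. a < \<bar>U w\<bar>} + prob {w \<in> space M. b < \<bar>V w\<bar>}"
    using s by (rule measure_Un_le)
  finally show ?thesis .
qed

lemma null_in_prob_measurable: "null_in_prob Y \<Longrightarrow> Y n \<in> borel_measurable M"
  by (simp add: null_in_prob_def)

lemma null_in_probD:
  "null_in_prob Y \<Longrightarrow> 0 < e \<Longrightarrow> 0 < \<delta> \<Longrightarrow> \<forall>\<^sub>F n in sequentially. prob {w \<in> space M. e < \<bar>Y n w\<bar>} \<le> \<delta>"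
  by (simp add: null_in_prob_def)

lemma tight_in_prob_measurable: "tight_in_prob Y \<Longrightarrow> Y n \<in> borel_measurable M"
  by (simp add: tight_in_prob_def)

lemma null_in_prob_zero: "null_in_prob (\<lambda>n w. 0)"
  by (simp add: null_in_prob_def)

lemma null_in_prob_dominated:
  assumes U: "null_in_prob U" and V: "null_in_prob V" and W: "\<And>n. W n \<in> borel_measurable M"
    and le: "\<And>n w. w \<in> space M \<Longrightarrow> \<bar>W n w\<bar> \<le> \<bar>U n w\<bar> + \<bar>V n w\<bar>"
  shows "null_in_prob W"
  unfolding null_in_prob_def
proof (intro conjI allI impI W)
  fix e \<delta> :: real assume e: "0 < e" and \<delta>: "0 < \<delta>"
  have "\<forall>\<^sub>F n in sequentially. prob {w \<in> space M. e / 2 < \<bar>U n w\<bar>} \<le> \<delta> / 2"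
    "\<forall>\<^sub>F n in sequentially. prob {w \<in> space M. e / 2 < \<bar>V n w\<bar>} \<le> \<delta> / 2"
    using null_in_probD[OF U, of "e / 2" "\<delta> / 2"] null_in_probD[OF V, of "e / 2" "\<delta> / 2"] e \<delta> by simp_all
  then show "\<forall>\<^sub>F n in sequentially. prob {w \<in> space M. e < \<bar>W n w\<bar>} \<le> \<delta>"
  proof eventually_elim
    case (elim n)
    show ?case
      using prob_abs_gt_subadditive[of "U n" "V n" "W n" "e / 2" "e / 2",
          OF null_in_prob_measurable[OF U] null_in_prob_measurable[OF V] le] elim by simp
  qed
qed

lemma null_in_prob_bound:
  assumes "null_in_prob U" "\<And>n. W n \<in> borel_measurable M" "\<And>n w. w \<in> space M \<Longrightarrow> \<bar>W n w\<bar> \<le> \<bar>U n w\<bar>"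
  shows "null_in_prob W"
  using assms by (intro null_in_prob_dominated[OF assms(1) null_in_prob_zero]) auto

lemma null_in_prob_add:
  assumes "null_in_prob U" "null_in_prob V"
  shows "null_in_prob (\<lambda>n w. U n w + V n w)"
proof (rule null_in_prob_dominated[OF assms])
  show "(\<lambda>w. U n w + V n w) \<in> borel_measurable M" for n
    by (intro borel_measurable_add null_in_prob_measurable assms)
qed (rule abs_triangle_ineq)

lemma null_in_prob_cmult:
  assumes U: "null_in_prob U"
  shows "null_in_prob (\<lambda>n w. c * U n w)"
proof (cases "c = 0")
  case False
  have "{w \<in> space M. e < \<bar>c * U n w\<bar>} = {w \<in> space M. e / \<bar>c\<bar> < \<bar>U n w\<bar>}" for e n
    using False by (auto simp: abs_mult divide_simps mult.commute)
  moreover have "(\<lambda>w. c * U n w) \<in> borel_measurable M" for n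
    by (intro borel_measurable_times borel_measurable_const null_in_prob_measurable U)
  ultimately show ?thesis using U False by (auto simp: null_in_prob_def)
qed (simp add: null_in_prob_zero)

lemma null_in_prob_sum:
  assumes "\<And>i. i \<in> A \<Longrightarrow> null_in_prob (\<lambda>n. U n i)"
  shows "null_in_prob (\<lambda>n w. \<Sum>i\<in>A. U n i w)"
  using assms
proof (induction A rule: infinite_finite_induct)
  case (insert i A)
  then show ?case by (simp add: null_in_prob_add)
qed (simp_all add: null_in_prob_zero)

lemma null_in_prob_abs:
  assumes "null_in_prob U"
  shows "null_in_prob (\<lambda>n w. \<bar>U n w\<bar>)"
proof (rule null_in_prob_bound[OF assms])
  show "(\<lambda>w. \<bar>U n w\<bar>) \<in> borel_measurable M" for n
    by (intro borel_measurable_abs null_in_prob_measurable assms)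
qed simp

lemma null_in_prob_imp_tight: "null_in_prob U \<Longrightarrow> tight_in_prob U"
  unfolding null_in_prob_def tight_in_prob_def by (meson zero_less_one)

lemma tight_in_prob_dominated:
  assumes U: "tight_in_prob U" and V: "tight_in_prob V" and W: "\<And>n. W n \<in> borel_measurable M"
    and le: "\<And>n w. w \<in> space M \<Longrightarrow> \<bar>W n w\<bar> \<le> \<bar>U n w\<bar> + \<bar>V n w\<bar>"
  shows "tight_in_prob W"
  unfolding tight_in_prob_def
proof (intro conjI allI impI W)
  fix \<delta> :: real assume \<delta>: "0 < \<delta>"
  obtain K where K: "\<forall>\<^sub>F n in sequentially. prob {w \<in> space M. K < \<bar>U n w\<bar>} \<le> \<delta> / 2"
    using U \<delta> unfolding tight_in_prob_def by (meson half_gt_zero)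
  obtain L where L: "\<forall>\<^sub>F n in sequentially. prob {w \<in> space M. L < \<bar>V n w\<bar>} \<le> \<delta> / 2"
    using V \<delta> unfolding tight_in_prob_def by (meson half_gt_zero)
  from K L have "\<forall>\<^sub>F n in sequentially. prob {w \<in> space M. K + L < \<bar>W n w\<bar>} \<le> \<delta>"
  proof eventually_elim
    case (elim n)
    show ?case
      using prob_abs_gt_subadditive[of "U n" "V n" "W n" K L,
          OF tight_in_prob_measurable[OF U] tight_in_prob_measurable[OF V] le] elim by simp
  qed
  then show "\<exists>K. \<forall>\<^sub>F n in sequentially. prob {w \<in> space M. K < \<bar>W n w\<bar>} \<le> \<delta>" by blast
qed

lemma tight_in_prob_add:
  assumes "tight_in_prob U" "tight_in_prob V"
  shows "tight_in_prob (\<lambda>n w. U n w + V n w)"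
proof (rule tight_in_prob_dominated[OF assms])
  show "(\<lambda>w. U n w + V n w) \<in> borel_measurable M" for n
    by (intro borel_measurable_add tight_in_prob_measurable assms)
qed (rule abs_triangle_ineq)

lemma tight_in_prob_cmult:
  assumes U: "tight_in_prob U"
  shows "tight_in_prob (\<lambda>n w. c * U n w)"
  unfolding tight_in_prob_def
proof (intro conjI allI impI)
  show "(\<lambda>w. c * U n w) \<in> borel_measurable M" for n
    using tight_in_prob_measurable[OF U] by (rule borel_measurable_const[THEN borel_measurable_times])
  fix \<delta> :: real assume "0 < \<delta>"
  then obtain K where K: "\<forall>\<^sub>F n in sequentially. prob {w \<in> space M. K < \<bar>U n w\<bar>} \<le> \<delta>"
    using U unfolding tight_in_prob_def by blast
  have "{w \<in> space M. \<bar>c\<bar> * \<bar>K\<bar> < \<bar>c * U n w\<bar>} \<subseteq> {w \<in> space M. K < \<bar>U n w\<bar>}" for n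
    by (auto simp: abs_mult mult_less_cancel_left)
  then have "prob {w \<in> space M. \<bar>c\<bar> * \<bar>K\<bar> < \<bar>c * U n w\<bar>} \<le> prob {w \<in> space M. K < \<bar>U n w\<bar>}" for n
    using tight_in_prob_measurable[OF U] by (intro finite_measure_mono) auto
  then show "\<exists>K. \<forall>\<^sub>F n in sequentially. prob {w \<in> space M. K < \<bar>c * U n w\<bar>} \<le> \<delta>"
    using K by (intro exI[of _ "\<bar>c\<bar> * \<bar>K\<bar>"]) (elim eventually_mono, meson order_trans)
qed

lemma tight_in_prob_sum_abs:
  assumes "\<And>i. i \<in> A \<Longrightarrow> tight_in_prob (\<lambda>n. U n i)"
  shows "tight_in_prob (\<lambda>n w. \<Sum>i\<in>A. \<bar>U n i w\<bar>)"
  using assms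
proof (induction A rule: infinite_finite_induct)
  case (insert i A)
  have "tight_in_prob (\<lambda>n w. \<bar>U n i w\<bar>)"
    using insert.prems[of i] by (simp add: tight_in_prob_def borel_measurable_abs)
  then show ?case using insert by (simp add: tight_in_prob_add)
qed (simp_all add: null_in_prob_zero null_in_prob_imp_tight)

lemma prob_abs_gt_le_second_moment:
  assumes "Y \<in> borel_measurable M" "integrable M (\<lambda>w. (Y w)\<^sup>2)" "0 < K"
  shows "prob {w \<in> space M. K < \<bar>Y w\<bar>} \<le> expectation (\<lambda>w. (Y w)\<^sup>2) / K\<^sup>2"
proof -
  have "prob {w \<in> space M. K < \<bar>Y w\<bar>} \<le> prob {w \<in> space M. K\<^sup>2 \<le> (Y w)\<^sup>2}"
    using assms by (intro finite_measure_mono) (auto simp: abs_le_square_iff[symmetric])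
  also have "\<dots> \<le> expectation (\<lambda>w. (Y w)\<^sup>2) / K\<^sup>2"
    using assms by (intro integral_Markov_inequality_measure[where A = "{}"]) auto
  finally show ?thesis .
qed

lemma tight_in_prob_second_moment:
  assumes Y: "\<And>n. Y n \<in> borel_measurable M" "\<And>n. integrable M (\<lambda>w. (Y n w)\<^sup>2)"
    and C: "\<And>n. expectation (\<lambda>w. (Y n w)\<^sup>2) \<le> C"
  shows "tight_in_prob Y"
  unfolding tight_in_prob_def
proof (intro conjI allI impI Y)
  fix \<delta> :: real assume \<delta>: "0 < \<delta>"
  have C0: "0 \<le> C" using order_trans[OF Bochner_Integration.integral_nonneg C[of 0]] by simp
  \<comment> \<open>Solves \<open>(C + 1) / K\<^sup>2 = \<delta>\<close>; the summand 1 keeps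
    \<open>K\<close> positive when \<open>C = 0\<close>.\<close>
  define K where "K = sqrt ((C + 1) / \<delta>)"
  have K: "0 < K" "K\<^sup>2 = (C + 1) / \<delta>" using C0 \<delta> by (auto simp: K_def)
  have "prob {w \<in> space M. K < \<bar>Y n w\<bar>} \<le> \<delta>" for n
  proof -
    have "prob {w \<in> space M. K < \<bar>Y n w\<bar>} \<le> expectation (\<lambda>w. (Y n w)\<^sup>2) / K\<^sup>2"
      using Y K by (intro prob_abs_gt_le_second_moment)
    also have "\<dots> \<le> C / K\<^sup>2" using C by (intro divide_right_mono) auto
    also have "\<dots> \<le> \<delta>" unfolding K(2) using C0 \<delta> by (simp add: field_simps)
    finally show ?thesis .
  qed
  then show "\<exists>K. \<forall>\<^sub>F n in sequentially. prob {w \<in> space M. K < \<bar>Y n w\<bar>} \<le> \<delta>"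
    by (intro exI[of _ K] always_eventually allI)
qed

lemma null_in_prob_Chebyshev:
  assumes Y: "\<And>n. Y n \<in> borel_measurable M"
    and Y2: "\<forall>\<^sub>F n in sequentially. integrable M (\<lambda>w. (Y n w)\<^sup>2) \<and> expectation (\<lambda>w. (Y n w)\<^sup>2) \<le> c n"
    and c: "c \<longlonglongrightarrow> 0"
  shows "null_in_prob Y"
  unfolding null_in_prob_def
proof (intro conjI allI impI Y)
  fix e \<delta> :: real assume e: "0 < e" and \<delta>: "0 < \<delta>"
  have "\<forall>\<^sub>F n in sequentially. c n < \<delta> * e\<^sup>2" using order_tendstoD(2)[OF c] e \<delta> by auto
  with Y2 show "\<forall>\<^sub>F n in sequentially. prob {w \<in> space M. e < \<bar>Y n w\<bar>} \<le> \<delta>"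
  proof eventually_elim
    case (elim n)
    have "prob {w \<in> space M. e < \<bar>Y n w\<bar>} \<le> expectation (\<lambda>w. (Y n w)\<^sup>2) / e\<^sup>2"
      using Y e elim by (intro prob_abs_gt_le_second_moment) auto
    also have "\<dots> \<le> (\<delta> * e\<^sup>2) / e\<^sup>2" using elim by (intro divide_right_mono) auto
    finally show ?case using e by simp
  qed
qed

lemma null_in_prob_of_real:
  assumes "c \<longlonglongrightarrow> 0"
  shows "null_in_prob (\<lambda>n w. c n)"
  unfolding null_in_prob_def
proof (intro conjI allI impI)
  fix e \<delta> :: real assume e: "0 < e" and \<delta>: "0 < \<delta>"
  have "\<forall>\<^sub>F n in sequentially. \<bar>c n\<bar> < e" using assms e by (auto simp: tendsto_iff dist_real_def)
  then show "\<forall>\<^sub>F n in sequentially. prob {w \<in> space M. e < \<bar>c n\<bar>} \<le> \<delta>"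
    by eventually_elim (use \<delta> in simp)
qed simp

text \<open>Slutsky's argument for a bounded Lipschitz test function: where the two variables are
  within \<open>e\<close> the Lipschitz bound is small, and elsewhere the difference is at most 2 on
  an event of small probability.\<close>

lemma null_in_prob_Lipschitz:
  assumes null: "null_in_prob (\<lambda>n w. Y n w - Z n w)"
    and Y: "\<And>n. Y n \<in> borel_measurable M" and Z: "\<And>n. Z n \<in> borel_measurable M"
    and \<phi>: "\<phi> \<in> borel_measurable borel" "\<And>a. \<bar>\<phi> a\<bar> \<le> 1" "\<And>a b. \<bar>\<phi> a - \<phi> b\<bar> \<le> L * \<bar>a - b\<bar>"
  shows "(\<lambda>n. expectation (\<lambda>w. \<phi> (Y n w)) - expectation (\<lambda>w. \<phi> (Z n w))) \<longlonglongrightarrow> 0"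
proof (rule LIMSEQ_I)
  fix r :: real assume r: "0 < r"
  define c where "c = \<bar>L\<bar> + 1"
  \<comment> \<open>Makes the Lipschitz part at most \<open>r / 4\<close>; the event of probability
    at most \<open>r / 8\<close> contributes another \<open>r / 4\<close>.\<close>
  define e where "e = r / (4 * c)"
  have c: "0 < c" "\<bar>L\<bar> \<le> c" by (auto simp: c_def)
  have e: "0 < e" using r c by (simp add: e_def)
  have "\<bar>L\<bar> * e \<le> c * e" using c e by (intro mult_right_mono) auto
  also have "c * e = r / 4" using c by (simp add: e_def)
  finally have Le: "\<bar>L\<bar> * e \<le> r / 4" .
  have i: "integrable M (\<lambda>w. \<phi> (V w))" if "V \<in> borel_measurable M" for V
    using measurable_compose[OF that \<phi>(1)] \<phi>(2) by (intro integrable_const_bound[where B = 1]) auto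
  have "0 < r / 8" using r by simp
  from null_in_probD[OF null e this] obtain n0 where n0: "\<And>n. n0 \<le> n \<Longrightarrow> prob {w \<in> space M. e < \<bar>Y n w - Z n w\<bar>} \<le> r / 8"
    by (auto simp: eventually_sequentially)
  have "\<bar>expectation (\<lambda>w. \<phi> (Y n w)) - expectation (\<lambda>w. \<phi> (Z n w))\<bar> < r" if n: "n0 \<le> n" for n
  proof -
    let ?E = "{w \<in> space M. e < \<bar>Y n w - Z n w\<bar>}"
    note [measurable] = Y Z
    have E: "?E \<in> events" by simp
    have iE: "integrable M (indicator ?E :: 'a \<Rightarrow> real)" using E by (simp add: less_top[symmetric])
    have "\<bar>expectation (\<lambda>w. \<phi> (Y n w)) - expectation (\<lambda>w. \<phi> (Z n w))\<bar> = \<bar>expectation (\<lambda>w. \<phi> (Y n w) - \<phi> (Z n w))\<bar>"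
      using i[OF Y] i[OF Z] by simp
    also have "\<dots> \<le> expectation (\<lambda>w. \<bar>\<phi> (Y n w) - \<phi> (Z n w)\<bar>)" by (rule integral_abs_bound)
    also have "\<dots> \<le> expectation (\<lambda>w. r / 4 + 2 * indicator ?E w)"
    proof (rule integral_mono)
      show "integrable M (\<lambda>w. \<bar>\<phi> (Y n w) - \<phi> (Z n w)\<bar>)" using i[OF Y] i[OF Z] by auto
      show "integrable M (\<lambda>w. r / 4 + 2 * indicator ?E w)" using iE by auto
      fix w assume w: "w \<in> space M"
      show "\<bar>\<phi> (Y n w) - \<phi> (Z n w)\<bar> \<le> r / 4 + 2 * indicator ?E w"
      proof (cases "w \<in> ?E")
        case True
        then show ?thesis using \<phi>(2)[of "Y n w"] \<phi>(2)[of "Z n w"] r by (simp add: indicator_def)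
      next
        case False
        have "\<bar>\<phi> (Y n w) - \<phi> (Z n w)\<bar> \<le> L * \<bar>Y n w - Z n w\<bar>" by (rule \<phi>(3))
        also have "\<dots> \<le> \<bar>L\<bar> * e" using False w by (intro mult_mono) auto
        finally show ?thesis using Le False by simp
      qed
    qed
    also have "\<dots> = r / 4 + 2 * prob ?E" using iE E by (simp add: prob_space)
    also have "\<dots> < r" using n0[OF n] r by linarith
    finally show ?thesis .
  qed
  then show "\<exists>no. \<forall>n\<ge>no. norm (expectation (\<lambda>w. \<phi> (Y n w)) - expectation (\<lambda>w. \<phi> (Z n w)) - 0) < r" by auto
qed

end

section \<open>Local expansion of empirical averages\<close>

lemma dist1_affine: "dist1 d (\<lambda>i. \<mu> i + c * s i) (\<lambda>i. \<mu> i + c * s' i) = \<bar>c\<bar> * dist1 d s s'"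
  unfolding dist1_def by (simp add: abs_mult sum_distrib_left flip: right_diff_distrib)

lemma dist1_affine_self: "dist1 d (\<lambda>i. \<mu> i + c * s i) \<mu> = \<bar>c\<bar> * dist1 d s (\<lambda>_. 0)"
  using dist1_affine[of d \<mu> c s "\<lambda>_. 0"] by simp

text \<open>
  Here \<open>h\<close> is one coordinate of a random function near a point \<open>\<mu>\<close>, and \<open>h'\<close> its directional derivative at \<open>\<mu>\<close>,
  which is needed only along the steps \<open>1 / sqrt n\<close>. At \<open>n = 0\<close> the step is \<open>0\<close>, by division by zero.
\<close>

locale delta_method = iid_sample M P X
  for M :: "'a measure" and P :: "'x measure" and X +
  fixes d :: nat and J :: "rvec set" and \<mu> :: rvec and r :: real
    and h :: "rvec \<Rightarrow> 'x \<Rightarrow> real" and h' :: "rvec \<Rightarrow> 'x \<Rightarrow> real" and \<gamma> :: "'x \<Rightarrow> real"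
  assumes r_pos: "0 < r" and \<mu>_Rvec: "\<mu> \<in> Rvec d"
    and ball: "\<And>v. v \<in> Rvec d \<Longrightarrow> dist1 d v \<mu> \<le> r \<Longrightarrow> v \<in> J"
    and h_meas: "\<And>v. v \<in> Rvec d \<Longrightarrow> h v \<in> borel_measurable P"
    and \<gamma>_sq: "square_integrable P \<gamma>" and \<gamma>_nonneg: "\<And>x. 0 \<le> \<gamma> x"
    and Lipschitz: "\<And>v w x. v \<in> J \<Longrightarrow> w \<in> J \<Longrightarrow> x \<in> space P \<Longrightarrow> \<bar>h v x - h w x\<bar> \<le> \<gamma> x * dist1 d v w"
    and deriv: "\<And>s x. s \<in> Rvec d \<Longrightarrow> x \<in> space P \<Longrightarrow>
      (\<lambda>n. sqrt (real n) * (h (\<lambda>i. \<mu> i + 1 / sqrt (real n) * s i) x - h \<mu> x)) \<longlonglongrightarrow> h' s x"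
begin

definition q :: "nat \<Rightarrow> rvec \<Rightarrow> 'x \<Rightarrow> real" where
  "q n s x = sqrt (real n) * (h (\<lambda>i. \<mu> i + 1 / sqrt (real n) * s i) x - h \<mu> x)"

definition D :: "rvec \<Rightarrow> real" where
  "D s = (\<integral>x. h' s x \<partial>P)"

text \<open>The directions for which the shifted point lies in the ball contained in
  \<open>J\<close>, where the Lipschitz bound is available. At \<open>n = 0\<close> the step is 0
  and the second condition would admit every \<open>s\<close>, hence the requirement
  \<open>1 \<le> n\<close>.\<close>

definition inside :: "nat \<Rightarrow> rvec \<Rightarrow> bool" where
  "inside n s \<longleftrightarrow> 1 \<le> n \<and> (1 / sqrt (real n)) * dist1 d s (\<lambda>_. 0) \<le> r"

lemma prob_space_P: "prob_space P"
  using prob_space_distr[OF X_measurable[of 1]] X_distr[of 1] by simp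

lemma zero_Rvec: "(\<lambda>_. 0) \<in> Rvec d"
  by (simp add: topspace_Euclidean_space)

lemma shift_Rvec: "s \<in> Rvec d \<Longrightarrow> (\<lambda>i. \<mu> i + c * s i) \<in> Rvec d"
  using \<mu>_Rvec by (simp add: topspace_Euclidean_space)

lemma inside_zero: "1 \<le> n \<Longrightarrow> inside n (\<lambda>_. 0)"
  using r_pos by (simp add: inside_def dist1_def)

lemma shift_J: "s \<in> Rvec d \<Longrightarrow> inside n s \<Longrightarrow> (\<lambda>i. \<mu> i + 1 / sqrt (real n) * s i) \<in> J"
  by (rule ball[OF shift_Rvec]) (simp_all only: dist1_affine_self, simp add: inside_def)

lemma eventually_inside_bounded:
  "\<forall>\<^sub>F n in sequentially. \<forall>s. dist1 d s (\<lambda>_. 0) \<le> K \<longrightarrow> inside n s"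
proof -
  have "(\<lambda>n. 1 / sqrt (real n) * \<bar>K\<bar>) \<longlonglongrightarrow> 0"
    by real_asymp
  then have "\<forall>\<^sub>F n in sequentially. 1 / sqrt (real n) * \<bar>K\<bar> < r"
    using r_pos by (rule order_tendstoD)
  moreover have "\<forall>\<^sub>F n in sequentially. 1 \<le> n" by (rule eventually_ge_at_top)
  ultimately show ?thesis
  proof eventually_elim
    case (elim n)
    show ?case
    proof (intro allI impI)
      fix s assume "dist1 d s (\<lambda>_. 0) \<le> K"
      then have "1 / sqrt (real n) * dist1 d s (\<lambda>_. 0) \<le> 1 / sqrt (real n) * \<bar>K\<bar>"
        by (intro mult_left_mono) auto
      then show "inside n s" using elim by (simp add: inside_def)
    qed
  qed
qed

lemma eventually_inside: "\<forall>\<^sub>F n in sequentially. inside n s"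
  using eventually_inside_bounded[of "dist1 d s (\<lambda>_. 0)"] by eventually_elim simp

lemma q_measurable: "s \<in> Rvec d \<Longrightarrow> q n s \<in> borel_measurable P"
  unfolding q_def[abs_def]
  by (intro borel_measurable_times borel_measurable_diff borel_measurable_const h_meas shift_Rvec \<mu>_Rvec)

lemma q_zero: "q n (\<lambda>_. 0) x = 0"
  by (simp add: q_def)

lemma q_Lipschitz:
  assumes "s \<in> Rvec d" "s' \<in> Rvec d" "inside n s" "inside n s'" "x \<in> space P"
  shows "\<bar>q n s x - q n s' x\<bar> \<le> \<gamma> x * dist1 d s s'"
proof -
  have n: "1 \<le> n" using assms(3) by (simp add: inside_def)
  have "\<bar>q n s x - q n s' x\<bar> = sqrt (real n) * \<bar>h (\<lambda>i. \<mu> i + 1 / sqrt (real n) * s i) x - h (\<lambda>i. \<mu> i + 1 / sqrt (real n) * s' i) x\<bar>"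
    by (simp add: q_def abs_mult flip: right_diff_distrib)
  also have "\<dots> \<le> sqrt (real n) * (\<gamma> x * dist1 d (\<lambda>i. \<mu> i + 1 / sqrt (real n) * s i) (\<lambda>i. \<mu> i + 1 / sqrt (real n) * s' i))"
    using assms by (intro mult_left_mono Lipschitz shift_J) auto
  also have "\<dots> = \<gamma> x * dist1 d s s'"
    unfolding dist1_affine using n by simp
  finally show ?thesis .
qed

lemma q_bound:
  assumes "s \<in> Rvec d" "inside n s" "x \<in> space P"
  shows "\<bar>q n s x\<bar> \<le> \<gamma> x * dist1 d s (\<lambda>_. 0)"
  using q_Lipschitz[OF assms(1) zero_Rvec assms(2) inside_zero assms(3)] assms(2)
  by (simp add: q_zero inside_def)

lemma q_limit: "s \<in> Rvec d \<Longrightarrow> x \<in> space P \<Longrightarrow> (\<lambda>n. q n s x) \<longlonglongrightarrow> h' s x"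
  unfolding q_def by (rule deriv)

text \<open>The difference quotients along \<open>1 / sqrt n\<close> are measurable in
  \<open>x\<close> and converge pointwise; measurability of the derivative is obtained, not
  assumed.\<close>

lemma h'_measurable: "s \<in> Rvec d \<Longrightarrow> h' s \<in> borel_measurable P"
  by (rule borel_measurable_LIMSEQ_real[OF q_limit q_measurable])

lemma h'_Lipschitz:
  assumes "s \<in> Rvec d" "s' \<in> Rvec d" "x \<in> space P"
  shows "\<bar>h' s x - h' s' x\<bar> \<le> \<gamma> x * dist1 d s s'"
proof (rule tendsto_upperbound)
  show "(\<lambda>n. \<bar>q n s x - q n s' x\<bar>) \<longlonglongrightarrow> \<bar>h' s x - h' s' x\<bar>"
    by (intro tendsto_intros q_limit assms)
  show "\<forall>\<^sub>F n in sequentially. \<bar>q n s x - q n s' x\<bar> \<le> \<gamma> x * dist1 d s s'"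
    using eventually_inside[of s] eventually_inside[of s'] by eventually_elim (intro q_Lipschitz assms)
qed simp

lemma h'_bound:
  assumes "s \<in> Rvec d" "x \<in> space P"
  shows "\<bar>h' s x\<bar> \<le> \<gamma> x * dist1 d s (\<lambda>_. 0)"
proof -
  have "(\<lambda>n. 0) \<longlonglongrightarrow> h' (\<lambda>_. 0) x" using q_limit[OF zero_Rvec assms(2)] by (simp add: q_zero)
  then have "h' (\<lambda>_. 0) x = 0" using LIMSEQ_unique tendsto_const by blast
  then show ?thesis using h'_Lipschitz[OF assms(1) zero_Rvec assms(2)] by simp
qed

lemma \<gamma>_integrable: "integrable P \<gamma>"
  using prob_space.square_integrable_integrable[OF prob_space_P \<gamma>_sq] .

lemma h'_integrable:
  assumes "s \<in> Rvec d"
  shows "integrable P (h' s)"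
proof (rule Bochner_Integration.integrable_bound)
  show "integrable P (\<lambda>x. \<gamma> x * dist1 d s (\<lambda>_. 0))" using \<gamma>_integrable by simp
  show "AE x in P. norm (h' s x) \<le> norm (\<gamma> x * dist1 d s (\<lambda>_. 0))"
  proof (rule AE_I2)
    fix x assume "x \<in> space P"
    from h'_bound[OF assms this] show "norm (h' s x) \<le> norm (\<gamma> x * dist1 d s (\<lambda>_. 0))"
      using \<gamma>_nonneg[of x] dist1_nonneg[of d s "\<lambda>_. 0"] by (simp add: abs_mult)
  qed
qed (rule h'_measurable[OF assms])

lemma D_Lipschitz:
  assumes "s \<in> Rvec d" "s' \<in> Rvec d"
  shows "\<bar>D s - D s'\<bar> \<le> (\<integral>x. \<gamma> x \<partial>P) * dist1 d s s'"
proof -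
  have "\<bar>D s - D s'\<bar> = \<bar>\<integral>x. h' s x - h' s' x \<partial>P\<bar>"
    unfolding D_def using h'_integrable[OF assms(1)] h'_integrable[OF assms(2)] by simp
  also have "\<dots> \<le> (\<integral>x. \<bar>h' s x - h' s' x\<bar> \<partial>P)" by (rule integral_abs_bound)
  also have "\<dots> \<le> (\<integral>x. \<gamma> x * dist1 d s s' \<partial>P)"
    using \<gamma>_integrable h'_integrable[OF assms(1)] h'_integrable[OF assms(2)]
    by (intro integral_mono h'_Lipschitz assms) auto
  finally show ?thesis by simp
qed

lemma D_zero: "D (\<lambda>_. 0) = 0"
proof -
  have "h' (\<lambda>_. 0) x = 0" if "x \<in> space P" for x
    using h'_bound[OF zero_Rvec that] by (simp add: dist1_def)
  then have "D (\<lambda>_. 0) = (\<integral>x. 0 \<partial>P)" unfolding D_def by (intro Bochner_Integration.integral_cong) auto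
  then show ?thesis by simp
qed

lemma D_bound: "s \<in> Rvec d \<Longrightarrow> \<bar>D s\<bar> \<le> (\<integral>x. \<gamma> x \<partial>P) * dist1 d s (\<lambda>_. 0)"
  using D_Lipschitz[OF _ zero_Rvec] by (simp add: D_zero)

text \<open>\<open>D\<close> is controlled only on \<open>Rvec d\<close>. Composing it with the
  truncation \<open>c\<close> gives a function that is Lipschitz on all sequences, hence Borel, and
  truncation does not change \<zeta>.\<close>

lemma D_measurable:
  assumes \<zeta>: "\<And>w. w \<in> space L \<Longrightarrow> \<zeta> w \<in> Rvec d" and meas: "\<And>i. i < d \<Longrightarrow> (\<lambda>w. \<zeta> w i) \<in> borel_measurable L"
  shows "(\<lambda>w. D (\<zeta> w)) \<in> borel_measurable L"
proof -
  define c where "c v = (\<lambda>i. if i < d then v i else 0)" for v :: rvec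
  have c: "c v \<in> Rvec d" for v by (simp add: c_def topspace_Euclidean_space)
  have c_id: "c v = v" if "v \<in> Rvec d" for v using that by (auto simp: c_def topspace_Euclidean_space fun_eq_iff)
  have "\<bar>D (c u) - D (c v)\<bar> \<le> (\<integral>x. \<gamma> x \<partial>P) * (\<Sum>i\<in>{..<d}. \<bar>u i - v i\<bar>)" for u v
    using D_Lipschitz[OF c c, of u v] by (simp add: dist1_def c_def)
  then have "continuous_on UNIV (\<lambda>v. D (c v))" by (rule continuous_on_finite_Lipschitz)
  then have "(\<lambda>v. D (c v)) \<in> borel_measurable borel" by (rule borel_measurable_continuous_onI)
  moreover have "(\<lambda>w. c (\<zeta> w)) \<in> borel_measurable L"
  proof (rule measurable_coordinatewise_then_product)
    show "(\<lambda>w. c (\<zeta> w) i) \<in> borel_measurable L" for i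
      using meas[of i] by (cases "i < d") (simp_all add: c_def)
  qed
  \<comment> \<open>The inner truncation makes all coordinates measurable, as only those below
    \<open>d\<close> are assumed to be.\<close>
  ultimately have "(\<lambda>w. D (c (c (\<zeta> w)))) \<in> borel_measurable L" by (rule measurable_compose[rotated])
  then show ?thesis
    by (rule measurable_cong[THEN iffD1, rotated]) (simp add: c_id \<zeta> c)
qed

lemma q_square_integrable:
  assumes "s \<in> Rvec d" "inside n s"
  shows "square_integrable P (q n s)"
proof (rule square_integrable_bound)
  show "square_integrable P (\<lambda>x. dist1 d s (\<lambda>_. 0) * \<gamma> x)" using \<gamma>_sq by (rule square_integrable_cmult)
  show "\<bar>q n s x\<bar> \<le> \<bar>dist1 d s (\<lambda>_. 0) * \<gamma> x\<bar>" if "x \<in> space P" for x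
    using q_bound[OF assms that] \<gamma>_nonneg[of x] dist1_nonneg[of d s "\<lambda>_. 0"] by (simp add: abs_mult mult.commute)
qed (rule q_measurable[OF assms(1)])

lemma integral_q_limit:
  assumes s: "s \<in> Rvec d"
  shows "(\<lambda>n. \<integral>x. q n s x \<partial>P) \<longlonglongrightarrow> D s"
proof -
  \<comment> \<open>The dominating bound holds only once \<open>s\<close> is inside, so the first
    \<open>n0\<close> terms are dropped.\<close>
  obtain n0 where n0: "\<And>n. n0 \<le> n \<Longrightarrow> inside n s"
    using eventually_inside[of s] by (auto simp: eventually_sequentially)
  have "(\<lambda>n. \<integral>x. q (n + n0) s x \<partial>P) \<longlonglongrightarrow> D s" unfolding D_def
  proof (rule integral_dominated_convergence)
    show "integrable P (\<lambda>x. \<gamma> x * dist1 d s (\<lambda>_. 0))" using \<gamma>_integrable by simp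
    show "AE x in P. (\<lambda>n. q (n + n0) s x) \<longlonglongrightarrow> h' s x"
      using q_limit[OF s] by (intro AE_I2 LIMSEQ_ignore_initial_segment)
    show "AE x in P. norm (q (n + n0) s x) \<le> \<gamma> x * dist1 d s (\<lambda>_. 0)" for n
      using q_bound[OF s n0[of "n + n0"]] by (intro AE_I2) simp
  qed (use h'_measurable[OF s] q_measurable[OF s] in auto)
  then show ?thesis by (rule LIMSEQ_offset)
qed

text \<open>The averaged function \<open>q n s\<close> changes with \<open>n\<close>, so a law of
  large numbers for a fixed function does not apply. Centred at its own mean \<open>m n\<close>, the
  average has variance at most \<open>c / n\<close> with \<open>c\<close> independent of
  \<open>n\<close>, and \<open>m n\<close> tends to \<open>D s\<close>.\<close>

lemma pointwise_null:
  assumes s: "s \<in> Rvec d"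
  shows "null_in_prob (\<lambda>n w. avg n w (q n s) - D s)"
proof -
  interpret P: prob_space P by (rule prob_space_P)
  define c where "c = (\<integral>x. (\<gamma> x * dist1 d s (\<lambda>_. 0))\<^sup>2 \<partial>P)"
  define m where "m n = (\<integral>x. q n s x \<partial>P)" for n
  have am: "(\<lambda>w. avg n w (q n s)) \<in> borel_measurable M" for n
    by (rule average_measurable[OF q_measurable[OF s]])
  have 1: "null_in_prob (\<lambda>n w. avg n w (q n s) - m n)"
  proof (rule null_in_prob_Chebyshev)
    show "(\<lambda>w. avg n w (q n s) - m n) \<in> borel_measurable M" for n using am by auto
    show "(\<lambda>n. c / real n) \<longlonglongrightarrow> 0" by (rule lim_const_over_n)
    show "\<forall>\<^sub>F n in sequentially. integrable M (\<lambda>w. (avg n w (q n s) - m n)\<^sup>2) \<and>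
        expectation (\<lambda>w. (avg n w (q n s) - m n)\<^sup>2) \<le> c / real n"
      using eventually_inside[of s]
    proof eventually_elim
      case (elim n)
      then have n: "1 \<le> n" by (simp add: inside_def)
      define u where "u x = q n s x - m n" for x
      have sq: "square_integrable P (q n s)" by (rule q_square_integrable[OF s elim])
      have u: "square_integrable P u" unfolding u_def m_def by (rule P.square_integrable_centred[OF sq])
      have iq: "integrable P (q n s)" by (rule P.square_integrable_integrable[OF sq])
      have u0: "(\<integral>x. u x \<partial>P) = 0" unfolding u_def using iq by (simp add: m_def P.prob_space)
      have eq: "avg n w u = avg n w (q n s) - m n" for w
        unfolding u_def average_diff by (simp add: average_const[OF n])
      have "(\<integral>x. (u x)\<^sup>2 \<partial>P) = (\<integral>x. (q n s x)\<^sup>2 \<partial>P) - (m n)\<^sup>2"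
        unfolding u_def m_def using iq sq by (intro P.variance_eq) (auto simp: square_integrable_def)
      also have "\<dots> \<le> (\<integral>x. (q n s x)\<^sup>2 \<partial>P)" by simp
      also have "\<dots> \<le> c" unfolding c_def
      proof (rule integral_mono)
        show "integrable P (\<lambda>x. (q n s x)\<^sup>2)" using sq by (simp add: square_integrable_def)
        show "integrable P (\<lambda>x. (\<gamma> x * dist1 d s (\<lambda>_. 0))\<^sup>2)"
          using \<gamma>_sq by (simp add: square_integrable_def power_mult_distrib)
        fix x assume "x \<in> space P"
        from power_mono[OF q_bound[OF s elim this], of 2]
        show "(q n s x)\<^sup>2 \<le> (\<gamma> x * dist1 d s (\<lambda>_. 0))\<^sup>2" by simp
      qed
      finally have "(\<integral>x. (u x)\<^sup>2 \<partial>P) / real n \<le> c / real n" by (simp add: divide_right_mono)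
      then show ?case
        using average_second_moment[OF u u0, of n] unfolding eq by simp
    qed
  qed
  have "(\<lambda>n. m n - D s) \<longlonglongrightarrow> 0"
    using integral_q_limit[OF s] unfolding m_def by (rule LIM_zero)
  then have 2: "null_in_prob (\<lambda>n w. m n - D s)" by (rule null_in_prob_of_real)
  show ?thesis using null_in_prob_add[OF 1 2] by simp
qed

text \<open>
  Stochastic equicontinuity of the local empirical process: up to events of small probability \<open>\<zeta> n\<close> is
  within a small distance of a finite net, at whose points \<open>pointwise_null\<close> applies.
\<close>

theorem local_expansion:
  assumes \<zeta>: "\<And>n w. w \<in> space M \<Longrightarrow> \<zeta> n w \<in> Rvec d"
    and tight: "\<And>i. i < d \<Longrightarrow> tight_in_prob (\<lambda>n w. \<zeta> n w i)"
    and meas: "\<And>n. (\<lambda>w. avg n w (q n (\<zeta> n w)) - D (\<zeta> n w)) \<in> borel_measurable M"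
  shows "null_in_prob (\<lambda>n w. avg n w (q n (\<zeta> n w)) - D (\<zeta> n w))"
  unfolding null_in_prob_def
proof (intro conjI allI impI meas)
  let ?R = "\<lambda>n w. avg n w (q n (\<zeta> n w)) - D (\<zeta> n w)"
  fix e \<delta> :: real assume e: "0 < e" and \<delta>: "0 < \<delta>"
  define T where "T n w = (\<Sum>i<d. \<bar>\<zeta> n w i\<bar>)" for n w
  have tT: "tight_in_prob T" unfolding T_def using tight by (intro tight_in_prob_sum_abs) auto
  then have Tm: "T n \<in> borel_measurable M" for n by (rule tight_in_prob_measurable)
  have "0 < \<delta> / 3" using \<delta> by simp
  then obtain K0 where "\<forall>\<^sub>F n in sequentially. prob {w \<in> space M. K0 < \<bar>T n w\<bar>} \<le> \<delta> / 3"
    using tT unfolding tight_in_prob_def by blast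
  moreover obtain K :: nat where K: "K0 \<le> real K" using real_arch_simple by blast
  ultimately have PT: "\<forall>\<^sub>F n in sequentially. prob {w \<in> space M. real K < \<bar>T n w\<bar>} \<le> \<delta> / 3"
  proof (elim eventually_mono)
    fix n assume le: "prob {w \<in> space M. K0 < \<bar>T n w\<bar>} \<le> \<delta> / 3"
    have "prob {w \<in> space M. real K < \<bar>T n w\<bar>} \<le> prob {w \<in> space M. K0 < \<bar>T n w\<bar>}"
      using K Tm by (intro finite_measure_mono) auto
    then show "prob {w \<in> space M. real K < \<bar>T n w\<bar>} \<le> \<delta> / 3" using le by simp
  qed
  define g where "g = (\<integral>x. \<gamma> x \<partial>P)"
  have g: "0 \<le> g" unfolding g_def using \<gamma>_nonneg by (intro Bochner_Integration.integral_nonneg) auto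
  \<comment> \<open>Markov's inequality bounds the probability that the average of \<gamma> reaches
    this level by \<delta>/3; \<open>g + 1\<close> instead of \<open>g\<close> keeps it
    positive.\<close>
  define \<Gamma> where "\<Gamma> = 3 * (g + 1) / \<delta>"
  have \<Gamma>: "0 < \<Gamma>" using g \<delta> by (simp add: \<Gamma>_def)
  have \<gamma>m: "\<gamma> \<in> borel_measurable P" using \<gamma>_sq by (rule square_integrable_measurable)
  define G where "G n w = avg n w \<gamma>" for n w
  have Gm [measurable]: "G n \<in> borel_measurable M" for n unfolding G_def by (rule average_measurable[OF \<gamma>m])
  have G0: "0 \<le> G n w" for n w unfolding G_def average_def using \<gamma>_nonneg by (intro sum_nonneg) simp
  have PG: "prob {w \<in> space M. \<Gamma> \<le> G n w} \<le> \<delta> / 3" if n: "1 \<le> n" for n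
  proof -
    have "prob {w \<in> space M. \<Gamma> \<le> G n w} \<le> expectation (G n) / \<Gamma>"
      using expectation_average(1)[OF \<gamma>_integrable n] G0 \<Gamma>
      by (intro integral_Markov_inequality_measure[where A = "{}"]) (auto simp: G_def)
    also have "\<dots> = g / \<Gamma>" using expectation_average(2)[OF \<gamma>_integrable n] by (simp add: G_def[abs_def] g_def)
    also have "\<dots> \<le> \<delta> / 3" using g \<delta> by (simp add: \<Gamma>_def field_simps)
    finally show ?thesis .
  qed
  \<comment> \<open>The mesh is so fine that moving to the nearest net point changes the average and
    \<open>D\<close> together by at most \<open>e / 2\<close>; the summand 1 makes \<open>N\<close>
    positive.\<close>
  obtain N :: nat where N: "real d * (\<Gamma> + g) * 2 / e + 1 \<le> real N" using real_arch_simple by blast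
  have "0 \<le> real d * (\<Gamma> + g) * 2 / e" using g \<Gamma> e by simp
  then have N0: "0 < N" using N by (cases N) auto
  have mesh: "(\<Gamma> + g) * (real d / real N) \<le> e / 2"
  proof -
    have "real d * (\<Gamma> + g) * 2 / e \<le> real N" using N by simp
    then have "real d * (\<Gamma> + g) * 2 \<le> real N * e" using e by (simp add: divide_le_eq)
    then show ?thesis using N0 by (simp add: field_simps)
  qed
  define B where "B = {s \<in> Rvec d. dist1 d s (\<lambda>_. 0) \<le> real K}"
  have Bi: "\<bar>s i\<bar> \<le> real K" if "s \<in> B" "i < d" for s i
  proof -
    have "\<bar>s i\<bar> \<le> (\<Sum>i<d. \<bar>s i\<bar>)" using that by (intro member_le_sum) auto
    then show ?thesis using that by (simp add: B_def dist1_def)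
  qed
  obtain S where S: "finite S" "S \<subseteq> B" "\<And>s. s \<in> B \<Longrightarrow> \<exists>u\<in>S. dist1 d s u \<le> real d / real N"
    using finite_net[of B d K N] Bi N0 by metis
  \<comment> \<open>The share of each net point in the last third of \<delta>.\<close>
  define c where "c = \<delta> / (3 * (real (card S) + 1))"
  have c: "0 < c" "real (card S) * c \<le> \<delta> / 3" using \<delta> by (auto simp: c_def field_simps)
  define Y where "Y s n w = avg n w (q n s) - D s" for s n w
  have Ym: "Y s n \<in> borel_measurable M" if "s \<in> S" for s n
    using null_in_prob_measurable[OF pointwise_null] that S(2) unfolding Y_def by (auto simp: B_def)
  have "\<forall>\<^sub>F n in sequentially. \<forall>s\<in>S. prob {w \<in> space M. e / 2 < \<bar>Y s n w\<bar>} \<le> c"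
    unfolding Y_def using S(2) e c(1) by (intro eventually_ball_finite[OF S(1)] ballI null_in_probD pointwise_null) (auto simp: B_def)
  with PT eventually_inside_bounded[of "real K"] eventually_ge_at_top[of 1]
  show "\<forall>\<^sub>F n in sequentially. prob {w \<in> space M. e < \<bar>?R n w\<bar>} \<le> \<delta>"
  proof eventually_elim
    case (elim n)
    \<comment> \<open>The bad events are: a direction outside the region covered by the net, a large
      empirical Lipschitz constant, and a failure of pointwise convergence at some net point. Off
      these the remainder is at most \<open>e\<close>.\<close>
    let ?A = "{w \<in> space M. real K < \<bar>T n w\<bar>}" and ?B = "{w \<in> space M. \<Gamma> \<le> G n w}"
      and ?C = "\<Union>s\<in>S. {w \<in> space M. e / 2 < \<bar>Y s n w\<bar>}"
    have Am: "?A \<in> events" using Tm[of n] by auto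
    have Bm: "?B \<in> events" by simp
    have Cs: "{w \<in> space M. e / 2 < \<bar>Y s n w\<bar>} \<in> events" if "s \<in> S" for s using Ym[OF that] by auto
    have Cm: "?C \<in> events" using S(1) Cs by (rule sets.finite_UN)
    have "{w \<in> space M. e < \<bar>?R n w\<bar>} \<subseteq> (?A \<union> ?B) \<union> ?C"
    proof (rule subsetI, rule ccontr)
      fix w assume w: "w \<in> {w \<in> space M. e < \<bar>?R n w\<bar>}"
        and "w \<notin> (?A \<union> ?B) \<union> ?C"
      then have sp: "w \<in> space M" and T: "T n w \<le> real K" and G: "G n w \<le> \<Gamma>"
        and Y: "\<And>s. s \<in> S \<Longrightarrow> \<bar>Y s n w\<bar> \<le> e / 2"
        by (auto simp: not_less not_le)
      have zB: "\<zeta> n w \<in> B" using \<zeta>[OF sp] T by (simp add: B_def dist1_def T_def)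
      then obtain s where s: "s \<in> S" "dist1 d (\<zeta> n w) s \<le> real d / real N" using S(3) by blast
      then have sB: "s \<in> B" using S(2) by auto
      have R: "\<zeta> n w \<in> Rvec d" "s \<in> Rvec d" "inside n (\<zeta> n w)" "inside n s"
        using zB sB elim by (auto simp: B_def)
      have "\<bar>avg n w (q n (\<zeta> n w)) - avg n w (q n s)\<bar>
          \<le> avg n w (\<lambda>x. \<bar>q n (\<zeta> n w) x - q n s x\<bar>)"
        unfolding average_diff[symmetric] by (rule average_abs)
      also have "\<dots> \<le> avg n w (\<lambda>x. dist1 d (\<zeta> n w) s * \<gamma> x)"
      proof (rule average_mono)
        fix l :: nat assume "1 \<le> l"
        from q_Lipschitz[OF R X_space[OF this sp]]
        show "\<bar>q n (\<zeta> n w) (X l w) - q n s (X l w)\<bar> \<le> dist1 d (\<zeta> n w) s * \<gamma> (X l w)"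
          by (simp add: mult.commute)
      qed
      also have "\<dots> = dist1 d (\<zeta> n w) s * G n w" by (simp add: average_cmult G_def)
      also have "\<dots> \<le> (real d / real N) * \<Gamma>"
        using s(2) G G0 dist1_nonneg by (intro mult_mono) auto
      finally have a1: "\<bar>avg n w (q n (\<zeta> n w)) - avg n w (q n s)\<bar> \<le> (real d / real N) * \<Gamma>" .
      have "\<bar>D (\<zeta> n w) - D s\<bar> \<le> g * dist1 d (\<zeta> n w) s" unfolding g_def by (rule D_Lipschitz[OF R(1,2)])
      also have "\<dots> \<le> g * (real d / real N)" using s(2) g by (rule mult_left_mono)
      finally have a2: "\<bar>D (\<zeta> n w) - D s\<bar> \<le> g * (real d / real N)" .
      have a3: "\<bar>avg n w (q n s) - D s\<bar> \<le> e / 2" using Y[OF s(1)] by (simp add: Y_def)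
      have "(real d / real N) * \<Gamma> + g * (real d / real N) \<le> e / 2"
        using mesh by (simp only: distrib_right mult.commute[of \<Gamma>])
      with a1 a2 a3 have "\<bar>?R n w\<bar> \<le> e" by linarith
      then show False using w by simp
    qed
    then have "prob {w \<in> space M. e < \<bar>?R n w\<bar>} \<le> prob ((?A \<union> ?B) \<union> ?C)"
      by (rule finite_measure_mono) (intro sets.Un Am Bm Cm)
    also have "\<dots> \<le> prob (?A \<union> ?B) + prob ?C" by (intro measure_Un_le sets.Un Am Bm Cm)
    also have "prob (?A \<union> ?B) \<le> prob ?A + prob ?B" using Am Bm by (rule measure_Un_le)
    also have "prob ?C \<le> (\<Sum>s\<in>S. prob {w \<in> space M. e / 2 < \<bar>Y s n w\<bar>})"
      using S(1) Cs by (intro finite_measure_subadditive_finite) auto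
    also have "\<dots> \<le> real (card S) * c" using elim by (intro sum_bounded_above) auto
    finally show ?case using elim PG[of n] c(2) by linarith
  qed
qed

end

section \<open>Composite functionals and the limit process\<close>

lemma Rvec_iff: "v \<in> Rvec d \<longleftrightarrow> (\<forall>i\<ge>d. v i = 0)"
  by (simp add: topspace_Euclidean_space)

lemma vnorm_le_dist1: "vnorm d (vdiff u v) \<le> dist1 d u v"
  unfolding vnorm_def vdiff_def dist1_def by (rule L2_set_le_sum_abs)

lemma abs_le_vnorm:
  assumes "i < d"
  shows "\<bar>v i\<bar> \<le> vnorm d v"
proof -
  have "(v i)\<^sup>2 \<le> (\<Sum>i<d. (v i)\<^sup>2)" using assms by (intro member_le_sum) auto
  then show ?thesis unfolding vnorm_def L2_set_def by (intro real_le_rsqrt) simp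
qed

lemma tendsto_fun_iff:
  fixes f :: "'c \<Rightarrow> 'i \<Rightarrow> 'b::topological_space"
  shows "(f \<longlongrightarrow> l) F \<longleftrightarrow> (\<forall>i. ((\<lambda>x. f x i) \<longlongrightarrow> l i) F)"
  using limitin_componentwise[of "\<lambda>_. euclidean" UNIV f l F] by (simp add: euclidean_product_topology)

lemma vnorm_nonneg: "0 \<le> vnorm d v"
  unfolding vnorm_def by (rule L2_set_nonneg)

lemma compactin_Euclidean_space_bounded:
  assumes "compactin (Euclidean_space d) S"
  shows "\<exists>R. \<forall>v\<in>S. \<forall>i<n. \<bar>v i\<bar> \<le> R"
proof -
  have S: "compact S"
    using assms by (simp add: Euclidean_space_def compactin_subtopology euclidean_product_topology)
  have "\<exists>R. \<forall>v\<in>S. \<bar>v i\<bar> \<le> R" for i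
  proof -
    have "compact ((\<lambda>v. v i) ` S)"
      by (rule compact_continuous_image[OF continuous_on_subset[OF continuous_on_product_coordinates] S]) simp
    then have "bounded ((\<lambda>v. v i) ` S)" by (rule compact_imp_bounded)
    then show ?thesis by (auto simp: bounded_real)
  qed
  then obtain R where R: "\<And>i v. v \<in> S \<Longrightarrow> \<bar>v i\<bar> \<le> R i" by metis
  have "\<bar>v i\<bar> \<le> (\<Sum>i<n. \<bar>R i\<bar>)" if "v \<in> S" "i < n" for v i
  proof -
    have "\<bar>v i\<bar> \<le> \<bar>R i\<bar>" using R[OF that(1), of i] by simp
    also have "\<dots> \<le> (\<Sum>i<n. \<bar>R i\<bar>)" using that by (intro member_le_sum) auto
    finally show ?thesis .
  qed
  then show ?thesis by blast
qed

text \<open>If no ball fitted, there would be points outside \<open>S\<close> at distance at most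
  \<open>1 / (n + 1)\<close>. They converge to \<mu> in every coordinate, the coordinates from
  \<open>d\<close> on being 0, and so enter any open set around \<mu>.\<close>

lemma interior_of_Euclidean_space_ball:
  assumes "\<mu> \<in> Euclidean_space d interior_of S"
  obtains r where "0 < r" "\<And>v. v \<in> Rvec d \<Longrightarrow> dist1 d v \<mu> \<le> r \<Longrightarrow> v \<in> S"
proof -
  from assms obtain T where T: "openin (Euclidean_space d) T" "\<mu> \<in> T" "T \<subseteq> S"
    by (auto simp: interior_of_def)
  then obtain U where U: "open U" "T = U \<inter> Rvec d"
    by (auto simp: Euclidean_space_def openin_subtopology euclidean_product_topology)
  have "\<exists>r>0. \<forall>v\<in>Rvec d. dist1 d v \<mu> \<le> r \<longrightarrow> v \<in> S"
  proof (rule ccontr)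
    assume neg: "\<not> (\<exists>r>0. \<forall>v\<in>Rvec d. dist1 d v \<mu> \<le> r \<longrightarrow> v \<in> S)"
    have "\<exists>v\<in>Rvec d. dist1 d v \<mu> \<le> 1 / real (Suc n) \<and> v \<notin> S" for n
    proof -
      have "0 < 1 / real (Suc n)" by simp
      then show ?thesis using neg by blast
    qed
    then obtain v where v: "\<And>n. v n \<in> Rvec d" "\<And>n. dist1 d (v n) \<mu> \<le> 1 / real (Suc n)" "\<And>n. v n \<notin> S"
      by metis
    have "(\<lambda>n. v n i) \<longlonglongrightarrow> \<mu> i" for i
    proof (cases "i < d")
      case True
      have "\<bar>v n i - \<mu> i\<bar> \<le> 1 / real (Suc n)" for n
      proof -
        have "\<bar>v n i - \<mu> i\<bar> \<le> dist1 d (v n) \<mu>"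
          unfolding dist1_def using True by (intro member_le_sum[where f = "\<lambda>i. \<bar>v n i - \<mu> i\<bar>"]) auto
        then show ?thesis using v(2)[of n] by linarith
      qed
      then have "(\<lambda>n. v n i - \<mu> i) \<longlonglongrightarrow> 0"
        by (intro Lim_null_comparison[OF _ LIMSEQ_Suc[OF lim_const_over_n[of 1]]]) simp
      then show ?thesis by (rule LIM_zero_cancel)
    next
      case False
      moreover have "\<mu> \<in> Rvec d" using T(2) U(2) by auto
      ultimately show ?thesis using v(1) by (simp add: Rvec_iff)
    qed
    then have "v \<longlonglongrightarrow> \<mu>"
      by (subst tendsto_fun_iff) simp
    then have "\<forall>\<^sub>F n in sequentially. v n \<in> U"
      using U T(2) by (intro topological_tendstoD) auto
    then obtain n where "v n \<in> U" by (auto simp: eventually_sequentially)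
    then show False using v(1,3)[of n] U T(3) by auto
  qed
  then show ?thesis using that by blast
qed

text \<open>Keeping the direction fixed and letting the step run through \<open>1 / sqrt n\<close>
  turns the limit into that of a sequence. Uniqueness of sequential limits also shows that the
  description \<open>THE\<close> denotes the derivative.\<close>

lemma hadamard_deriv_sequentially:
  assumes "hadamard_differentiable_at d d' h v" "\<zeta> \<in> Rvec d"
  shows "hadamard_deriv d d' h v \<zeta> \<in> Rvec d'"
    and "(\<lambda>n. sqrt (real n) * (h (\<lambda>l. v l + 1 / sqrt (real n) * \<zeta> l) i - h v i)) \<longlonglongrightarrow> hadamard_deriv d d' h v \<zeta> i"
proof -
  have lim: "L \<in> Rvec d'" "(\<lambda>n. sqrt (real n) * (h (\<lambda>l. v l + 1 / sqrt (real n) * \<zeta> l) i - h v i)) \<longlonglongrightarrow> L i"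
    if L: "has_hadamard_deriv d d' h v \<zeta> L" for L i
  proof -
    have l: "limitin (Euclidean_space d')
       (\<lambda>(t, s). (\<lambda>i. (1 / t) * (h (\<lambda>l. v l + t * s l) i - h v i))) L
       (at_right 0 \<times>\<^sub>F nhdsin (Euclidean_space d) \<zeta>)" using L by (simp add: has_hadamard_deriv_def)
    then show "L \<in> Rvec d'" by (rule limitin_topspace)
    \<comment> \<open>Shifted to \<open>Suc n\<close>, since the filter \<open>at_right 0\<close>
      needs positive steps.\<close>
    have c: "filterlim (\<lambda>n. (1 / sqrt (real (Suc n)), \<zeta>)) (at_right 0 \<times>\<^sub>F nhdsin (Euclidean_space d) \<zeta>) sequentially"
    proof (rule filterlim_Pair)
      show "LIM n sequentially. 1 / sqrt (real (Suc n)) :> at_right 0"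
        by real_asymp
      show "LIM n sequentially. \<zeta> :> nhdsin (Euclidean_space d) \<zeta>"
        using assms(2) by (simp add: filterlim_iff eventually_nhdsin) blast
    qed
    have "((\<lambda>(t, s). (\<lambda>i. (1 / t) * (h (\<lambda>l. v l + t * s l) i - h v i))) \<longlongrightarrow> L)
       (at_right 0 \<times>\<^sub>F nhdsin (Euclidean_space d) \<zeta>)"
      using l by (simp add: Euclidean_space_def limitin_subtopology euclidean_product_topology)
    from filterlim_compose[OF this c]
    have "(\<lambda>n. (\<lambda>i. (1 / (1 / sqrt (real (Suc n)))) * (h (\<lambda>l. v l + 1 / sqrt (real (Suc n)) * \<zeta> l) i - h v i))) \<longlonglongrightarrow> L"
      by (simp only: prod.case)
    then have "(\<lambda>n. (1 / (1 / sqrt (real (Suc n)))) * (h (\<lambda>l. v l + 1 / sqrt (real (Suc n)) * \<zeta> l) i - h v i)) \<longlonglongrightarrow> L i"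
      by (subst (asm) tendsto_fun_iff) blast
    then have "(\<lambda>n. sqrt (real (Suc n)) * (h (\<lambda>l. v l + 1 / sqrt (real (Suc n)) * \<zeta> l) i - h v i)) \<longlonglongrightarrow> L i"
      by simp
    then show "(\<lambda>n. sqrt (real n) * (h (\<lambda>l. v l + 1 / sqrt (real n) * \<zeta> l) i - h v i)) \<longlonglongrightarrow> L i"
      by (rule LIMSEQ_imp_Suc)
  qed
  obtain L where L: "has_hadamard_deriv d d' h v \<zeta> L"
    using assms by (auto simp: hadamard_differentiable_at_def)
  have "hadamard_deriv d d' h v \<zeta> = L"
    unfolding hadamard_deriv_def
  proof (rule the_equality[where P = "has_hadamard_deriv d d' h v \<zeta>"])
    show "L' = L" if "has_hadamard_deriv d d' h v \<zeta> L'" for L'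
      using LIMSEQ_unique[OF lim(2)[OF that] lim(2)[OF L]] by auto
  qed (rule L)
  then have "has_hadamard_deriv d d' h v \<zeta> (hadamard_deriv d d' h v \<zeta>)" using L by simp
  then show "hadamard_deriv d d' h v \<zeta> \<in> Rvec d'"
    and "(\<lambda>n. sqrt (real n) * (h (\<lambda>l. v l + 1 / sqrt (real n) * \<zeta> l) i - h v i)) \<longlonglongrightarrow> hadamard_deriv d d' h v \<zeta> i"
    by (rule lim)+
qed

section \<open>Coordinates of all levels and their L2 bounds\<close>

locale composite_functional =
  fixes P :: "'x measure" and k :: nat and m :: "nat \<Rightarrow> nat"
    and f :: "nat \<Rightarrow> rvec \<Rightarrow> 'x \<Rightarrow> rvec" and g :: "'x \<Rightarrow> rvec"
    and I :: "nat \<Rightarrow> rvec set" and \<gamma> :: "nat \<Rightarrow> 'x \<Rightarrow> real"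
  assumes prob_P: "prob_space P"
    and f_range: "\<And>j \<eta> x. j \<in> {1..k} \<Longrightarrow> \<eta> \<in> Rvec (m j) \<Longrightarrow> x \<in> space P \<Longrightarrow> f j \<eta> x \<in> Rvec (m (j - 1))"
    and g_range: "\<And>x. x \<in> space P \<Longrightarrow> g x \<in> Rvec (m k)"
    and f_meas: "\<And>j. j \<in> {1..k} \<Longrightarrow>
      (\<lambda>(\<eta>, x). f j \<eta> x) \<in> restrict_space borel (Rvec (m j)) \<Otimes>\<^sub>M P \<rightarrow>\<^sub>M borel"
    and g_meas: "g \<in> P \<rightarrow>\<^sub>M borel"
    and I_compact: "\<And>j. j \<in> {1..k} \<Longrightarrow> compactin (Euclidean_space (m j)) (I j)"
    and I_mu: "\<And>j. j \<in> {1..k} \<Longrightarrow> mu P k f g (Suc j) \<in> Euclidean_space (m j) interior_of I j"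
    and f_square: "\<And>j \<eta>. j \<in> {1..k} \<Longrightarrow> \<eta> \<in> I j \<Longrightarrow>
      integrable P (\<lambda>x. (vnorm (m (j - 1)) (f j \<eta> x))\<^sup>2)"
    and g_square: "integrable P (\<lambda>x. (vnorm (m k) (g x))\<^sup>2)"
    and f_Lipschitz: "\<And>j x \<eta> \<theta>. j \<in> {1..k} \<Longrightarrow> x \<in> space P \<Longrightarrow> \<eta> \<in> I j \<Longrightarrow> \<theta> \<in> I j \<Longrightarrow>
      vnorm (m (j - 1)) (vdiff (f j \<eta> x) (f j \<theta> x)) \<le> \<gamma> j x * vnorm (m j) (vdiff \<eta> \<theta>)"
    and \<gamma>_square: "\<And>j. j \<in> {1..k} \<Longrightarrow> integrable P (\<lambda>x. (\<gamma> j x)\<^sup>2)"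
    and f_Hadamard: "\<And>j x \<eta>. j \<in> {1..k} \<Longrightarrow> x \<in> space P \<Longrightarrow> \<eta> \<in> I j \<Longrightarrow>
      hadamard_differentiable_at (m j) (m (j - 1)) (\<lambda>\<eta>. f j \<eta> x) \<eta>"
begin

sublocale P: prob_space P by (rule prob_P)

text \<open>
  The coordinates of all levels are indexed uniformly by pairs \<open>(j, a)\<close>: \<open>g\<close> becomes level \<open>k + 1\<close>, a function
  of a parameter from the one-point set \<open>{0} = \<real>\<^sup>0\<close>.
\<close>

definition idx :: "(nat \<times> nat) set" where
  "idx = (SIGMA j:{1..Suc k}. {..<m (j - 1)})"

definition pdim :: "nat \<times> nat \<Rightarrow> nat" where
  "pdim \<alpha> = (if fst \<alpha> \<le> k then m (fst \<alpha>) else 0)"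

definition pset :: "nat \<times> nat \<Rightarrow> rvec set" where
  "pset \<alpha> = (if fst \<alpha> \<le> k then I (fst \<alpha>) else {\<lambda>_. 0})"

definition base :: "nat \<times> nat \<Rightarrow> rvec" where
  "base \<alpha> = (if fst \<alpha> \<le> k then mu P k f g (Suc (fst \<alpha>)) else (\<lambda>_. 0))"

definition fn :: "nat \<times> nat \<Rightarrow> rvec \<Rightarrow> 'x \<Rightarrow> real" where
  "fn \<alpha> \<eta> x = (if fst \<alpha> \<le> k then f (fst \<alpha>) \<eta> x (snd \<alpha>) else g x (snd \<alpha>))"

definition H :: "nat \<times> nat \<Rightarrow> rvec \<Rightarrow> 'x \<Rightarrow> real" where
  "H \<alpha> \<eta> x = fn \<alpha> \<eta> x - (\<integral>y. fn \<alpha> \<eta> y \<partial>P)"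

text \<open>The absolute value is taken because \<gamma> carries no sign assumption. The last level
  does not depend on its parameter, so its constant is 0.\<close>

definition lip :: "nat \<times> nat \<Rightarrow> 'x \<Rightarrow> real" where
  "lip \<alpha> x = (if fst \<alpha> \<le> k then \<bar>\<gamma> (fst \<alpha>) x\<bar> else 0)"

lemma finite_idx: "finite idx"
  by (simp add: idx_def)

lemma idx_cases:
  assumes "\<alpha> \<in> idx"
  obtains (inner) j a where "\<alpha> = (j, a)" "j \<in> {1..k}" "a < m (j - 1)"
    | (last) b where "\<alpha> = (Suc k, b)" "b < m k"
proof -
  obtain j a where \<alpha>: "\<alpha> = (j, a)" by (cases \<alpha>)
  show ?thesis
  proof (cases "j \<le> k")
    case True
    then show ?thesis using inner[of j a] assms \<alpha> by (auto simp: idx_def)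
  next
    case False
    then have "j = Suc k" using assms \<alpha> by (auto simp: idx_def)
    then show ?thesis using last[of a] assms \<alpha> by (auto simp: idx_def)
  qed
qed

lemma I_Rvec: "j \<in> {1..k} \<Longrightarrow> I j \<subseteq> Rvec (m j)"
  using compactin_subset_topspace[OF I_compact] .

lemma mu_I: "j \<in> {1..k} \<Longrightarrow> mu P k f g (Suc j) \<in> I j"
  using I_mu[of j] interior_of_subset[of "Euclidean_space (m j)" "I j"] by (auto dest: subsetD)

lemma mu_Rvec: "j \<in> {1..k} \<Longrightarrow> mu P k f g (Suc j) \<in> Rvec (m j)"
  using mu_I I_Rvec by blast

lemma f_measurable:
  assumes "j \<in> {1..k}" "\<eta> \<in> Rvec (m j)"
  shows "(\<lambda>x. f j \<eta> x i) \<in> borel_measurable P"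
proof -
  have "Pair \<eta> \<in> P \<rightarrow>\<^sub>M restrict_space borel (Rvec (m j)) \<Otimes>\<^sub>M P"
    by (rule measurable_Pair1') (use assms in \<open>simp add: space_restrict_space\<close>)
  from measurable_compose[OF this f_meas[OF assms(1)]]
  have "(\<lambda>x. f j \<eta> x) \<in> borel_measurable P" by (simp only: prod.case)
  then show ?thesis by (rule measurable_compose) (rule measurable_product_coordinates)
qed

lemma g_measurable: "(\<lambda>x. g x i) \<in> borel_measurable P"
  using g_meas by (rule measurable_compose) (rule measurable_product_coordinates)

lemma fn_square_integrable:
  assumes "\<alpha> \<in> idx" "\<eta> \<in> pset \<alpha>"
  shows "square_integrable P (fn \<alpha> \<eta>)"
  using assms(1)
proof (cases rule: idx_cases)
  case (inner j a)
  then have \<eta>: "\<eta> \<in> I j" using assms(2) by (simp add: pset_def)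
  have eq: "fn \<alpha> \<eta> = (\<lambda>x. f j \<eta> x a)" using inner by (auto simp: fn_def)
  have fm: "(\<lambda>x. f j \<eta> x a) \<in> borel_measurable P" using inner \<eta> I_Rvec by (intro f_measurable) auto
  show ?thesis unfolding eq square_integrable_def
  proof (intro conjI fm, rule Bochner_Integration.integrable_bound[OF f_square[OF inner(2) \<eta>]])
    show "AE x in P. norm ((f j \<eta> x a)\<^sup>2) \<le> norm ((vnorm (m (j - 1)) (f j \<eta> x))\<^sup>2)"
      using abs_le_vnorm[OF inner(3)] vnorm_nonneg by (intro AE_I2) (simp add: abs_le_square_iff[symmetric])
  qed (use fm in auto)
next
  case (last b)
  have eq: "fn \<alpha> \<eta> = (\<lambda>x. g x b)" using last by (auto simp: fn_def)
  show ?thesis unfolding eq square_integrable_def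
  proof (intro conjI g_measurable, rule Bochner_Integration.integrable_bound[OF g_square])
    show "AE x in P. norm ((g x b)\<^sup>2) \<le> norm ((vnorm (m k) (g x))\<^sup>2)"
      using abs_le_vnorm[OF last(2)] vnorm_nonneg by (intro AE_I2) (simp add: abs_le_square_iff[symmetric])
  qed (use g_measurable[of b] in auto)
qed

lemma H_square_integrable:
  "\<alpha> \<in> idx \<Longrightarrow> \<eta> \<in> pset \<alpha> \<Longrightarrow> square_integrable P (H \<alpha> \<eta>)"
  unfolding H_def[abs_def] by (rule P.square_integrable_centred[OF fn_square_integrable])

lemma H_mean:
  assumes "\<alpha> \<in> idx" "\<eta> \<in> pset \<alpha>"
  shows "(\<integral>x. H \<alpha> \<eta> x \<partial>P) = 0"
  using P.square_integrable_integrable[OF fn_square_integrable[OF assms]] by (simp add: H_def P.prob_space)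

text \<open>Integrability of the square makes only the square measurable; its root is |\<gamma>|,
  which is why |\<gamma>| takes the place of \<gamma> from here on.\<close>

lemma \<gamma>_square_integrable: "j \<in> {1..k} \<Longrightarrow> square_integrable P (\<lambda>x. \<bar>\<gamma> j x\<bar>)"
proof -
  assume j: "j \<in> {1..k}"
  have "(\<lambda>x. sqrt ((\<gamma> j x)\<^sup>2)) \<in> borel_measurable P"
    by (rule measurable_compose[OF borel_measurable_integrable[OF \<gamma>_square[OF j]]]) simp
  then have "(\<lambda>x. \<bar>\<gamma> j x\<bar>) \<in> borel_measurable P" by simp
  then show ?thesis using \<gamma>_square[OF j] by (simp add: square_integrable_def)
qed

lemma lip_square_integrable: "\<alpha> \<in> idx \<Longrightarrow> square_integrable P (lip \<alpha>)"
  unfolding lip_def[abs_def] by (erule idx_cases) (auto simp: \<gamma>_square_integrable P.square_integrable_const)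

lemma f_coordinate_Lipschitz:
  assumes "j \<in> {1..k}" "a < m (j - 1)" "x \<in> space P" "\<eta> \<in> I j" "\<theta> \<in> I j"
  shows "\<bar>f j \<eta> x a - f j \<theta> x a\<bar> \<le> \<bar>\<gamma> j x\<bar> * dist1 (m j) \<eta> \<theta>"
proof -
  have "\<bar>f j \<eta> x a - f j \<theta> x a\<bar> \<le> vnorm (m (j - 1)) (vdiff (f j \<eta> x) (f j \<theta> x))"
    using abs_le_vnorm[OF assms(2), of "vdiff (f j \<eta> x) (f j \<theta> x)"] by (simp add: vdiff_def)
  also have "\<dots> \<le> \<gamma> j x * vnorm (m j) (vdiff \<eta> \<theta>)" by (rule f_Lipschitz) fact+
  also have "\<dots> \<le> \<bar>\<gamma> j x\<bar> * dist1 (m j) \<eta> \<theta>"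
    using vnorm_le_dist1 vnorm_nonneg by (intro mult_mono) auto
  finally show ?thesis .
qed

lemma fn_Lipschitz:
  assumes "\<alpha> \<in> idx" "\<eta> \<in> pset \<alpha>" "\<theta> \<in> pset \<alpha>" "x \<in> space P"
  shows "\<bar>fn \<alpha> \<eta> x - fn \<alpha> \<theta> x\<bar> \<le> lip \<alpha> x * dist1 (pdim \<alpha>) \<eta> \<theta>"
  using assms(1)
proof (cases rule: idx_cases)
  case (inner j a)
  then show ?thesis using assms f_coordinate_Lipschitz[of j a x \<eta> \<theta>] by (simp add: fn_def lip_def pset_def pdim_def)
next
  case (last b)
  then show ?thesis by (simp add: fn_def lip_def)
qed

lemma H_Lipschitz:
  assumes "\<alpha> \<in> idx" "\<eta> \<in> pset \<alpha>" "\<theta> \<in> pset \<alpha>" "x \<in> space P"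
  shows "\<bar>H \<alpha> \<eta> x - H \<alpha> \<theta> x\<bar> \<le> (lip \<alpha> x + (\<integral>y. lip \<alpha> y \<partial>P)) * dist1 (pdim \<alpha>) \<eta> \<theta>"
proof -
  note int = P.square_integrable_integrable[OF fn_square_integrable[OF assms(1,2)]]
    P.square_integrable_integrable[OF fn_square_integrable[OF assms(1,3)]]
    P.square_integrable_integrable[OF lip_square_integrable[OF assms(1)]]
  have "\<bar>(\<integral>y. fn \<alpha> \<eta> y \<partial>P) - (\<integral>y. fn \<alpha> \<theta> y \<partial>P)\<bar> = \<bar>\<integral>y. fn \<alpha> \<eta> y - fn \<alpha> \<theta> y \<partial>P\<bar>"
    using int by simp
  also have "\<dots> \<le> (\<integral>y. \<bar>fn \<alpha> \<eta> y - fn \<alpha> \<theta> y\<bar> \<partial>P)" by (rule integral_abs_bound)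
  also have "\<dots> \<le> (\<integral>y. lip \<alpha> y * dist1 (pdim \<alpha>) \<eta> \<theta> \<partial>P)"
    using int by (intro integral_mono fn_Lipschitz assms) auto
  also have "\<dots> = (\<integral>y. lip \<alpha> y \<partial>P) * dist1 (pdim \<alpha>) \<eta> \<theta>" by simp
  finally show ?thesis
    using fn_Lipschitz[OF assms] by (simp add: H_def distrib_right)
qed

lemma pset_bounded:
  assumes "\<alpha> \<in> idx"
  shows "\<exists>R. \<forall>v\<in>pset \<alpha>. \<forall>i<pdim \<alpha>. \<bar>v i\<bar> \<le> R"
  using assms
proof (cases rule: idx_cases)
  case (inner j a)
  then show ?thesis using compactin_Euclidean_space_bounded[OF I_compact[OF inner(2)], of "m j"]
    by (simp add: pset_def pdim_def)
qed (auto simp: pset_def pdim_def)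

lemma base_pset: "\<alpha> \<in> idx \<Longrightarrow> base \<alpha> \<in> pset \<alpha>"
  by (erule idx_cases) (auto simp: base_def pset_def mu_I)

section \<open>Existence of the Brownian process\<close>

text \<open>Translates the scalar coordinates of a path into pairs of a field index and a parameter;
  the vector of level \<open>k + 1\<close> sits at parameter 0.\<close>

definition point_of :: "index \<Rightarrow> (nat \<times> nat) \<times> rvec" where
  "point_of t = (case t of Inl (j, \<eta>, a) \<Rightarrow> ((j, a), \<eta>) | Inr b \<Rightarrow> ((Suc k, b), \<lambda>_. 0))"

lemma point_of_index_set: "t \<in> index_set k m I \<Longrightarrow> point_of t \<in> Sigma idx pset"
  by (auto simp: index_set_def point_of_def idx_def pset_def)

lemma inj_on_point_of: "inj_on point_of (index_set k m I)"
  by (rule inj_onI) (auto simp: index_set_def point_of_def)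

definition path_of_fields :: "(nat \<times> nat \<Rightarrow> rvec \<Rightarrow> real) \<Rightarrow> path" where
  "path_of_fields V =
     ((\<lambda>j\<in>{1..k}. \<lambda>\<eta>\<in>I j. \<lambda>a. if a < m (j - 1) then V (j, a) \<eta> else 0),
      (\<lambda>b. if b < m k then V (Suc k, b) (\<lambda>_. 0) else 0))"

lemma coord_path_of_fields:
  assumes "t \<in> index_set k m I"
  shows "coord (path_of_fields V) t = V (fst (point_of t)) (snd (point_of t))"
  using assms by (auto simp: index_set_def coord_def path_of_fields_def point_of_def)

lemma path_of_fields_in_path_space:
  assumes "\<And>\<alpha>. \<alpha> \<in> idx \<Longrightarrow> continuous_on (pset \<alpha>) (V \<alpha>)"
  shows "path_of_fields V \<in> path_space k m I"
proof -
  have "(\<lambda>\<eta>\<in>I j. \<lambda>a. if a < m (j - 1) then V (j, a) \<eta> else 0) \<in> cont_funs (m j) (m (j - 1)) (I j)"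
    if j: "j \<in> {1..k}" for j
  proof -
    have top: "topspace (subtopology (Euclidean_space (m j)) (I j)) = I j"
      using I_Rvec[OF j] by auto
    have "continuous_on (I j) (\<lambda>\<eta> a. if a < m (j - 1) then V (j, a) \<eta> else 0)"
    proof (rule continuous_on_coordinatewise_then_product)
      fix a
      show "continuous_on (I j) (\<lambda>\<eta>. if a < m (j - 1) then V (j, a) \<eta> else 0)"
      proof (cases "a < m (j - 1)")
        case True
        then show ?thesis using assms[of "(j, a)"] j by (auto simp: idx_def pset_def)
      qed simp
    qed
    then have "continuous_on (I j) (\<lambda>\<eta>\<in>I j. \<lambda>a. if a < m (j - 1) then V (j, a) \<eta> else 0)"
      by (rule continuous_on_eq) simp
    then show ?thesis
      unfolding cont_funs_def mem_Collect_eq cm_Euclidean_space_iff_continuous_on top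
      by (auto simp: Rvec_iff)
  qed
  then show ?thesis by (auto simp: path_space_def path_of_fields_def Rvec_iff)
qed

lemma H_inner: "1 \<le> j \<Longrightarrow> j \<le> k \<Longrightarrow> H (j, a) \<eta> x = f j \<eta> x a - fbar P f j \<eta> a"
  by (simp add: H_def fn_def fbar_def vint_def)

lemma H_last: "H (Suc k, b) \<eta> x = g x b - mu P k f g (Suc k) b"
  by (simp add: H_def fn_def mu_last vint_def)

text \<open>The fields of all levels come from one construction, so joint Gaussianity across levels
  and the cross-covariances come from their common noise.\<close>

theorem brownian_process_exists:
  "\<exists>(N :: path measure) W. brownian_process N P k m I f g W"
proof -
  let ?T = "index_set k m I"
  obtain V :: "(nat \<Rightarrow> real) \<Rightarrow> nat \<times> nat \<Rightarrow> rvec \<Rightarrow> real" where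
    cont: "\<And>z \<alpha>. \<alpha> \<in> idx \<Longrightarrow> continuous_on (pset \<alpha>) (V z \<alpha>)"
    and gauss: "\<And>T a. finite T \<Longrightarrow> T \<subseteq> Sigma idx pset \<Longrightarrow>
      centred_gaussian white_noise (\<lambda>z. \<Sum>t\<in>T. a t * V z (fst t) (snd t)) (\<integral>x. (\<Sum>t\<in>T. a t * H (fst t) (snd t) x)\<^sup>2 \<partial>P)"
  proof (rule gaussian_continuous_process[where A = idx and H = H and J = pset and P = P and d = pdim
        and \<Gamma> = "\<lambda>\<alpha> x. lip \<alpha> x + (\<integral>y. lip \<alpha> y \<partial>P)"])
    show "square_integrable P (\<lambda>x. lip \<alpha> x + (\<integral>y. lip \<alpha> y \<partial>P))" if "\<alpha> \<in> idx" for \<alpha>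
      by (rule square_integrable_add[OF lip_square_integrable[OF that] P.square_integrable_const])
  qed (use finite_idx H_square_integrable H_Lipschitz pset_bounded that in blast)+
  interpret W0: prob_space white_noise by (rule prob_space_white_noise)
  have spW: "space white_noise = UNIV" by (simp add: white_noise_def space_PiM PiE_def)
  \<comment> \<open>The measure must live on the type \<open>path\<close>. White noise is merely
    stored in the second component of a pair, with the sigma-algebra generated by
    \<open>snd\<close>; sample points of \<open>N\<close> are not the paths of
    \<open>W\<close>.\<close>
  define e :: "(nat \<Rightarrow> real) \<Rightarrow> path" where "e z = (undefined, z)" for z
  define N where "N = distr white_noise (vimage_algebra UNIV snd white_noise) e"
  have em: "e \<in> white_noise \<rightarrow>\<^sub>M vimage_algebra UNIV snd white_noise"
    by (rule measurable_vimage_algebra2) (auto simp: e_def)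
  have N: "prob_space N" unfolding N_def using em by (rule W0.prob_space_distr)
  then interpret N: prob_space N .
  define W where "W w = path_of_fields (V (snd w))" for w :: path
  have transfer: "centred_gaussian N (\<lambda>w. Y (snd w)) v" if Y: "centred_gaussian white_noise Y v" for Y v
  proof -
    note Yd = centred_gaussianD[OF Y]
    have "snd \<in> vimage_algebra UNIV snd white_noise \<rightarrow>\<^sub>M white_noise"
      by (rule measurable_vimage_algebra1) (simp add: spW)
    from measurable_compose[OF this Yd(1)]
    have Ym: "(\<lambda>w. Y (snd w)) \<in> borel_measurable (vimage_algebra UNIV snd white_noise)" .
    have "distr N borel (\<lambda>w. Y (snd w)) = distr white_noise borel ((\<lambda>w. Y (snd w)) \<circ> e)"
      unfolding N_def using Ym em by (rule distr_distr)
    also have "(\<lambda>w. Y (snd w)) \<circ> e = Y" by (auto simp: e_def)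
    finally show ?thesis using Yd Ym by (simp add: centred_gaussian_def N_def)
  qed
  define h where "h t x = H (fst (point_of t)) (snd (point_of t)) x" for t x
  have hsq: "square_integrable P (h t)" if "t \<in> ?T" for t
    using point_of_index_set[OF that] unfolding h_def[abs_def] by (auto intro: H_square_integrable)
  have G: "centred_gaussian N (\<lambda>w. \<Sum>t\<in>S. a t * coord (W w) t) (\<integral>x. (\<Sum>t\<in>S. a t * h t x)\<^sup>2 \<partial>P)"
    if S: "finite S" "S \<subseteq> ?T" for S a
  proof -
    have inj: "inj_on point_of S" using inj_on_point_of S(2) by (rule inj_on_subset)
    define b where "b = a \<circ> the_inv_into S point_of"
    have b: "b (point_of t) = a t" if "t \<in> S" for t using that inj by (simp add: b_def the_inv_into_f_f)
    have re: "(\<Sum>p\<in>point_of ` S. b p * q p) = (\<Sum>t\<in>S. a t * q (point_of t))" for q :: "(nat \<times> nat) \<times> rvec \<Rightarrow> real"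
      unfolding sum.reindex[OF inj] using b by (intro sum.cong) auto
    have "centred_gaussian white_noise (\<lambda>z. \<Sum>t\<in>S. a t * V z (fst (point_of t)) (snd (point_of t))) (\<integral>x. (\<Sum>t\<in>S. a t * h t x)\<^sup>2 \<partial>P)"
      using gauss[of "point_of ` S" b] S point_of_index_set unfolding re h_def by auto
    from transfer[OF this]
    have "centred_gaussian N (\<lambda>w. \<Sum>t\<in>S. a t * V (snd w) (fst (point_of t)) (snd (point_of t))) (\<integral>x. (\<Sum>t\<in>S. a t * h t x)\<^sup>2 \<partial>P)" .
    moreover have "(\<Sum>t\<in>S. a t * coord (W w) t) = (\<Sum>t\<in>S. a t * V (snd w) (fst (point_of t)) (snd (point_of t)))" for w
      using S(2) by (intro sum.cong refl) (auto simp: W_def coord_path_of_fields)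
    ultimately show ?thesis by simp
  qed
  have G1: "centred_gaussian N (\<lambda>w. coord (W w) t) (\<integral>x. (h t x)\<^sup>2 \<partial>P)" if "t \<in> ?T" for t
    using G[of "{t}" "\<lambda>_. 1"] that by simp
  have mean0: "mean N (\<lambda>w. coord (W w) t) = 0" if "t \<in> ?T" for t
    using centred_gaussian_mean(2)[OF G1[OF that]] .
  \<comment> \<open>Polarization: the covariance is read off from the variance of the sum. The case
    \<open>s = t\<close> is separate because the set of the two indices collapses.\<close>
  have cov: "cov N (\<lambda>w. coord (W w) s) (\<lambda>w. coord (W w) t) = (\<integral>x. h s x * h t x \<partial>P)" if st: "s \<in> ?T" "t \<in> ?T" for s t
  proof (cases "s = t")
    case True
    then show ?thesis
      using centred_gaussian_variance(2)[OF G1[OF st(1)]] mean0[OF st(1)] by (simp add: cov_def power2_eq_square)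
  next
    case False
    have sq: "square_integrable N (\<lambda>w. coord (W w) t)" if "t \<in> ?T" for t
      using centred_gaussian_variance(1)[OF G1[OF that]] centred_gaussianD(1)[OF G1[OF that]] by (simp add: square_integrable_def)
    have "(\<integral>w. (coord (W w) s + coord (W w) t)\<^sup>2 \<partial>N) = (\<integral>x. (h s x + h t x)\<^sup>2 \<partial>P)"
      using centred_gaussian_variance(2)[OF G[of "{s, t}" "\<lambda>_. 1"]] st False by simp
    then have "(\<integral>w. coord (W w) s * coord (W w) t \<partial>N) = (\<integral>x. h s x * h t x \<partial>P)"
      using integral_square_add[OF sq[OF st(1)] sq[OF st(2)]] integral_square_add[OF hsq[OF st(1)] hsq[OF st(2)]]
        centred_gaussian_variance(2)[OF G1[OF st(1)]] centred_gaussian_variance(2)[OF G1[OF st(2)]] by simp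
    then show ?thesis using mean0 st by (simp add: cov_def)
  qed
  have "brownian_process N P k m I f g W"
    unfolding brownian_process_def
  proof (intro conjI ballI allI impI)
    show "W \<in> space N \<rightarrow> path_space k m I"
      unfolding W_def using cont by (auto intro: path_of_fields_in_path_space)
    show "gaussian_process N ?T (\<lambda>t w. coord (W w) t)"
      unfolding gaussian_process_def using G N.centred_gaussian_imp_normal_rv by blast
    fix i j \<eta> \<theta> a b
    assume "i \<in> {1..k}" "j \<in> {1..k}" "\<eta> \<in> I i" "\<theta> \<in> I j" "a < m (i - 1)" "b < m (j - 1)"
    then show "cov N (\<lambda>w. fst (W w) i \<eta> a) (\<lambda>w. fst (W w) j \<theta> b) =
          (\<integral>x. (f i \<eta> x a - fbar P f i \<eta> a) * (f j \<theta> x b - fbar P f j \<theta> b) \<partial>P)"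
      using cov[of "Inl (i, \<eta>, a)" "Inl (j, \<theta>, b)"]
      by (auto simp: index_set_def coord_def h_def point_of_def H_inner)
  next
    fix i \<eta> a b
    assume "i \<in> {1..k}" "\<eta> \<in> I i" "a < m (i - 1)" "b < m k"
    then show "cov N (\<lambda>w. fst (W w) i \<eta> a) (\<lambda>w. snd (W w) b) =
          (\<integral>x. (f i \<eta> x a - fbar P f i \<eta> a) * (g x b - mu P k f g (Suc k) b) \<partial>P)"
      using cov[of "Inl (i, \<eta>, a)" "Inr b"]
      by (auto simp: index_set_def coord_def h_def point_of_def H_inner H_last)
  next
    fix a b
    assume "a < m k" "b < m k"
    then show "cov N (\<lambda>w. snd (W w) a) (\<lambda>w. snd (W w) b) =
          (\<integral>x. (g x a - mu P k f g (Suc k) a) * (g x b - mu P k f g (Suc k) b) \<partial>P)"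
      using cov[of "Inr a" "Inr b"]
      by (auto simp: index_set_def coord_def h_def point_of_def H_last)
  qed (use N mean0 in auto)
  then show ?thesis by blast
qed

end

section \<open>Linearization of the plug-in estimator\<close>

text \<open>A ramp is an affine function truncated to the interval from 0 to 1, and truncation is
  1-Lipschitz. Ramps are the test functions for weak convergence.\<close>

lemma cts_step_Lipschitz:
  assumes "a < b"
  shows "\<bar>cts_step a b x - cts_step a b y\<bar> \<le> 1 / (b - a) * \<bar>x - y\<bar>"
proof -
  have eq: "cts_step a b z = max 0 (min 1 ((b - z) / (b - a)))" for z
  proof -
    define q where "q = (b - z) / (b - a)"
    have "1 \<le> q \<longleftrightarrow> z \<le> a" "q \<le> 0 \<longleftrightarrow> b \<le> z"
      using assms by (simp_all add: q_def pos_le_divide_eq pos_divide_le_eq)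
    then show ?thesis unfolding cts_step_def q_def[symmetric] by (auto simp: max_def min_def)
  qed
  have clamp: "\<bar>max 0 (min 1 p) - max 0 (min 1 q)\<bar> \<le> \<bar>p - q\<bar>" for p q :: real
    by (simp add: max_def min_def)
  have "\<bar>cts_step a b x - cts_step a b y\<bar> \<le> \<bar>(b - x) / (b - a) - (b - y) / (b - a)\<bar>"
    unfolding eq by (rule clamp)
  also have "(b - x) / (b - a) - (b - y) / (b - a) = (y - x) / (b - a)"
    by (simp add: diff_divide_distrib)
  also have "\<bar>(y - x) / (b - a)\<bar> = 1 / (b - a) * \<bar>x - y\<bar>"
    using assms by (simp add: abs_minus_commute)
  finally show ?thesis .
qed

lemma cts_step_bounded: "a < b \<Longrightarrow> \<bar>cts_step a b x\<bar> \<le> 1"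
  by (auto simp: cts_step_def)

locale composite_sample = composite_functional P k m f g I \<gamma> + iid_sample M P X
  for P :: "'x measure" and k m f g I \<gamma> and M :: "'a measure" and X
begin

section \<open>The limit functional as a Lipschitz function of finitely many numbers\<close>

definition hderiv :: "nat \<Rightarrow> nat \<Rightarrow> rvec \<Rightarrow> 'x \<Rightarrow> real" where
  "hderiv j i s x = hadamard_deriv (m j) (m (j - 1)) (\<lambda>\<eta>. f j \<eta> x) (mu P k f g (Suc j)) s i"

lemma delta_method_level:
  assumes j: "j \<in> {1..k}" and i: "i < m (j - 1)"
  shows "\<exists>r. delta_method M P X (m j) (I j) (mu P k f g (Suc j)) r (\<lambda>\<eta> x. f j \<eta> x i) (hderiv j i) (\<lambda>x. \<bar>\<gamma> j x\<bar>)"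
proof -
  obtain r where r: "0 < r" "\<And>v. v \<in> Rvec (m j) \<Longrightarrow> dist1 (m j) v (mu P k f g (Suc j)) \<le> r \<Longrightarrow> v \<in> I j"
    using interior_of_Euclidean_space_ball[OF I_mu[OF j]] by blast
  have "delta_method M P X (m j) (I j) (mu P k f g (Suc j)) r (\<lambda>\<eta> x. f j \<eta> x i) (hderiv j i) (\<lambda>x. \<bar>\<gamma> j x\<bar>)"
  proof unfold_locales
    show "(\<lambda>n. sqrt (real n) * (f j (\<lambda>l. mu P k f g (Suc j) l + 1 / sqrt (real n) * s l) x i - f j (mu P k f g (Suc j)) x i))
        \<longlonglongrightarrow> hderiv j i s x" if "s \<in> Rvec (m j)" "x \<in> space P" for s x
      unfolding hderiv_def by (rule hadamard_deriv_sequentially(2)[OF f_Hadamard[OF j that(2) mu_I[OF j]] that(1)])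
  qed (use r j i mu_Rvec f_measurable f_coordinate_Lipschitz \<gamma>_square_integrable in auto)
  then show ?thesis by blast
qed

lemma hderiv_Rvec:
  assumes "j \<in> {1..k}" "s \<in> Rvec (m j)" "x \<in> space P" "m (j - 1) \<le> i"
  shows "hderiv j i s x = 0"
  using hadamard_deriv_sequentially(1)[OF f_Hadamard[OF assms(1,3) mu_I[OF assms(1)]] assms(2)] assms(4)
  by (simp add: hderiv_def Rvec_iff)

definition Dd :: "nat \<Rightarrow> nat \<Rightarrow> rvec \<Rightarrow> real" where
  "Dd j i s = (\<integral>x. hderiv j i s x \<partial>P)"

text \<open>A path with prescribed numbers as values, constant in the parameter. It need not belong
  to \<open>path_space\<close>; it allows the finite-dimensional recursion \<open>lin\<close> to be
  an instance of \<open>xi\<close>.\<close>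

definition path_of :: "(nat \<times> nat \<Rightarrow> real) \<Rightarrow> path" where
  "path_of u = ((\<lambda>j \<eta> i. if (j, i) \<in> idx then u (j, i) else 0), (\<lambda>i. if (Suc k, i) \<in> idx then u (Suc k, i) else 0))"

definition coords :: "path \<Rightarrow> nat \<times> nat \<Rightarrow> real" where
  "coords p \<alpha> = (if \<alpha> \<in> idx then if fst \<alpha> \<le> k then fst p (fst \<alpha>) (base \<alpha>) (snd \<alpha>) else snd p (snd \<alpha>) else 0)"

definition lin :: "(nat \<times> nat \<Rightarrow> real) \<Rightarrow> nat \<Rightarrow> rvec" where
  "lin u j = xi P k m f g (path_of u) j"

lemma idx_iff: "(j, i) \<in> idx \<longleftrightarrow> 1 \<le> j \<and> j \<le> Suc k \<and> i < m (j - 1)"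
  by (auto simp: idx_def)

lemma lin_last: "lin u (Suc k) i = (if i < m k then u (Suc k, i) else 0)"
  unfolding lin_def by (subst xi.simps) (simp add: path_of_def idx_iff)

lemma lin_step: "j \<in> {1..k} \<Longrightarrow> lin u j i = Dd j i (lin u (Suc j)) + (if i < m (j - 1) then u (j, i) else 0)"
  unfolding lin_def by (subst xi.simps) (simp add: path_of_def idx_iff vint_def Dd_def hderiv_def)

text \<open>The recursion reads level \<open>j\<close> of the path only at the next mean, so the
  numbers in \<open>coords\<close> determine it. The \<open>Rvec\<close> conditions give agreement
  beyond the dimension, where \<open>coords\<close> is 0.\<close>

lemma xi_eq_lin:
  assumes d: "\<And>j. j \<in> {1..k} \<Longrightarrow> fst p j (mu P k f g (Suc j)) \<in> Rvec (m (j - 1))" "snd p \<in> Rvec (m k)"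
    and j: "1 \<le> j" "j \<le> Suc k"
  shows "xi P k m f g p j = lin (coords p) j"
  using j(2,1)
proof (induction j rule: inc_induct)
  case base
  have "snd p i = lin (coords p) (Suc k) i" for i
    using d(2) unfolding lin_last by (auto simp: coords_def idx_iff Rvec_iff not_less)
  then show ?case by (subst xi.simps) auto
next
  case (step j)
  then have j: "j \<in> {1..k}" by auto
  have IH: "xi P k m f g p (Suc j) = lin (coords p) (Suc j)" using step by simp
  have "xi P k m f g p j i = lin (coords p) j i" for i
  proof -
    have "xi P k m f g p j i = Dd j i (lin (coords p) (Suc j)) + fst p j (mu P k f g (Suc j)) i"
      using j by (subst xi.simps) (simp add: IH vint_def Dd_def hderiv_def)
    moreover have "fst p j (mu P k f g (Suc j)) i = (if i < m (j - 1) then coords p (j, i) else 0)"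
      using d(1)[OF j] j by (auto simp: coords_def idx_iff Rvec_iff base_def)
    ultimately show ?thesis unfolding lin_step[OF j] by simp
  qed
  then show ?case by auto
qed

lemma lin_Rvec:
  assumes "1 \<le> j" "j \<le> Suc k"
  shows "lin u j \<in> Rvec (m (j - 1))"
  using assms(2,1)
proof (induction j rule: inc_induct)
  case base
  then show ?case by (simp add: Rvec_iff lin_last)
next
  case (step j)
  then have j: "j \<in> {1..k}" and IH: "lin u (Suc j) \<in> Rvec (m j)" by auto
  have "Dd j i (lin u (Suc j)) = 0" if "m (j - 1) \<le> i" for i
  proof -
    have "Dd j i (lin u (Suc j)) = (\<integral>x. 0 \<partial>P)"
      unfolding Dd_def using hderiv_Rvec[OF j IH _ that] by (intro Bochner_Integration.integral_cong) auto
    then show ?thesis by simp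
  qed
  then show ?case by (simp add: Rvec_iff lin_step[OF j])
qed

lemma Dd_Lipschitz:
  assumes "j \<in> {1..k}" "i < m (j - 1)" "s \<in> Rvec (m j)" "s' \<in> Rvec (m j)"
  shows "\<bar>Dd j i s - Dd j i s'\<bar> \<le> (\<integral>x. \<bar>\<gamma> j x\<bar> \<partial>P) * dist1 (m j) s s'"
proof -
  obtain r where "delta_method M P X (m j) (I j) (mu P k f g (Suc j)) r (\<lambda>\<eta> x. f j \<eta> x i) (hderiv j i) (\<lambda>x. \<bar>\<gamma> j x\<bar>)"
    using delta_method_level[OF assms(1,2)] by blast
  then interpret L: delta_method M P X "m j" "I j" "mu P k f g (Suc j)" r "\<lambda>\<eta> x. f j \<eta> x i" "hderiv j i" "\<lambda>x. \<bar>\<gamma> j x\<bar>" .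
  show ?thesis using L.D_Lipschitz[OF assms(3,4)] by (simp add: L.D_def Dd_def)
qed

text \<open>Downward recursion for the constant: the integrated derivative multiplies the constant
  of the next level by the mean of |\<gamma>| and by \<open>m j\<close>, the number of coordinates;
  the summand 1 comes from \<open>u (j, i)\<close>.\<close>

lemma lin_Lipschitz:
  assumes "1 \<le> j" "j \<le> Suc k"
  shows "\<exists>C\<ge>0. \<forall>u v. \<forall>i<m (j - 1). \<bar>lin u j i - lin v j i\<bar> \<le> C * (\<Sum>\<alpha>\<in>idx. \<bar>u \<alpha> - v \<alpha>\<bar>)"
  using assms(2,1)
proof (induction j rule: inc_induct)
  case base
  have "\<bar>lin u (Suc k) i - lin v (Suc k) i\<bar> \<le> 1 * (\<Sum>\<alpha>\<in>idx. \<bar>u \<alpha> - v \<alpha>\<bar>)" if "i < m k" for u v i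
    using that finite_idx member_le_sum[of "(Suc k, i)" idx "\<lambda>\<alpha>. \<bar>u \<alpha> - v \<alpha>\<bar>"] by (simp add: lin_last idx_iff)
  then show ?case by (intro exI[of _ 1]) simp
next
  case (step j)
  then have j: "j \<in> {1..k}" by auto
  from step obtain C where C: "0 \<le> C" "\<And>u v i. i < m j \<Longrightarrow> \<bar>lin u (Suc j) i - lin v (Suc j) i\<bar> \<le> C * (\<Sum>\<alpha>\<in>idx. \<bar>u \<alpha> - v \<alpha>\<bar>)"
    by auto
  define G where "G = (\<integral>x. \<bar>\<gamma> j x\<bar> \<partial>P)"
  have G: "0 \<le> G" unfolding G_def by (intro Bochner_Integration.integral_nonneg) auto
  have "\<bar>lin u j i - lin v j i\<bar> \<le> (G * (real (m j) * C) + 1) * (\<Sum>\<alpha>\<in>idx. \<bar>u \<alpha> - v \<alpha>\<bar>)" if i: "i < m (j - 1)" for u v i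
  proof -
    let ?S = "\<Sum>\<alpha>\<in>idx. \<bar>u \<alpha> - v \<alpha>\<bar>"
    have R: "lin u (Suc j) \<in> Rvec (m j)" "lin v (Suc j) \<in> Rvec (m j)" using lin_Rvec[of "Suc j"] j by auto
    have "\<bar>Dd j i (lin u (Suc j)) - Dd j i (lin v (Suc j))\<bar> \<le> G * dist1 (m j) (lin u (Suc j)) (lin v (Suc j))"
      unfolding G_def by (rule Dd_Lipschitz[OF j i R])
    also have "\<dots> \<le> G * (real (m j) * (C * ?S))"
    proof (rule mult_left_mono[OF _ G])
      have "dist1 (m j) (lin u (Suc j)) (lin v (Suc j)) \<le> (\<Sum>i<m j. C * ?S)"
        unfolding dist1_def using C(2) by (intro sum_mono) auto
      then show "dist1 (m j) (lin u (Suc j)) (lin v (Suc j)) \<le> real (m j) * (C * ?S)" by simp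
    qed
    finally have 1: "\<bar>Dd j i (lin u (Suc j)) - Dd j i (lin v (Suc j))\<bar> \<le> G * (real (m j) * C) * ?S" by (simp add: mult.assoc)
    have "(j, i) \<in> idx" using j i by (simp add: idx_iff)
    then have 2: "\<bar>u (j, i) - v (j, i)\<bar> \<le> ?S"
      using finite_idx member_le_sum[of "(j, i)" idx "\<lambda>\<alpha>. \<bar>u \<alpha> - v \<alpha>\<bar>"] by simp
    show ?thesis using 1 2 i unfolding lin_step[OF j] by (simp add: distrib_right)
  qed
  then show ?case using G C(1) by (intro exI[of _ "G * (real (m j) * C) + 1"]) auto
qed

lemma lin_measurable:
  assumes "1 \<le> j" "j \<le> Suc k" "i < m (j - 1)" "\<And>\<alpha>. (\<lambda>w. u w \<alpha>) \<in> borel_measurable L"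
  shows "(\<lambda>w. lin (u w) j i) \<in> borel_measurable L"
proof -
  obtain C where "\<And>u v. \<bar>lin u j i - lin v j i\<bar> \<le> C * (\<Sum>\<alpha>\<in>idx. \<bar>u \<alpha> - v \<alpha>\<bar>)"
    using lin_Lipschitz[OF assms(1,2)] assms(3) by blast
  then have "continuous_on UNIV (\<lambda>u. lin u j i)" by (rule continuous_on_finite_Lipschitz)
  then have "(\<lambda>u. lin u j i) \<in> borel_measurable borel" by (rule borel_measurable_continuous_onI)
  moreover have "u \<in> borel_measurable L"
    using assms(4) by (rule measurable_coordinatewise_then_product)
  ultimately show ?thesis by (rule measurable_compose[rotated])
qed

section \<open>The empirical recursion and its linearization\<close>

definition nu :: "nat \<Rightarrow> 'a \<Rightarrow> nat \<Rightarrow> rvec" where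
  "nu n w j = nested (sample_mean (\<lambda>l. X l w) n) k f g j"

definition zeta :: "nat \<Rightarrow> 'a \<Rightarrow> nat \<Rightarrow> rvec" where
  "zeta n w j = (\<lambda>i. sqrt (real n) * (nu n w j i - mu P k f g j i))"

text \<open>Set to 0 outside \<open>idx\<close>, so that every coordinate is measurable, as the
  Cramer--Wold step demands.\<close>

definition emp :: "nat \<Rightarrow> 'a \<Rightarrow> nat \<times> nat \<Rightarrow> real" where
  "emp n w \<alpha> = (if \<alpha> \<in> idx then sqrt (real n) * avg n w (H \<alpha> (base \<alpha>)) else 0)"

lemma nu_last: "nu n w (Suc k) i = avg n w (\<lambda>x. g x i)"
  unfolding nu_def by (subst nested.simps) (simp add: sample_mean_eq_average)

lemma nu_step: "j \<le> k \<Longrightarrow> nu n w j i = avg n w (\<lambda>x. f j (nu n w (Suc j)) x i)"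
  unfolding nu_def by (subst nested.simps) (simp add: sample_mean_eq_average)

lemma average_zero:
  assumes "\<And>l. 1 \<le> l \<Longrightarrow> u (x l) = 0"
  shows "average x n u = 0"
  unfolding average_def using assms by (intro sum.neutral) auto

lemma nu_Rvec:
  assumes "1 \<le> j" "j \<le> Suc k" and w: "w \<in> space M"
  shows "nu n w j \<in> Rvec (m (j - 1))"
  using assms(2,1)
proof (induction j rule: inc_induct)
  case base
  show ?case using g_range[OF X_space[OF _ w]] by (auto simp: Rvec_iff nu_last intro!: average_zero)
next
  case (step j)
  then have j: "j \<in> {1..k}" and IH: "nu n w (Suc j) \<in> Rvec (m j)" by auto
  show ?case using f_range[OF j IH X_space[OF _ w]] j by (auto simp: Rvec_iff nu_step intro!: average_zero)
qed

text \<open>The vector argument of \<open>f j\<close> is itself random, so measurability of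
  \<open>f j\<close> in both arguments jointly is needed; it is available on
  \<open>Rvec (m j)\<close>, where the argument lies.\<close>

lemma nu_measurable:
  assumes "1 \<le> j" "j \<le> Suc k"
  shows "(\<lambda>w. nu n w j i) \<in> borel_measurable M"
  using assms(2,1)
proof (induction j arbitrary: i rule: inc_induct)
  case base
  show ?case unfolding nu_last by (rule average_measurable[OF g_measurable])
next
  case (step j)
  then have j: "j \<in> {1..k}" by auto
  have "(\<lambda>w. nu n w (Suc j)) \<in> borel_measurable M"
    using step by (intro measurable_coordinatewise_then_product) auto
  then have nu: "(\<lambda>w. nu n w (Suc j)) \<in> M \<rightarrow>\<^sub>M restrict_space borel (Rvec (m j))"
    using nu_Rvec[of "Suc j"] j by (intro measurable_restrict_space2) auto
  have "(\<lambda>w. f j (nu n w (Suc j)) (X l w) i) \<in> borel_measurable M" if l: "1 \<le> l" for l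
  proof -
    have "(\<lambda>w. (nu n w (Suc j), X l w)) \<in> M \<rightarrow>\<^sub>M restrict_space borel (Rvec (m j)) \<Otimes>\<^sub>M P"
      by (rule measurable_Pair[OF nu X_measurable[OF l]])
    from measurable_compose[OF this f_meas[OF j]]
    have "(\<lambda>w. f j (nu n w (Suc j)) (X l w)) \<in> borel_measurable M" by (simp only: prod.case)
    then show ?thesis by (rule measurable_compose) (rule measurable_product_coordinates)
  qed
  then have "(\<lambda>w. avg n w (\<lambda>x. f j (nu n w (Suc j)) x i)) \<in> borel_measurable M"
    unfolding average_def by (intro borel_measurable_sum borel_measurable_times) auto
  then show ?case using j by (simp add: nu_step)
qed

lemma zeta_measurable: "1 \<le> j \<Longrightarrow> j \<le> Suc k \<Longrightarrow> (\<lambda>w. zeta n w j i) \<in> borel_measurable M"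
  unfolding zeta_def using nu_measurable by (intro borel_measurable_times borel_measurable_diff borel_measurable_const)

lemma zeta_Rvec:
  assumes "j \<in> {1..k}" "w \<in> space M"
  shows "zeta n w (Suc j) \<in> Rvec (m j)"
  using nu_Rvec[of "Suc j" w n] mu_Rvec[OF assms(1)] assms by (simp add: zeta_def Rvec_iff)

lemma emp_eq:
  assumes "\<alpha> \<in> idx"
  shows "emp n w \<alpha> = sqrt (real n) * (avg n w (fn \<alpha> (base \<alpha>)) - (\<integral>x. fn \<alpha> (base \<alpha>) x \<partial>P))"
proof (cases "n = 0")
  case False
  then have "avg n w (H \<alpha> (base \<alpha>)) = avg n w (fn \<alpha> (base \<alpha>)) - (\<integral>x. fn \<alpha> (base \<alpha>) x \<partial>P)"
    unfolding H_def[abs_def] average_diff by (simp add: average_const)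
  then show ?thesis using assms by (simp add: emp_def)
qed (simp add: emp_def)

lemma emp_measurable: "(\<lambda>w. emp n w \<alpha>) \<in> borel_measurable M"
proof (cases "\<alpha> \<in> idx")
  case True
  have "H \<alpha> (base \<alpha>) \<in> borel_measurable P"
    using H_square_integrable[OF True base_pset[OF True]] by (rule square_integrable_measurable)
  then show ?thesis using True average_measurable by (auto simp: emp_def)
qed (simp add: emp_def)

lemma zeta_last:
  assumes "i < m k"
  shows "zeta n w (Suc k) i = emp n w (Suc k, i)"
proof -
  have "(Suc k, i) \<in> idx" using assms by (simp add: idx_iff)
  then show ?thesis by (simp add: emp_eq zeta_def nu_last mu_last vint_def fn_def[abs_def])
qed

lemma zeta_step:
  assumes j: "j \<in> {1..k}" and i: "i < m (j - 1)"
  shows "zeta n w j i = avg n w (\<lambda>x. sqrt (real n) *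
      (f j (\<lambda>l. mu P k f g (Suc j) l + 1 / sqrt (real n) * zeta n w (Suc j) l) x i - f j (mu P k f g (Suc j)) x i))
    + emp n w (j, i)"
proof (cases "n = 0")
  case False
  have "mu P k f g (Suc j) l + 1 / sqrt (real n) * zeta n w (Suc j) l = nu n w (Suc j) l" for l
    using False by (simp add: zeta_def)
  then have nu: "(\<lambda>l. mu P k f g (Suc j) l + 1 / sqrt (real n) * zeta n w (Suc j) l) = nu n w (Suc j)" by auto
  have idx: "(j, i) \<in> idx" using j i by (simp add: idx_iff)
  have "fn (j, i) (base (j, i)) = (\<lambda>x. f j (mu P k f g (Suc j)) x i)" using j by (auto simp: fn_def base_def)
  then show ?thesis
    using j unfolding nu average_cmult average_diff emp_eq[OF idx]
    by (simp add: zeta_def nu_step mu_step fbar_def vint_def right_diff_distrib)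
next
  case True
  then show ?thesis by (simp add: zeta_def emp_def average_def)
qed

lemma emp_tight: "tight_in_prob (\<lambda>n w. emp n w \<alpha>)"
proof (cases "\<alpha> \<in> idx")
  case True
  note h = H_square_integrable[OF True base_pset[OF True]] H_mean[OF True base_pset[OF True]]
  have eq: "emp n w \<alpha> = sqrt (real n) * avg n w (H \<alpha> (base \<alpha>))" for n w
    using True by (simp add: emp_def)
  show ?thesis
    by (rule tight_in_prob_second_moment[OF emp_measurable scaled_average_second_moment[OF h, folded eq]])
next
  case False
  then show ?thesis by (simp add: emp_def null_in_prob_zero null_in_prob_imp_tight)
qed

text \<open>The two claims are proved together: tightness at level \<open>j + 1\<close> is what the
  local expansion needs, and the expansion in turn gives tightness at level
  \<open>j\<close>.\<close>

lemma zeta_linearization: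
  assumes "1 \<le> j" "j \<le> Suc k"
  shows "\<forall>i<m (j - 1). tight_in_prob (\<lambda>n w. zeta n w j i) \<and> null_in_prob (\<lambda>n w. zeta n w j i - lin (emp n w) j i)"
  using assms(2,1)
proof (induction j rule: inc_induct)
  case base
  show ?case
  proof (intro allI impI conjI)
    fix i assume "i < m (Suc k - 1)"
    then have i: "i < m k" by simp
    show "tight_in_prob (\<lambda>n w. zeta n w (Suc k) i)" unfolding zeta_last[OF i] by (rule emp_tight)
    show "null_in_prob (\<lambda>n w. zeta n w (Suc k) i - lin (emp n w) (Suc k) i)"
      unfolding zeta_last[OF i] lin_last using i by (simp add: null_in_prob_zero)
  qed
next
  case (step j)
  then have j: "j \<in> {1..k}" and IHt: "\<And>l. l < m j \<Longrightarrow> tight_in_prob (\<lambda>n w. zeta n w (Suc j) l)"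
    and IHn: "\<And>l. l < m j \<Longrightarrow> null_in_prob (\<lambda>n w. zeta n w (Suc j) l - lin (emp n w) (Suc j) l)" by auto
  show ?case
  proof (intro allI impI)
    fix i assume i: "i < m (j - 1)"
    obtain r where "delta_method M P X (m j) (I j) (mu P k f g (Suc j)) r (\<lambda>\<eta> x. f j \<eta> x i) (hderiv j i) (\<lambda>x. \<bar>\<gamma> j x\<bar>)"
      using delta_method_level[OF j i] by blast
    then interpret L: delta_method M P X "m j" "I j" "mu P k f g (Suc j)" r "\<lambda>\<eta> x. f j \<eta> x i" "hderiv j i" "\<lambda>x. \<bar>\<gamma> j x\<bar>" .
    have LD: "L.D = Dd j i" by (auto simp: L.D_def Dd_def)
    define G where "G = (\<integral>x. \<bar>\<gamma> j x\<bar> \<partial>P)"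
    have zR: "\<And>n w. w \<in> space M \<Longrightarrow> zeta n w (Suc j) \<in> Rvec (m j)" using zeta_Rvec[OF j] .
    have lR: "lin u (Suc j) \<in> Rvec (m j)" for u using lin_Rvec[of "Suc j"] j by auto
    let ?A = "\<lambda>n w. avg n w (L.q n (zeta n w (Suc j)))"
    have zs: "zeta n w j i = ?A n w + emp n w (j, i)" for n w
      unfolding zeta_step[OF j i] by (simp add: L.q_def[abs_def])
    \<comment> \<open>Measurability of the average in a random direction is read off from the
      recursion, where it is a difference of two measurable terms.\<close>
    have Am: "?A n \<in> borel_measurable M" for n
    proof -
      have eq: "?A n = (\<lambda>w. zeta n w j i - emp n w (j, i))" by (simp only: zs add_diff_cancel_right')
      show ?thesis
        unfolding eq by (intro borel_measurable_diff zeta_measurable emp_measurable) (use j in auto)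
    qed
    have Dzm: "(\<lambda>w. Dd j i (zeta n w (Suc j))) \<in> borel_measurable M" for n
      unfolding LD[symmetric] using j by (intro L.D_measurable zR zeta_measurable) auto
    have llm: "(\<lambda>w. lin (emp n w) (Suc j) l) \<in> borel_measurable M" if "l < m j" for n l
      using j that by (intro lin_measurable emp_measurable) auto
    have Dlm: "(\<lambda>w. Dd j i (lin (emp n w) (Suc j))) \<in> borel_measurable M" for n
      unfolding LD[symmetric] by (rule L.D_measurable[OF lR llm])
    have N1: "null_in_prob (\<lambda>n w. ?A n w - Dd j i (zeta n w (Suc j)))"
      unfolding LD[symmetric]
    proof (rule L.local_expansion)
      show "(\<lambda>w. ?A n w - L.D (zeta n w (Suc j))) \<in> borel_measurable M" for n
        unfolding LD using Am Dzm by (rule borel_measurable_diff)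
    qed (use zR IHt in auto)
    \<comment> \<open>The direction is replaced by its linearization inside the integrated
      derivative; the Lipschitz bound passes on the error of level \<open>j + 1\<close>.\<close>
    have N2: "null_in_prob (\<lambda>n w. Dd j i (zeta n w (Suc j)) - Dd j i (lin (emp n w) (Suc j)))"
    proof (rule null_in_prob_bound)
      show "null_in_prob (\<lambda>n w. G * (\<Sum>l<m j. \<bar>zeta n w (Suc j) l - lin (emp n w) (Suc j) l\<bar>))"
        using IHn by (intro null_in_prob_cmult null_in_prob_sum null_in_prob_abs) auto
      show "(\<lambda>w. Dd j i (zeta n w (Suc j)) - Dd j i (lin (emp n w) (Suc j))) \<in> borel_measurable M" for n
        using Dzm Dlm by (rule borel_measurable_diff)
      show "\<bar>Dd j i (zeta n w (Suc j)) - Dd j i (lin (emp n w) (Suc j))\<bar>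
          \<le> \<bar>G * (\<Sum>l<m j. \<bar>zeta n w (Suc j) l - lin (emp n w) (Suc j) l\<bar>)\<bar>" if "w \<in> space M" for n w
        using Dd_Lipschitz[OF j i zR[OF that] lR] by (fold G_def, unfold dist1_def) (rule order_trans[OF _ abs_ge_self])
    qed
    have N: "null_in_prob (\<lambda>n w. zeta n w j i - lin (emp n w) j i)"
      using null_in_prob_add[OF N1 N2] i by (simp add: zs lin_step[OF j])
    have T2: "tight_in_prob (\<lambda>n w. Dd j i (zeta n w (Suc j)))"
    proof (rule tight_in_prob_dominated[OF _ null_in_prob_imp_tight[OF null_in_prob_zero]])
      show "tight_in_prob (\<lambda>n w. G * (\<Sum>l<m j. \<bar>zeta n w (Suc j) l\<bar>))"
        using IHt by (intro tight_in_prob_cmult tight_in_prob_sum_abs) auto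
      show "\<bar>Dd j i (zeta n w (Suc j))\<bar> \<le> \<bar>G * (\<Sum>l<m j. \<bar>zeta n w (Suc j) l\<bar>)\<bar> + \<bar>0\<bar>" if "w \<in> space M" for n w
        using L.D_bound[OF zR[OF that]] unfolding LD G_def dist1_def by simp
    qed (rule Dzm)
    have "tight_in_prob (\<lambda>n w. ((?A n w - Dd j i (zeta n w (Suc j))) + Dd j i (zeta n w (Suc j))) + emp n w (j, i))"
      by (intro tight_in_prob_add null_in_prob_imp_tight[OF N1] T2 emp_tight)
    then have T: "tight_in_prob (\<lambda>n w. zeta n w j i)" by (simp add: zs)
    from T N show "tight_in_prob (\<lambda>n w. zeta n w j i) \<and> null_in_prob (\<lambda>n w. zeta n w j i - lin (emp n w) j i)" by simp
  qed
qed

section \<open>Comparison of the empirical means with the Gaussian process\<close>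

text \<open>A linear combination of averages over the same sample is the average of one centred
  function, to which the one-dimensional limit theorem applies.\<close>

lemma emp_char:
  "(\<lambda>n. char (distr M borel (\<lambda>w. \<Sum>\<alpha>\<in>idx. t \<alpha> * emp n w \<alpha>)) 1)
    \<longlonglongrightarrow> complex_of_real (exp (- (\<integral>x. (\<Sum>\<alpha>\<in>idx. t \<alpha> * H \<alpha> (base \<alpha>) x)\<^sup>2 \<partial>P) / 2))"
proof -
  let ?u = "\<lambda>x. \<Sum>\<alpha>\<in>idx. t \<alpha> * H \<alpha> (base \<alpha>) x"
  have sq: "square_integrable P (\<lambda>x. t \<alpha> * H \<alpha> (base \<alpha>) x)" if "\<alpha> \<in> idx" for \<alpha>
    by (rule square_integrable_cmult[OF H_square_integrable[OF that base_pset[OF that]]])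
  then have u: "square_integrable P ?u" by (rule square_integrable_sum)
  have "(\<integral>x. ?u x \<partial>P) = (\<Sum>\<alpha>\<in>idx. \<integral>x. t \<alpha> * H \<alpha> (base \<alpha>) x \<partial>P)"
    using P.square_integrable_integrable[OF sq] by (rule Bochner_Integration.integral_sum)
  also have "\<dots> = 0" using H_mean base_pset by (intro sum.neutral) auto
  finally have u0: "(\<integral>x. ?u x \<partial>P) = 0" .
  have "sqrt (real n) * avg n w ?u = (\<Sum>\<alpha>\<in>idx. t \<alpha> * emp n w \<alpha>)" for n w
    unfolding average_sum average_cmult sum_distrib_left by (intro sum.cong refl) (simp add: emp_def)
  then show ?thesis using CLT_char[OF u u0, of 1] by simp
qed

text \<open>For any admissible \<open>W\<close>, combinations of coordinates are normal with mean 0,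
  and the prescribed covariances give their second moment. It is the variance that appears in
  \<open>emp_char\<close>.\<close>

lemma brownian_coords_gaussian:
  assumes W: "brownian_process N P k m I f g W"
  shows "centred_gaussian N (\<lambda>w. \<Sum>\<alpha>\<in>idx. t \<alpha> * coords (W w) \<alpha>) (\<integral>x. (\<Sum>\<alpha>\<in>idx. t \<alpha> * H \<alpha> (base \<alpha>) x)\<^sup>2 \<partial>P)"
    and "\<alpha> \<in> idx \<Longrightarrow> centred_gaussian N (\<lambda>w. coords (W w) \<alpha>) (\<integral>x. (H \<alpha> (base \<alpha>) x)\<^sup>2 \<partial>P)"
proof -
  interpret N: prob_space N using W by (simp add: brownian_process_def)
  \<comment> \<open>Picks the scalar coordinate of the path at the base point, the only one that the
    recursion reads.\<close>
  define \<iota> :: "nat \<times> nat \<Rightarrow> index" where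
    "\<iota> \<alpha> = (if fst \<alpha> \<le> k then Inl (fst \<alpha>, base \<alpha>, snd \<alpha>) else Inr (snd \<alpha>))" for \<alpha>
  have co: "coords (W w) \<alpha> = coord (W w) (\<iota> \<alpha>)" if "\<alpha> \<in> idx" for w \<alpha>
    using that by (auto simp: coords_def coord_def \<iota>_def)
  have \<iota>T: "\<iota> \<alpha> \<in> index_set k m I" if "\<alpha> \<in> idx" for \<alpha>
    using that by (rule idx_cases) (auto simp: \<iota>_def index_set_def base_def mu_I)
  have inj: "inj_on \<iota> idx"
    by (rule inj_onI) (auto simp: \<iota>_def idx_iff split: if_splits)
  have gp: "normal_rv N (\<lambda>w. \<Sum>t\<in>S. a t * coord (W w) t)" if "finite S" "S \<subseteq> index_set k m I" for S a
    using W that by (simp add: brownian_process_def gaussian_process_def)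
  have mean0: "mean N (\<lambda>w. coord (W w) t) = 0" if "t \<in> index_set k m I" for t
    using W that by (simp add: brownian_process_def)
  have single: "centred_gaussian N (\<lambda>w. coord (W w) s) (\<integral>w. (coord (W w) s)\<^sup>2 \<partial>N)" if "s \<in> index_set k m I" for s
    using gp[of "{s}" "\<lambda>_. 1"] mean0[OF that] that by (intro N.normal_rv_imp_centred_gaussian) auto
  have sq: "square_integrable N (\<lambda>w. coord (W w) s)" if "s \<in> index_set k m I" for s
    using centred_gaussianD(1)[OF single[OF that]] centred_gaussian_variance(1)[OF single[OF that]]
    by (simp add: square_integrable_def)
  have cov: "(\<integral>w. coord (W w) (\<iota> \<alpha>) * coord (W w) (\<iota> \<beta>) \<partial>N) = (\<integral>x. H \<alpha> (base \<alpha>) x * H \<beta> (base \<beta>) x \<partial>P)"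
    if \<alpha>: "\<alpha> \<in> idx" and \<beta>: "\<beta> \<in> idx" for \<alpha> \<beta>
  proof -
    have c: "(\<integral>w. coord (W w) (\<iota> \<alpha>) * coord (W w) (\<iota> \<beta>) \<partial>N) = cov N (\<lambda>w. coord (W w) (\<iota> \<alpha>)) (\<lambda>w. coord (W w) (\<iota> \<beta>))"
      using mean0[OF \<iota>T[OF \<alpha>]] mean0[OF \<iota>T[OF \<beta>]] by (simp add: cov_def)
    have inner_inner: "\<And>i j \<eta> \<theta> a b. i \<in> {1..k} \<Longrightarrow> j \<in> {1..k} \<Longrightarrow> \<eta> \<in> I i \<Longrightarrow> \<theta> \<in> I j \<Longrightarrow> a < m (i - 1) \<Longrightarrow> b < m (j - 1) \<Longrightarrow>
        cov N (\<lambda>w. fst (W w) i \<eta> a) (\<lambda>w. fst (W w) j \<theta> b) =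
          (\<integral>x. (f i \<eta> x a - fbar P f i \<eta> a) * (f j \<theta> x b - fbar P f j \<theta> b) \<partial>P)"
      and inner_last: "\<And>i \<eta> a b. i \<in> {1..k} \<Longrightarrow> \<eta> \<in> I i \<Longrightarrow> a < m (i - 1) \<Longrightarrow> b < m k \<Longrightarrow>
        cov N (\<lambda>w. fst (W w) i \<eta> a) (\<lambda>w. snd (W w) b) =
          (\<integral>x. (f i \<eta> x a - fbar P f i \<eta> a) * (g x b - mu P k f g (Suc k) b) \<partial>P)"
      and last_last: "\<And>a b. a < m k \<Longrightarrow> b < m k \<Longrightarrow>
        cov N (\<lambda>w. snd (W w) a) (\<lambda>w. snd (W w) b) =
          (\<integral>x. (g x a - mu P k f g (Suc k) a) * (g x b - mu P k f g (Suc k) b) \<partial>P)"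
      using W unfolding brownian_process_def by blast+
    have sym: "cov N u v = cov N v u" for u v by (simp add: cov_def mult.commute)
    from \<alpha> show ?thesis
    proof (cases rule: idx_cases)
      case \<alpha>': (inner i a)
      from \<beta> show ?thesis
      proof (cases rule: idx_cases)
        case \<beta>': (inner j b)
        show ?thesis unfolding c
          using \<alpha>' \<beta>' inner_inner[OF \<alpha>'(2) \<beta>'(2) mu_I[OF \<alpha>'(2)] mu_I[OF \<beta>'(2)] \<alpha>'(3) \<beta>'(3)]
          by (simp add: coord_def \<iota>_def base_def H_inner)
      next
        case \<beta>': (last b)
        show ?thesis unfolding c
          using \<alpha>' \<beta>' inner_last[OF \<alpha>'(2) mu_I[OF \<alpha>'(2)] \<alpha>'(3) \<beta>'(2)]
          by (simp add: coord_def \<iota>_def base_def H_inner H_last)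
      qed
    next
      case \<alpha>': (last a)
      from \<beta> show ?thesis
      proof (cases rule: idx_cases)
        case \<beta>': (inner j b)
        \<comment> \<open>The mixed covariance is prescribed in one order only; the other order
          follows by symmetry.\<close>
        show ?thesis unfolding c sym[of "\<lambda>w. coord (W w) (\<iota> \<alpha>)"]
          using \<alpha>' \<beta>' inner_last[OF \<beta>'(2) mu_I[OF \<beta>'(2)] \<beta>'(3) \<alpha>'(2)]
          by (simp add: coord_def \<iota>_def base_def H_inner H_last mult.commute)
      next
        case \<beta>': (last b)
        show ?thesis unfolding c
          using \<alpha>' \<beta>' last_last[OF \<alpha>'(2) \<beta>'(2)]
          by (simp add: coord_def \<iota>_def base_def H_last)
      qed
    qed
  qed
  have sum: "centred_gaussian N (\<lambda>w. \<Sum>\<alpha>\<in>idx. t \<alpha> * coords (W w) \<alpha>) (\<integral>x. (\<Sum>\<alpha>\<in>idx. t \<alpha> * H \<alpha> (base \<alpha>) x)\<^sup>2 \<partial>P)" for t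
  proof -
    let ?Y = "\<lambda>w. \<Sum>\<alpha>\<in>idx. t \<alpha> * coord (W w) (\<iota> \<alpha>)"
    have eq: "(\<lambda>w. \<Sum>\<alpha>\<in>idx. t \<alpha> * coords (W w) \<alpha>) = ?Y"
      by (intro ext sum.cong refl) (simp add: co)
    have sqt: "square_integrable N (\<lambda>w. t \<alpha> * coord (W w) (\<iota> \<alpha>))" if "\<alpha> \<in> idx" for \<alpha>
      by (rule square_integrable_cmult[OF sq[OF \<iota>T[OF that]]])
    have sqH: "square_integrable P (\<lambda>x. t \<alpha> * H \<alpha> (base \<alpha>) x)" if "\<alpha> \<in> idx" for \<alpha>
      by (rule square_integrable_cmult[OF H_square_integrable[OF that base_pset[OF that]]])
    have "normal_rv N (\<lambda>w. \<Sum>s\<in>\<iota> ` idx. (t \<circ> the_inv_into idx \<iota>) s * coord (W w) s)"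
      using finite_idx \<iota>T by (intro gp) auto
    then have nr: "normal_rv N ?Y"
      by (simp add: sum.reindex[OF inj] the_inv_into_f_f[OF inj])
    have "(\<integral>w. ?Y w \<partial>N) = (\<Sum>\<alpha>\<in>idx. \<integral>w. t \<alpha> * coord (W w) (\<iota> \<alpha>) \<partial>N)"
      using N.square_integrable_integrable[OF sqt] by (rule Bochner_Integration.integral_sum)
    also have "\<dots> = 0" using mean0[OF \<iota>T] by (intro sum.neutral) (auto simp: mean_def)
    finally have "mean N ?Y = 0" by (simp add: mean_def)
    with nr have cg: "centred_gaussian N ?Y (\<integral>w. (?Y w)\<^sup>2 \<partial>N)" by (rule N.normal_rv_imp_centred_gaussian)
    have "(\<integral>w. (?Y w)\<^sup>2 \<partial>N) = (\<Sum>\<alpha>\<in>idx. \<Sum>\<beta>\<in>idx. \<integral>w. (t \<alpha> * coord (W w) (\<iota> \<alpha>)) * (t \<beta> * coord (W w) (\<iota> \<beta>)) \<partial>N)"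
      unfolding power2_eq_square by (rule integral_sum_squares[OF sqt sqt])
    also have "\<dots> = (\<Sum>\<alpha>\<in>idx. \<Sum>\<beta>\<in>idx. \<integral>x. (t \<alpha> * H \<alpha> (base \<alpha>) x) * (t \<beta> * H \<beta> (base \<beta>) x) \<partial>P)"
      unfolding integral_scaled_product by (intro sum.cong refl) (simp add: cov)
    also have "\<dots> = (\<integral>x. (\<Sum>\<alpha>\<in>idx. t \<alpha> * H \<alpha> (base \<alpha>) x)\<^sup>2 \<partial>P)"
      unfolding power2_eq_square by (rule integral_sum_squares[OF sqH sqH, symmetric])
    finally show ?thesis using cg unfolding eq by simp
  qed
  then show "centred_gaussian N (\<lambda>w. \<Sum>\<alpha>\<in>idx. t \<alpha> * coords (W w) \<alpha>) (\<integral>x. (\<Sum>\<alpha>\<in>idx. t \<alpha> * H \<alpha> (base \<alpha>) x)\<^sup>2 \<partial>P)" .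
  assume \<alpha>: "\<alpha> \<in> idx"
  have delta: "(\<Sum>\<beta>\<in>idx. (if \<beta> = \<alpha> then 1 else 0) * q \<beta>) = q \<alpha>" for q :: "nat \<times> nat \<Rightarrow> real"
    using finite_idx \<alpha> by (simp add: if_distrib[of "\<lambda>c. c * _"] cong: if_cong)
  show "centred_gaussian N (\<lambda>w. coords (W w) \<alpha>) (\<integral>x. (H \<alpha> (base \<alpha>) x)\<^sup>2 \<partial>P)"
    using sum[of "\<lambda>\<beta>. if \<beta> = \<alpha> then 1 else 0"] unfolding delta .
qed

text \<open>Weak convergence may be tested on ramps. These are bounded and Lipschitz, so they
  tolerate a null remainder, and composed with the Lipschitz map \<open>lin\<close> they remain
  admissible in the Cramer--Wold step.\<close>

theorem plug_in_convergence:
  assumes m0: "m 0 = 1" and W: "brownian_process N P k m I f g W"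
  shows "converges_in_distribution M
    (\<lambda>n w. sqrt (real n) * (rho_emp k f g (\<lambda>l. X l w) n - rho P k f g))
    N (\<lambda>w. xi P k m f g (W w) 1 0)"
proof -
  interpret N: prob_space N using W by (simp add: brownian_process_def)
  have Y: "sqrt (real n) * (rho_emp k f g (\<lambda>l. X l w) n - rho P k f g) = zeta n w 1 0" for n w
    by (simp add: zeta_def nu_def rho_emp_def rho_def mu_def)
  have Ym: "(\<lambda>w. zeta n w 1 0) \<in> borel_measurable M" for n by (rule zeta_measurable) auto
  define V where "V w = coords (W w)" for w
  have Vm: "(\<lambda>w. V w \<alpha>) \<in> borel_measurable N" for \<alpha>
    using centred_gaussianD(1)[OF brownian_coords_gaussian(2)[OF W]] unfolding V_def
    by (cases "\<alpha> \<in> idx") (auto simp: coords_def)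
  have lm: "(\<lambda>w. lin (u w) 1 0) \<in> borel_measurable L" if "\<And>\<alpha>. (\<lambda>w. u w \<alpha>) \<in> borel_measurable L" for u L
    using that m0 by (intro lin_measurable) auto
  have Zeq: "xi P k m f g (W w) 1 0 = lin (V w) 1 0" if w: "w \<in> space N" for w
  proof -
    have ps: "W w \<in> path_space k m I" using W w by (auto simp: brownian_process_def)
    have "xi P k m f g (W w) 1 = lin (V w) 1" unfolding V_def
    proof (rule xi_eq_lin)
      fix j assume j: "j \<in> {1..k}"
      from ps have "fst (W w) \<in> (\<Pi>\<^sub>E j\<in>{1..k}. cont_funs (m j) (m (j - 1)) (I j))"
        unfolding path_space_def by (simp only: mem_Times_iff)
      from PiE_mem[OF this j] have "fst (W w) j \<in> cont_funs (m j) (m (j - 1)) (I j)" .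
      then have "continuous_map (subtopology (Euclidean_space (m j)) (I j)) (Euclidean_space (m (j - 1))) (fst (W w) j)"
        by (simp add: cont_funs_def)
      then show "fst (W w) j (mu P k f g (Suc j)) \<in> Rvec (m (j - 1))"
        by (rule funcset_mem[OF continuous_map_funspace]) (use mu_I[OF j] mu_Rvec[OF j] in simp)
    next
      show "snd (W w) \<in> Rvec (m k)" using ps by (auto simp: path_space_def mem_Times_iff)
    qed auto
    then show ?thesis by simp
  qed
  have Zm: "(\<lambda>w. xi P k m f g (W w) 1 0) \<in> borel_measurable N"
    using lm[of V N, OF Vm] by (rule measurable_cong[THEN iffD1, rotated]) (rule Zeq[symmetric])
  obtain C where C: "0 \<le> C" "\<And>u v. \<bar>lin u 1 0 - lin v 1 0\<bar> \<le> C * (\<Sum>\<alpha>\<in>idx. \<bar>u \<alpha> - v \<alpha>\<bar>)"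
    using lin_Lipschitz[of 1] m0 by auto
  have "weak_conv_m (\<lambda>n. distr M borel (\<lambda>w. zeta n w 1 0)) (distr N borel (\<lambda>w. xi P k m f g (W w) 1 0))"
  proof (rule integral_cts_step_conv_imp_weak_conv)
    show "real_distribution (distr M borel (\<lambda>w. zeta n w 1 0))" for n using Ym by (rule real_distribution_distr)
    show "real_distribution (distr N borel (\<lambda>w. xi P k m f g (W w) 1 0))" using Zm by (rule N.real_distribution_distr)
    fix x y :: real assume xy: "x < y"
    let ?\<phi> = "cts_step x y"
    have \<phi>m [measurable]: "?\<phi> \<in> borel_measurable borel"
      by (rule borel_measurable_continuous_onI[OF uniformly_continuous_imp_continuous[OF cts_step_uniformly_continuous[OF xy]]])
    \<comment> \<open>The estimator is exchanged for its linearization.\<close>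
    have D: "(\<lambda>n. expectation (\<lambda>w. ?\<phi> (zeta n w 1 0)) - expectation (\<lambda>w. ?\<phi> (lin (emp n w) 1 0))) \<longlonglongrightarrow> 0"
    proof (rule null_in_prob_Lipschitz[where \<phi> = ?\<phi> and L = "1 / (y - x)"])
      show "null_in_prob (\<lambda>n w. zeta n w 1 0 - lin (emp n w) 1 0)" using zeta_linearization[of 1] m0 by auto
      show "(\<lambda>w. lin (emp n w) 1 0) \<in> borel_measurable M" for n by (rule lm[OF emp_measurable])
    qed (rule Ym \<phi>m cts_step_bounded[OF xy] cts_step_Lipschitz[OF xy])+
    define K where "K = (\<Sum>\<alpha>\<in>idx. \<integral>x. (H \<alpha> (base \<alpha>) x)\<^sup>2 \<partial>P)"
    have K: "(\<integral>x. (H \<alpha> (base \<alpha>) x)\<^sup>2 \<partial>P) \<le> K" if "\<alpha> \<in> idx" for \<alpha>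
      unfolding K_def using that finite_idx
      by (intro member_le_sum[where f = "\<lambda>\<alpha>. \<integral>x. (H \<alpha> (base \<alpha>) x)\<^sup>2 \<partial>P"] Bochner_Integration.integral_nonneg) auto
    \<comment> \<open>The vector of empirical means is exchanged for its Gaussian limit; second
      moments are bounded by the sum \<open>K\<close> of all variances.\<close>
    have E: "(\<lambda>n. expectation (\<lambda>w. ?\<phi> (lin (emp n w) 1 0))) \<longlonglongrightarrow> (\<integral>w. ?\<phi> (lin (V w) 1 0) \<partial>N)"
    proof (rule Cramer_Wold_Lipschitz[where F = "\<lambda>u. ?\<phi> (lin u 1 0)" and S = idx and C = K and B = 1 and K = "1 / (y - x) * C"])
      show "integrable M (\<lambda>w. (emp n w \<alpha>)\<^sup>2)" "expectation (\<lambda>w. (emp n w \<alpha>)\<^sup>2) \<le> K" if \<alpha>: "\<alpha> \<in> idx" for n \<alpha>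
        using scaled_average_second_moment[OF H_square_integrable[OF \<alpha> base_pset[OF \<alpha>]] H_mean[OF \<alpha> base_pset[OF \<alpha>]], of n] K[OF \<alpha>] \<alpha>
        by (auto simp: emp_def)
      show "integrable N (\<lambda>w. (V w \<alpha>)\<^sup>2)" "(\<integral>w. (V w \<alpha>)\<^sup>2 \<partial>N) \<le> K" if \<alpha>: "\<alpha> \<in> idx" for \<alpha>
        using centred_gaussian_variance[OF brownian_coords_gaussian(2)[OF W \<alpha>]] K[OF \<alpha>] by (auto simp: V_def)
      show "(\<lambda>n. char (distr M borel (\<lambda>w. \<Sum>\<alpha>\<in>idx. t \<alpha> * emp n w \<alpha>)) 1)
          \<longlonglongrightarrow> char (distr N borel (\<lambda>w. \<Sum>\<alpha>\<in>idx. t \<alpha> * V w \<alpha>)) 1" for t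
        using emp_char[of t] centred_gaussian_char[OF brownian_coords_gaussian(1)[OF W], of t 1] by (simp add: V_def)
      show "\<bar>?\<phi> (lin u 1 0) - ?\<phi> (lin v 1 0)\<bar> \<le> 1 / (y - x) * C * (\<Sum>\<alpha>\<in>idx. \<bar>u \<alpha> - v \<alpha>\<bar>)" for u v
      proof -
        have "\<bar>?\<phi> (lin u 1 0) - ?\<phi> (lin v 1 0)\<bar> \<le> 1 / (y - x) * \<bar>lin u 1 0 - lin v 1 0\<bar>"
          by (rule cts_step_Lipschitz[OF xy])
        also have "\<dots> \<le> 1 / (y - x) * (C * (\<Sum>\<alpha>\<in>idx. \<bar>u \<alpha> - v \<alpha>\<bar>))"
          using C(2) xy by (intro mult_left_mono) auto
        finally show ?thesis by (simp only: mult.assoc)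
      qed
    qed (use finite_idx emp_measurable Vm cts_step_bounded[OF xy] prob_space_axioms N.prob_space_axioms in auto)
    have "(\<lambda>n. expectation (\<lambda>w. ?\<phi> (zeta n w 1 0))) \<longlonglongrightarrow> (\<integral>w. ?\<phi> (lin (V w) 1 0) \<partial>N)"
      using tendsto_add[OF D E] by (simp only: diff_add_cancel add_0)
    also have "(\<integral>w. ?\<phi> (lin (V w) 1 0) \<partial>N) = (\<integral>w. ?\<phi> (xi P k m f g (W w) 1 0) \<partial>N)"
      by (intro Bochner_Integration.integral_cong refl) (simp only: Zeq)
    finally show "(\<lambda>n. integral\<^sup>L (distr M borel (\<lambda>w. zeta n w 1 0)) ?\<phi>)
        \<longlonglongrightarrow> integral\<^sup>L (distr N borel (\<lambda>w. xi P k m f g (W w) 1 0)) ?\<phi>"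
      using Ym Zm by (simp add: integral_distr)
  qed
  then show ?thesis unfolding converges_in_distribution_def Y using Ym Zm by simp
qed

end

theorem theorem2p2:
  fixes M :: "'a measure"
    and \<X> :: "(real ^ 'm) set"
    and P :: "(real ^ 'm) measure"
    and X :: "nat \<Rightarrow> 'a \<Rightarrow> real ^ 'm"
    and k :: nat
    and m :: "nat \<Rightarrow> nat"
    and f :: "nat \<Rightarrow> rvec \<Rightarrow> real ^ 'm \<Rightarrow> rvec"
    and g :: "real ^ 'm \<Rightarrow> rvec"
    and I :: "nat \<Rightarrow> rvec set"
    and \<gamma> :: "nat \<Rightarrow> real ^ 'm \<Rightarrow> real"
  assumes prob_M: "prob_space M"
    and prob_P: "prob_space P"
    and sets_P: "sets P = sets (restrict_space borel \<X>)"
    and X_indep: "prob_space.indep_vars M (\<lambda>_. P) X {1..}"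
    and X_distr: "\<And>i. 1 \<le> i \<Longrightarrow> distr M P (X i) = P"
    and k: "1 \<le> k"
    and m_0: "m 0 = 1"
    and m_pos: "\<And>j. j \<in> {1..k} \<Longrightarrow> 1 \<le> m j"
    and f_range: "\<And>j \<eta> x. j \<in> {1..k} \<Longrightarrow> \<eta> \<in> Rvec (m j) \<Longrightarrow> x \<in> \<X> \<Longrightarrow> f j \<eta> x \<in> Rvec (m (j - 1))"
    and g_range: "\<And>x. x \<in> \<X> \<Longrightarrow> g x \<in> Rvec (m k)"
    and f_meas: "\<And>j. j \<in> {1..k} \<Longrightarrow>
      (\<lambda>(\<eta>, x). f j \<eta> x) \<in> restrict_space borel (Rvec (m j)) \<Otimes>\<^sub>M P \<rightarrow>\<^sub>M borel"
    and g_meas: "g \<in> P \<rightarrow>\<^sub>M borel"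
    and I_compact: "\<And>j. j \<in> {1..k} \<Longrightarrow> compactin (Euclidean_space (m j)) (I j)"
    and I_mu: "\<And>j. j \<in> {1..k} \<Longrightarrow> mu P k f g (Suc j) \<in> Euclidean_space (m j) interior_of I j"
    and f_square: "\<And>j \<eta>. j \<in> {1..k} \<Longrightarrow> \<eta> \<in> I j \<Longrightarrow>
      integrable P (\<lambda>x. (vnorm (m (j - 1)) (f j \<eta> x))\<^sup>2)"
    and g_square: "integrable P (\<lambda>x. (vnorm (m k) (g x))\<^sup>2)"
    and f_Lipschitz: "\<And>j x \<eta> \<theta>. j \<in> {1..k} \<Longrightarrow> x \<in> \<X> \<Longrightarrow> \<eta> \<in> I j \<Longrightarrow> \<theta> \<in> I j \<Longrightarrow>
      vnorm (m (j - 1)) (vdiff (f j \<eta> x) (f j \<theta> x)) \<le> \<gamma> j x * vnorm (m j) (vdiff \<eta> \<theta>)"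
    and \<gamma>_square: "\<And>j. j \<in> {1..k} \<Longrightarrow> integrable P (\<lambda>x. (\<gamma> j x)\<^sup>2)"
    and f_Hadamard: "\<And>j x \<eta>. j \<in> {1..k} \<Longrightarrow> x \<in> \<X> \<Longrightarrow> \<eta> \<in> I j \<Longrightarrow>
      hadamard_differentiable_at (m j) (m (j - 1)) (\<lambda>\<eta>. f j \<eta> x) \<eta>"
  shows "(\<exists>(N :: path measure) W. brownian_process N P k m I f g W \<and>
            converges_in_distribution M
              (\<lambda>n \<omega>. sqrt (real n) * (rho_emp k f g (\<lambda>l. X l \<omega>) n - rho P k f g))
              N (\<lambda>w. xi P k m f g (W w) 1 0)) \<and>
         (\<forall>(N :: 'w measure) W. brownian_process N P k m I f g W \<longrightarrow>
            converges_in_distribution M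
              (\<lambda>n \<omega>. sqrt (real n) * (rho_emp k f g (\<lambda>l. X l \<omega>) n - rho P k f g))
              N (\<lambda>w. xi P k m f g (W w) 1 0))"
proof (intro conjI allI impI)
  have sp: "space P = \<X>"
    using sets_eq_imp_space_eq[OF sets_P] by (simp add: space_restrict_space)
  have "composite_functional P k m f g I \<gamma>"
    by (rule composite_functional.intro; (unfold sp)?) (fact assms)+
  moreover have "iid_sample M P X"
    using prob_M X_indep X_distr by (simp add: iid_sample_def iid_sample_axioms_def)
  ultimately interpret composite_sample P k m f g I \<gamma> M X
    by (simp add: composite_sample_def)
  \<comment> \<open>Convergence holds for every process with the stated properties; the one
    constructed from white noise provides an instance.\<close>
  show "\<exists>(N :: path measure) W. brownian_process N P k m I f g W \<and>
      converges_in_distribution M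
        (\<lambda>n \<omega>. sqrt (real n) * (rho_emp k f g (\<lambda>l. X l \<omega>) n - rho P k f g))
        N (\<lambda>w. xi P k m f g (W w) 1 0)"
    using brownian_process_exists plug_in_convergence[OF m_0] by blast
  fix N :: "'w measure" and W
  assume "brownian_process N P k m I f g W"
  then show "converges_in_distribution M
      (\<lambda>n \<omega>. sqrt (real n) * (rho_emp k f g (\<lambda>l. X l \<omega>) n - rho P k f g))
      N (\<lambda>w. xi P k m f g (W w) 1 0)"
    by (rule plug_in_convergence[OF m_0])
qed

end
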